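(* Let $r,s_1,s_2$ be integers with $1\le s_2<r$ and $s_1\ge1$, let $\rho\ge\max(r,s_1)$ be an integer, and consider the cross-neighborhood growth dynamics of range $\rho$ with the infinite zero-set $\mathcal Z$ given by the minimal counts $(0,r)$ and $(s_1,s_2)$, that is, $$\mathcal Z=\{(u,v)\in\mathbb Z_+^2:\ v<r\ \text{and}\ (u<s_1\text{ or }v<s_2)\}.$$ Then the critical power of $\mathcal Z$ exists, is pure, and equals $$\gamma_c=\frac{rs_1+s_2}{1+s_1}.$$
   Context: Let $\mathbb Z_+=\{0,1,2,\dots\}$. A zero-set is a set $\mathcal Z\subseteq\mathbb Z_+^2$ such that $(u,v)\in\mathcal Z$ implies $([0,u]\times[0,v])\cap\mathbb Z_+^2\subseteq\mathcal Z$. Its minimal counts are the pairs $(u_0,v_0)\in\mathbb Z_+^2\setminus\mathcal Z$ such that both $(u_0-1,v_0)$ and $(u_0,v_0-1)$ lie in $\mathcal Z\cup(\mathbb Z_+^2)^c$. Given an integer range $\rho$, for $x\in\mathbb Z^2$ let $\mathcal N^h_x=x+([-\rho,\rho]\cap\mathbb Z)\times\{0\}$ and $\mathcal N^v_x=x+\{0\}\times([-\rho,\rho]\cap\mathbb Z)$. Given $\xi_0\subseteq\mathbb Z^2$, define recursively, for $t\in\mathbb Z_+$, $$\xi_{t+1}=\xi_t\cup\{x\in\mathbb Z^2:(|\mathcal N_x^h\cap\xi_t|,|\mathcal N_x^v\cap\xi_t|)\notin\mathcal Z\}.$$ Each $x\in\mathbb Z^2$ is included in $\xi_0$ independently with probability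 $p\in[0,1]$, and $T=\inf\{t\ge0:(0,0)\in\xi_t\}$. For a deterministic $a=a(p)$ and nonnegative random variables $X=X(p)$: $X\lesssim a$ means $\lim_{\lambda\to\infty}\limsup_{p\to0}\mathbb P(X\ge\lambda a)=0$; $X\gtrsim a$ means $\lim_{\lambda\to0}\limsup_{p\to0}\mathbb P(X\le\lambda a)=0$; $X\asymp a$ means both. A number $\gamma>0$ is a lower power (resp. upper power) for $\mathcal Z$ if for every $\epsilon>0$, $T\gtrsim p^{-(\gamma-\epsilon)}$ (resp. $T\lesssim p^{-(\gamma+\epsilon)}$). The critical power $\gamma_c=\gamma_c(\mathcal Z)$ is a number that is both a lower and an upper power; it is pure if $T\asymp p^{-\gamma_c}$. *)

theory Defs
  imports "HOL-Probability.Probability"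
begin

definition zero_set :: "(nat \<times> nat) set \<Rightarrow> bool" where
  "zero_set Z \<longleftrightarrow> (\<forall>(u, v)\<in>Z. {0..u} \<times> {0..v} \<subseteq> Z)"

(* The condition "(u - 1, v) is in Z or outside the nonnegative quadrant" is
   rendered as "u = 0 or (u - 1, v) is in Z", since subtraction on nat truncates. *)
definition minimal_counts :: "(nat \<times> nat) set \<Rightarrow> (nat \<times> nat) set" where
  "minimal_counts Z =
     {(u, v). (u, v) \<notin> Z \<and> (u = 0 \<or> (u - 1, v) \<in> Z) \<and> (v = 0 \<or> (u, v - 1) \<in> Z)}"

definition nbhd_h :: "nat \<Rightarrow> int \<times> int \<Rightarrow> (int \<times> int) set" where
  "nbhd_h \<rho> x = (\<lambda>y. x + y) ` ({- int \<rho>..int \<rho>} \<times> {0})"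

definition nbhd_v :: "nat \<Rightarrow> int \<times> int \<Rightarrow> (int \<times> int) set" where
  "nbhd_v \<rho> x = (\<lambda>y. x + y) ` ({0} \<times> {- int \<rho>..int \<rho>})"

primrec growth ::
  "nat \<Rightarrow> (nat \<times> nat) set \<Rightarrow> (int \<times> int) set \<Rightarrow> nat \<Rightarrow> (int \<times> int) set" where
  "growth \<rho> Z \<xi>\<^sub>0 0 = \<xi>\<^sub>0"
| "growth \<rho> Z \<xi>\<^sub>0 (Suc t) = growth \<rho> Z \<xi>\<^sub>0 t \<union>
     {x. (card (nbhd_h \<rho> x \<inter> growth \<rho> Z \<xi>\<^sub>0 t), card (nbhd_v \<rho> x \<inter> growth \<rho> Z \<xi>\<^sub>0 t)) \<notin> Z}"

(* Law of the random initial set, encoded by its indicator function on the lattice. *)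
definition init_measure :: "real \<Rightarrow> (int \<times> int \<Rightarrow> bool) measure" where
  "init_measure p = PiM UNIV (\<lambda>_. measure_pmf (bernoulli_pmf p))"

(* Equals infinity if the origin is never occupied. *)
definition hit_time :: "nat \<Rightarrow> (nat \<times> nat) set \<Rightarrow> (int \<times> int \<Rightarrow> bool) \<Rightarrow> ennreal" where
  "hit_time \<rho> Z \<omega> = (INF t\<in>{t. (0, 0) \<in> growth \<rho> Z {x. \<omega> x} t}. of_nat t)"

definition prob_lesssim ::
  "(real \<Rightarrow> 'a measure) \<Rightarrow> (real \<Rightarrow> 'a \<Rightarrow> ennreal) \<Rightarrow> (real \<Rightarrow> real) \<Rightarrow> bool" where
  "prob_lesssim M X a \<longleftrightarrow>
     ((\<lambda>l::real. Limsup (at_right 0)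
        (\<lambda>p. ereal (measure (M p) {\<omega> \<in> space (M p). X p \<omega> \<ge> ennreal (l * a p)}))) \<longlongrightarrow> 0) at_top"

definition prob_gtrsim ::
  "(real \<Rightarrow> 'a measure) \<Rightarrow> (real \<Rightarrow> 'a \<Rightarrow> ennreal) \<Rightarrow> (real \<Rightarrow> real) \<Rightarrow> bool" where
  "prob_gtrsim M X a \<longleftrightarrow>
     ((\<lambda>l::real. Limsup (at_right 0)
        (\<lambda>p. ereal (measure (M p) {\<omega> \<in> space (M p). X p \<omega> \<le> ennreal (l * a p)}))) \<longlongrightarrow> 0) (at_right 0)"

definition prob_asymp ::
  "(real \<Rightarrow> 'a measure) \<Rightarrow> (real \<Rightarrow> 'a \<Rightarrow> ennreal) \<Rightarrow> (real \<Rightarrow> real) \<Rightarrow> bool" where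
  "prob_asymp M X a \<longleftrightarrow> prob_lesssim M X a \<and> prob_gtrsim M X a"

definition lower_power :: "nat \<Rightarrow> (nat \<times> nat) set \<Rightarrow> real \<Rightarrow> bool" where
  "lower_power \<rho> Z \<gamma> \<longleftrightarrow> \<gamma> > 0 \<and>
     (\<forall>\<epsilon>>0. prob_gtrsim init_measure (\<lambda>_. hit_time \<rho> Z) (\<lambda>p. p powr (- (\<gamma> - \<epsilon>))))"

definition upper_power :: "nat \<Rightarrow> (nat \<times> nat) set \<Rightarrow> real \<Rightarrow> bool" where
  "upper_power \<rho> Z \<gamma> \<longleftrightarrow> \<gamma> > 0 \<and>
     (\<forall>\<epsilon>>0. prob_lesssim init_measure (\<lambda>_. hit_time \<rho> Z) (\<lambda>p. p powr (- (\<gamma> + \<epsilon>))))"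

definition is_critical_power :: "nat \<Rightarrow> (nat \<times> nat) set \<Rightarrow> real \<Rightarrow> bool" where
  "is_critical_power \<rho> Z \<gamma> \<longleftrightarrow> lower_power \<rho> Z \<gamma> \<and> upper_power \<rho> Z \<gamma>"

definition critical_power :: "nat \<Rightarrow> (nat \<times> nat) set \<Rightarrow> real" where
  "critical_power \<rho> Z = (THE \<gamma>. is_critical_power \<rho> Z \<gamma>)"

definition critical_power_pure :: "nat \<Rightarrow> (nat \<times> nat) set \<Rightarrow> bool" where
  "critical_power_pure \<rho> Z \<longleftrightarrow>
     prob_asymp init_measure (\<lambda>_. hit_time \<rho> Z) (\<lambda>p. p powr (- critical_power \<rho> Z))"

lemma zero_set_alt: "zero_set Z \<longleftrightarrow> (\<forall>u v u' v'. (u, v) \<in> Z \<longrightarrow> u' \<le> u \<longrightarrow> v' \<le> v \<longrightarrow> (u', v') \<in> Z)"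
  unfolding zero_set_def by (simp add: subset_iff Ball_def) blast

lemma exists_minimal_count:
  assumes "(u, v) \<notin> Z"
  shows "\<exists>(u', v')\<in>minimal_counts Z. u' \<le> u \<and> v' \<le> v"
  using assms
proof (induction "u + v" arbitrary: u v rule: less_induct)
  case less
  show ?case
  proof (cases "(u, v) \<in> minimal_counts Z")
    case True
    then show ?thesis by blast
  next
    case False
    then have "(u > 0 \<and> (u - 1, v) \<notin> Z) \<or> (v > 0 \<and> (u, v - 1) \<notin> Z)"
      using less.prems by (auto simp: minimal_counts_def)
    then show ?thesis
    proof
      assume "u > 0 \<and> (u - 1, v) \<notin> Z"
      then obtain u' v' where "(u', v') \<in> minimal_counts Z" "u' \<le> u - 1" "v' \<le> v"
        using less.hyps[of "u - 1" v] by auto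
      moreover from this have "u' \<le> u" by linarith
      ultimately show ?thesis by blast
    next
      assume "v > 0 \<and> (u, v - 1) \<notin> Z"
      then obtain u' v' where "(u', v') \<in> minimal_counts Z" "u' \<le> u" "v' \<le> v - 1"
        using less.hyps[of u "v - 1"] by auto
      moreover from this have "v' \<le> v" by linarith
      ultimately show ?thesis by blast
    qed
  qed
qed

lemma zero_set_two_minimal_counts_iff:
  fixes r s1 s2 :: nat
  assumes "1 \<le> s2" "s2 < r" "1 \<le> s1"
  shows "zero_set Z \<and> minimal_counts Z = {(0, r), (s1, s2)} \<longleftrightarrow>
           Z = {(u, v). v < r \<and> (u < s1 \<or> v < s2)}" (is "?L \<longleftrightarrow> Z = ?Z")
proof
  assume L: ?L
  then have down: "\<And>u v u' v'. (u, v) \<in> Z \<Longrightarrow> u' \<le> u \<Longrightarrow> v' \<le> v \<Longrightarrow> (u', v') \<in> Z"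
    and mc: "minimal_counts Z = {(0, r), (s1, s2)}"
    by (auto simp only: zero_set_alt)
  have "(0, r) \<in> minimal_counts Z" "(s1, s2) \<in> minimal_counts Z"
    by (simp_all add: mc)
  then have nin: "(0, r) \<notin> Z" "(s1, s2) \<notin> Z"
    by (simp_all add: minimal_counts_def)
  have "(u, v) \<in> Z \<longleftrightarrow> v < r \<and> (u < s1 \<or> v < s2)" for u v
  proof
    assume "(u, v) \<in> Z"
    then have "\<not> r \<le> v" "\<not> (s1 \<le> u \<and> s2 \<le> v)"
      using nin down[of u v 0 r] down[of u v s1 s2] by blast+
    then show "v < r \<and> (u < s1 \<or> v < s2)" by linarith
  next
    assume *: "v < r \<and> (u < s1 \<or> v < s2)"
    show "(u, v) \<in> Z"
    proof (rule ccontr)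
      assume "(u, v) \<notin> Z"
      from exists_minimal_count[OF this] have "r \<le> v \<or> (s1 \<le> u \<and> s2 \<le> v)"
        by (simp add: mc)
      with * show False by linarith
    qed
  qed
  then show "Z = ?Z" by auto
next
  assume Z: "Z = ?Z"
  have "zero_set ?Z" unfolding zero_set_alt by auto
  moreover have "x \<in> minimal_counts ?Z \<longleftrightarrow> x \<in> {(0, r), (s1, s2)}" for x
  proof (cases x)
    case (Pair u v)
    have "(\<not> (v < r \<and> (u < s1 \<or> v < s2)) \<and> (u = 0 \<or> v < r \<and> (u - 1 < s1 \<or> v < s2))
             \<and> (v = 0 \<or> v - 1 < r \<and> (u < s1 \<or> v - 1 < s2)))
          \<longleftrightarrow> (u = 0 \<and> v = r) \<or> (u = s1 \<and> v = s2)"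
      using assms by arith
    then show ?thesis
      unfolding minimal_counts_def Pair by simp
  qed
  ultimately show ?L unfolding Z by blast
qed

lemma finite_nbhd [simp]: "finite (nbhd_h \<rho> x)" "finite (nbhd_v \<rho> x)"
  by (auto simp: nbhd_h_def nbhd_v_def)

lemma measurable_card_inter:
  assumes "finite N" "\<And>x. x \<in> N \<Longrightarrow> Measurable.pred M (\<lambda>\<omega>. x \<in> A \<omega>)"
  shows "(\<lambda>\<omega>. card (N \<inter> A \<omega>)) \<in> measurable M (count_space UNIV)"
proof -
  have "card (N \<inter> A \<omega>) = (\<Sum>x\<in>N. if x \<in> A \<omega> then 1 else 0)" for \<omega>
    using assms(1) by (simp add: sum.If_cases Int_def)
  moreover have "(\<lambda>\<omega>. \<Sum>x\<in>N. if x \<in> A \<omega> then 1 else (0::nat)) \<in> measurable M (count_space UNIV)"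
    using assms(2) by (intro measurable_sum_nat measurable_If) auto
  ultimately show ?thesis by simp
qed

lemma measurable_growth:
  "Measurable.pred (init_measure p) (\<lambda>\<omega>. x \<in> growth \<rho> Z {x. \<omega> x} t)"
proof (induction t arbitrary: x)
  case 0
  show ?case unfolding init_measure_def growth.simps mem_Collect_eq
    by (rule measurable_compose[OF measurable_component_singleton]) auto
next
  case (Suc t)
  have "(\<lambda>\<omega>. card (nbhd_h \<rho> x \<inter> growth \<rho> Z {x. \<omega> x} t)) \<in> measurable (init_measure p) (count_space UNIV)"
       "(\<lambda>\<omega>. card (nbhd_v \<rho> x \<inter> growth \<rho> Z {x. \<omega> x} t)) \<in> measurable (init_measure p) (count_space UNIV)"
    by (intro measurable_card_inter Suc.IH; simp)+
  note [measurable] = this Suc.IH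
  show ?case by simp
qed

lemma measurable_hit_time: "hit_time \<rho> Z \<in> borel_measurable (init_measure p)"
proof -
  have "hit_time \<rho> Z = (\<lambda>\<omega>. INF t. if (0, 0) \<in> growth \<rho> Z {x. \<omega> x} t then of_nat t else \<top>)"
  proof
    fix \<omega>
    show "hit_time \<rho> Z \<omega> = (INF t. if (0, 0) \<in> growth \<rho> Z {x. \<omega> x} t then of_nat t else \<top>)"
      unfolding hit_time_def
    proof (rule antisym; rule INF_greatest)
      fix t
      show "(INF t\<in>{t. (0, 0) \<in> growth \<rho> Z {x. \<omega> x} t}. of_nat t)
              \<le> (if (0, 0) \<in> growth \<rho> Z {x. \<omega> x} t then of_nat t else (\<top>::ennreal))"
        by (simp add: INF_lower)
    next
      fix t assume "t \<in> {t. (0, 0) \<in> growth \<rho> Z {x. \<omega> x} t}"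
      then show "(INF t. if (0, 0) \<in> growth \<rho> Z {x. \<omega> x} t then of_nat t else (\<top>::ennreal)) \<le> of_nat t"
        by (intro INF_lower2[of t]) auto
    qed
  qed
  moreover have "\<dots> \<in> borel_measurable (init_measure p)"
    using measurable_growth[where p = p and x = "(0, 0)" and \<rho> = \<rho> and Z = Z]
    by (intro borel_measurable_INF measurable_If measurable_const) (auto simp: pred_def)
  ultimately show ?thesis by metis
qed

end

(* Write gam = (r s1 + s2) / (1 + s1), so that p^s2 a (p^r a)^s1 = 1 for a = p^-gam.

   Upper bound.  A column with r consecutive occupied sites fills at speed one, and next to s1 full
   columns a column fills once it contains s2 consecutive occupied sites.  Within height a and width
   p^s2 a, up to constants, there are s1 adjacent columns with an r-block, and the waiting times for
   s2-blocks on the way from there to the origin have total mean of order a.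

   Lower bound.  Initially occupied sites are grouped into bounded classes, so far apart that growth
   outside full columns stays in the grid (columns times rows) of a single class.  Filling s1 nearby
   columns by means of k classes requires at least k r + (s1 - k) (r - s2) / (s1 + 1) sites, which is
   unlikely within width p^s2 a and height a.  If it does not happen, then the full columns together
   with the grids contain a stable set.  The growth can then leave this set at the origin only along
   a chain of sites that leads across the whole width, each chain site having s2 occupied sites
   nearby.  The number of short chains is bounded by an exponential Markov inequality for their total
   vertical length. *)
theory Submission
  imports Defs
begin

section \<open>The initial configuration\<close>

text \<open>The charge \<open>(r - s2) / (s1 + 1)\<close> is exactly \<open>r - gam\<close>. A class
  placed freely within height \<open>a\<close> contributes \<open>p^r a = p^(r - gam)\<close>, and
  every further full column that it creates is charged the same factor. Hence the weights for all
  \<open>k\<close> from 1 to \<open>s1\<close> are at most of the common order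
  \<open>p^(s1 (r - gam))\<close>, which the width \<open>p^s2 a\<close> compensates exactly. No
  power of \<open>p\<close> and no logarithm is lost, and this is what gives purity. The difficulty
  is that full columns help each other: a row of a class may use nearby full columns as horizontal
  neighbors, so a later column can be cheaper than an earlier one. The cost therefore has to be
  counted over a whole cluster of columns, in the order in which they fill. For the chains, a free
  choice of a height for each of about \<open>p^s2 a\<close> links would be far too many choices.
  The finite speed of growth limits their total vertical length to order \<open>a\<close>, which
  leaves about \<open>p^-s2\<close> heights per link, and this is what the cost \<open>p^s2\<close>
  of a link can balance.\<close>

lemma prob_space_init: "prob_space (init_measure p)"
  unfolding init_measure_def by (intro prob_space_PiM prob_space_measure_pmf)

lemma space_init [simp]: "space (init_measure p) = UNIV"
  by (simp add: init_measure_def space_PiM PiE_UNIV_domain)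

lemma measurable_coordinate [measurable]: "Measurable.pred (init_measure p) (\<lambda>\<omega>. \<omega> i)"
  unfolding init_measure_def by (rule measurable_compose[OF measurable_component_singleton]) auto

lemma prob_cylinder:
  assumes "finite F" "0 \<le> p" "p \<le> 1"
  shows "measure (init_measure p) {\<omega>. \<forall>i\<in>F. \<omega> i} = p ^ card F"
proof -
  interpret product_prob_space "\<lambda>_::int \<times> int. measure_pmf (bernoulli_pmf p)" UNIV
    by unfold_locales
  have "emeasure (init_measure p) {\<omega>\<in>space (init_measure p). \<forall>i\<in>F. \<omega> i \<in> {True}}
      = (\<Prod>i\<in>F. emeasure (measure_pmf (bernoulli_pmf p)) {True})"
    unfolding init_measure_def by (rule emeasure_PiM_Collect) (use assms in auto)
  also have "\<dots> = ennreal p ^ card F"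
    using assms by (simp add: emeasure_pmf_single)
  finally show ?thesis
    using assms by (simp add: measure_def ennreal_power)
qed

text \<open>All probabilities in the lower bound are estimated through this union bound: a bad event
  is covered by finitely many patterns of occupied sites, and only the number and the sizes of the
  patterns matter.\<close>

lemma prob_Un_cylinders:
  assumes "finite \<F>" "\<And>F. F \<in> \<F> \<Longrightarrow> finite F" "0 \<le> p" "p \<le> 1"
    and "\<And>\<omega>. \<omega> \<in> A \<Longrightarrow> \<exists>F\<in>\<F>. \<forall>i\<in>F. \<omega> i"
  shows "measure (init_measure p) A \<le> (\<Sum>F\<in>\<F>. p ^ card F)"
proof -
  interpret prob_space "init_measure p" by (rule prob_space_init)
  have m: "{\<omega>. \<forall>i\<in>F. \<omega> i} \<in> events" if "F \<in> \<F>" for F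
  proof -
    have "{\<omega>\<in>space (init_measure p). \<forall>i\<in>F. \<omega> i} \<in> events"
      using assms(2)[OF that] by measurable
    then show ?thesis by simp
  qed
  have "prob A \<le> prob (\<Union>F\<in>\<F>. {\<omega>. \<forall>i\<in>F. \<omega> i})"
    using assms(1,5) m by (intro finite_measure_mono) auto
  also have "\<dots> \<le> (\<Sum>F\<in>\<F>. prob {\<omega>. \<forall>i\<in>F. \<omega> i})"
    using assms(1) m by (intro finite_measure_subadditive_finite) auto
  also have "\<dots> = (\<Sum>F\<in>\<F>. p ^ card F)"
    using assms by (intro sum.cong refl prob_cylinder) auto
  finally show ?thesis .
qed

section \<open>Independence of events on disjoint finite sets of sites\<close>

lemma indep_coordinates:
  "prob_space.indep_vars (init_measure p) (\<lambda>_. measure_pmf (bernoulli_pmf p)) (\<lambda>i \<omega>. \<omega> i) UNIV"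
proof -
  interpret prob_space "init_measure p" by (rule prob_space_init)
  interpret P: product_prob_space "\<lambda>_::int \<times> int. measure_pmf (bernoulli_pmf p)" UNIV
    by unfold_locales
  have "distr (init_measure p) (measure_pmf (bernoulli_pmf p)) (\<lambda>\<omega>. \<omega> i) = measure_pmf (bernoulli_pmf p)" for i
    unfolding init_measure_def by (rule P.PiM_component) simp
  moreover have "random_variable (measure_pmf (bernoulli_pmf p)) (\<lambda>\<omega>. \<omega> i)" for i
    unfolding init_measure_def by (rule measurable_component_singleton) simp
  ultimately show ?thesis
    by (subst indep_vars_iff_distr_eq_PiM') 
      (auto simp: restrict_UNIV init_measure_def distr_id2)
qed

text \<open>Over a finite \<open>K\<close> the product sigma-algebra is discrete, so every predicate
  determined by the coordinates in \<open>K\<close> is an event. Dependence on \<open>K\<close> is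
  phrased as invariance under agreement on \<open>K\<close>, which is easy to verify for concrete
  predicates.\<close>

lemma finite_coordinates_event:
  assumes K: "finite K" and Q: "\<And>\<omega> \<omega>'. (\<And>i. i \<in> K \<Longrightarrow> \<omega> i = \<omega>' i) \<Longrightarrow> Q \<omega> = Q \<omega>'"
  shows "{f \<in> extensional K. Q f} \<in> sets (PiM K (\<lambda>_. measure_pmf (bernoulli_pmf p)))"
    and "(\<lambda>\<omega>. restrict \<omega> K) -` {f \<in> extensional K. Q f} = {\<omega>. Q \<omega>}"
    and "{\<omega>. Q \<omega>} \<in> sets (init_measure p)"
proof -
  have "sets (PiM K (\<lambda>_. measure_pmf (bernoulli_pmf p))) = sets (count_space (PiE K (\<lambda>_. UNIV)))"
    using K by (subst count_space_PiM_finite[symmetric]) (auto intro!: sets_PiM_cong)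
  then show A: "{f \<in> extensional K. Q f} \<in> sets (PiM K (\<lambda>_. measure_pmf (bernoulli_pmf p)))"
    by (auto simp: PiE_def)
  show eq: "(\<lambda>\<omega>. restrict \<omega> K) -` {f \<in> extensional K. Q f} = {\<omega>. Q \<omega>}"
  proof (intro set_eqI)
    fix \<omega>
    have "Q (restrict \<omega> K) = Q \<omega>" by (rule Q) simp
    then show "\<omega> \<in> (\<lambda>\<omega>. restrict \<omega> K) -` {f \<in> extensional K. Q f} \<longleftrightarrow> \<omega> \<in> {\<omega>. Q \<omega>}" by simp
  qed
  have "(\<lambda>\<omega>. restrict \<omega> K) \<in> measurable (init_measure p) (PiM K (\<lambda>_. measure_pmf (bernoulli_pmf p)))"
    unfolding init_measure_def by (rule measurable_restrict_subset) simp
  from measurable_sets[OF this A] show "{\<omega>. Q \<omega>} \<in> sets (init_measure p)"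
    by (simp only: eq space_init Int_UNIV_right)
qed

text \<open>The restrictions of the configuration to disjoint sets of sites are independent, and
  each \<open>Q j\<close> is a function of one of them.\<close>

lemma prob_indep:
  assumes L: "finite L" and fK: "\<And>j. j \<in> L \<Longrightarrow> finite (K j)" and K: "disjoint_family_on K L"
    and Q: "\<And>j \<omega> \<omega>'. j \<in> L \<Longrightarrow> (\<And>i. i \<in> K j \<Longrightarrow> \<omega> i = \<omega>' i) \<Longrightarrow> Q j \<omega> = Q j \<omega>'"
  shows "measure (init_measure p) {\<omega>. \<forall>j\<in>L. Q j \<omega>} = (\<Prod>j\<in>L. measure (init_measure p) {\<omega>. Q j \<omega>})"
proof (cases "L = {}")
  case True
  then show ?thesis using prob_space.prob_space[OF prob_space_init[of p]] by simp
next
  case False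
  interpret prob_space "init_measure p" by (rule prob_space_init)
  have "indep_vars (\<lambda>j. PiM (K j) (\<lambda>_. measure_pmf (bernoulli_pmf p))) (\<lambda>j \<omega>. restrict \<omega> (K j)) L"
    using indep_vars_restrict[OF indep_coordinates _ K] by simp
  note ind = indep_varsD[OF this False L order.refl]
  let ?A = "\<lambda>j. {f \<in> extensional (K j). Q j f}"
  have eq: "(\<lambda>\<omega>. restrict \<omega> (K j)) -` ?A j \<inter> space (init_measure p) = {\<omega>. Q j \<omega>}" if "j \<in> L" for j
    by (subst finite_coordinates_event(2)[OF fK[OF that]]) (use Q[OF that] in blast, simp)
  have "{\<omega>. \<forall>j\<in>L. Q j \<omega>} = (\<Inter>j\<in>L. (\<lambda>\<omega>. restrict \<omega> (K j)) -` ?A j \<inter> space (init_measure p))"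
    using eq False by auto
  also have "prob \<dots> = (\<Prod>j\<in>L. prob ((\<lambda>\<omega>. restrict \<omega> (K j)) -` ?A j \<inter> space (init_measure p)))"
  proof (rule ind)
    fix j assume j: "j \<in> L"
    show "?A j \<in> sets (PiM (K j) (\<lambda>_. measure_pmf (bernoulli_pmf p)))"
      by (rule finite_coordinates_event(1)[OF fK[OF j]]) (rule Q[OF j])
  qed
  also have "\<dots> = (\<Prod>j\<in>L. prob {\<omega>. Q j \<omega>})"
    by (intro prod.cong refl) (simp only: eq)
  finally show ?thesis .
qed

section \<open>Deterministic growth from a front\<close>

lemma nbhd_h_eq: "nbhd_h \<rho> (x, y) = {x - int \<rho>..x + int \<rho>} \<times> {y}"
proof -
  have "u \<in> (\<lambda>w. (x, y) + w) ` ({- int \<rho>..int \<rho>} \<times> {0})" if "u \<in> {x - int \<rho>..x + int \<rho>} \<times> {y}" for u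
    using that by (intro image_eqI[of _ _ "u - (x, y)"]) (auto simp: prod_eq_iff)
  then show ?thesis by (auto simp: nbhd_h_def)
qed

lemma nbhd_v_eq: "nbhd_v \<rho> (x, y) = {x} \<times> {y - int \<rho>..y + int \<rho>}"
proof -
  have "u \<in> (\<lambda>w. (x, y) + w) ` ({0} \<times> {- int \<rho>..int \<rho>})" if "u \<in> {x} \<times> {y - int \<rho>..y + int \<rho>}" for u
    using that by (intro image_eqI[of _ _ "u - (x, y)"]) (auto simp: prod_eq_iff)
  then show ?thesis by (auto simp: nbhd_v_def)
qed

lemma growth_mono: "s \<le> t \<Longrightarrow> growth \<rho> Z \<xi> s \<subseteq> growth \<rho> Z \<xi> t"
  by (rule lift_Suc_mono_le[of "growth \<rho> Z \<xi>"]) auto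

declare growth.simps(2) [simp del]

lemma growth_monoD: "x \<in> growth \<rho> Z \<xi> s \<Longrightarrow> s \<le> t \<Longrightarrow> x \<in> growth \<rho> Z \<xi> t"
  using growth_mono by blast

lemma card_nbhd_v_ge:
  assumes "\<And>i. i < k \<Longrightarrow> (x, a + int i) \<in> A" "y - int \<rho> \<le> a" "a + int k \<le> y + int \<rho> + 1"
  shows "k \<le> card (nbhd_v \<rho> (x, y) \<inter> A)"
proof -
  have "(\<lambda>i. (x, a + int i)) ` {..<k} \<subseteq> nbhd_v \<rho> (x, y) \<inter> A"
    using assms by (auto simp: nbhd_v_eq)
  then have "card ((\<lambda>i. (x, a + int i)) ` {..<k}) \<le> card (nbhd_v \<rho> (x, y) \<inter> A)"
    by (intro card_mono) auto
  then show ?thesis by (simp add: card_image inj_on_def)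
qed

lemma card_nbhd_h_ge:
  assumes "\<And>i. i < k \<Longrightarrow> (a + int i, y) \<in> A" "x - int \<rho> \<le> a" "a + int k \<le> x + int \<rho> + 1"
  shows "k \<le> card (nbhd_h \<rho> (x, y) \<inter> A)"
proof -
  have "(\<lambda>i. (a + int i, y)) ` {..<k} \<subseteq> nbhd_h \<rho> (x, y) \<inter> A"
    using assms by (auto simp: nbhd_h_eq)
  then have "card ((\<lambda>i. (a + int i, y)) ` {..<k}) \<le> card (nbhd_h \<rho> (x, y) \<inter> A)"
    by (intro card_mono) auto
  then show ?thesis by (simp add: card_image inj_on_def)
qed

locale cross_growth =
  fixes r s1 s2 \<rho> :: nat
  assumes s2_pos: "1 \<le> s2" and s2_less: "s2 < r" and s1_pos: "1 \<le> s1"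
    and r_le: "r \<le> \<rho>" and s1_le: "s1 \<le> \<rho>"
begin

definition corner_zeros :: "(nat \<times> nat) set" where
  "corner_zeros = {(u, v). v < r \<and> (u < s1 \<or> v < s2)}"

abbreviation grown :: "(int \<times> int) set \<Rightarrow> nat \<Rightarrow> (int \<times> int) set" where
  "grown \<equiv> growth \<rho> corner_zeros"

lemma grown_Suc_iff:
  "x \<in> grown \<xi> (Suc t) \<longleftrightarrow> x \<in> grown \<xi> t \<or> r \<le> card (nbhd_v \<rho> x \<inter> grown \<xi> t)
     \<or> s1 \<le> card (nbhd_h \<rho> x \<inter> grown \<xi> t) \<and> s2 \<le> card (nbhd_v \<rho> x \<inter> grown \<xi> t)"
  by (auto simp: growth.simps(2) corner_zeros_def)

lemma initial_grown: "x \<in> \<xi> \<Longrightarrow> x \<in> grown \<xi> t"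
  using growth_mono[of 0 t] by auto

text \<open>A front moves away from the block in both directions by one site per step: the
  \<open>r\<close> sites directly behind the next site are occupied one step earlier, and they are
  visible because \<open>r \<le> \<rho>\<close>.\<close>

lemma column_fill:
  assumes "\<And>i. i < r \<Longrightarrow> (k, h + int i) \<in> \<xi>"
  shows "(k, y) \<in> grown \<xi> (nat \<bar>y - h\<bar>)"
proof -
  have up: "(k, h + int m) \<in> grown \<xi> m" for m
  proof (induction m rule: less_induct)
    case (less m)
    show ?case
    proof (cases "m < r")
      case True
      then show ?thesis using assms initial_grown by blast
    next
      case False
      then obtain m' where m: "m = Suc m'" using s2_less by (cases m) auto
      have "r \<le> card (nbhd_v \<rho> (k, h + int m) \<inter> grown \<xi> m')"
      proof (rule card_nbhd_v_ge[where a = "h + int (m - r)"])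
        fix i assume "i < r"
        then have "(k, h + int (m - r + i)) \<in> grown \<xi> (m - r + i)"
          using False by (intro less) auto
        then show "(k, h + int (m - r) + int i) \<in> grown \<xi> m'"
          using \<open>i < r\<close> False m by (auto intro: growth_monoD simp: algebra_simps)
      qed (use False r_le in auto)
      then show ?thesis unfolding m grown_Suc_iff by blast
    qed
  qed
  have down: "(k, h - int m) \<in> grown \<xi> m" for m
  proof (induction m rule: less_induct)
    case (less m)
    show ?case
    proof (cases m)
      case 0
      then show ?thesis using assms[of 0] s2_less by auto
    next
      case (Suc m')
      have "r \<le> card (nbhd_v \<rho> (k, h - int m) \<inter> grown \<xi> m')"
      proof (rule card_nbhd_v_ge[where a = "h - int m + 1"])
        fix i assume i: "i < r"
        show "(k, h - int m + 1 + int i) \<in> grown \<xi> m'"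
        \<comment> \<open>The \<open>i\<close>-th site above the target lies either below
          \<open>h\<close>, where the induction hypothesis applies, or in the initial block.\<close>
        proof (cases "i < m'")
          case True
          then have "(k, h - int (m' - i)) \<in> grown \<xi> (m' - i)"
            using Suc by (intro less) auto
          then have "(k, h - int (m' - i)) \<in> grown \<xi> m'"
            by (rule growth_monoD) simp
          then show ?thesis using Suc True by (simp add: of_nat_diff algebra_simps)
        next
          case False
          then have "(k, h + int (i - m')) \<in> grown \<xi> m'"
            using assms[of "i - m'"] i initial_grown by auto
          then show ?thesis using Suc False by (simp add: of_nat_diff algebra_simps)
        qed
      qed (use r_le in auto)
      then show ?thesis unfolding Suc grown_Suc_iff by blast
    qed
  qed
  show ?thesis
    using up[of "nat (y - h)"] down[of "nat (h - y)"] by (cases "h \<le> y") (auto simp: abs_if)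
qed

text \<open>The profile \<open>\<tau> + \<bar>y\<bar>\<close> is passed on from column to column, so that the delays simply add up.\<close>
lemma column_spread:
  assumes nbr: "\<And>j y. 1 \<le> j \<Longrightarrow> j \<le> s1 \<Longrightarrow> (k + int j, y) \<in> grown \<xi> (\<tau> + nat \<bar>y\<bar>)"
    and seed: "\<And>i. i < s2 \<Longrightarrow> (k, int d + int i) \<in> \<xi>"
  shows "(k, y) \<in> grown \<xi> (\<tau> + 2 * d + 1 + nat \<bar>y\<bar>)"
proof -
  have horiz: "s1 \<le> card (nbhd_h \<rho> (k, y) \<inter> grown \<xi> t)" if "\<tau> + nat \<bar>y\<bar> \<le> t" for t y
  proof (rule card_nbhd_h_ge[where a = "k + 1"])
    fix i assume "i < s1"
    then have "(k + int (Suc i), y) \<in> grown \<xi> (\<tau> + nat \<bar>y\<bar>)"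
      by (intro nbr) auto
    then show "(k + 1 + int i, y) \<in> grown \<xi> t"
      using that by (auto intro: growth_monoD simp: algebra_simps)
  qed (use s1_le in auto)
  \<comment> \<open>The columns to the right are occupied at heights \<open>d + m\<close> and
    \<open>d - m\<close> by time \<open>\<tau> + d + m\<close>, since both heights have modulus at
    most \<open>d + m\<close>. The additional \<open>1\<close> is the step in which column
    \<open>k\<close> uses them.\<close>
  have up: "(k, int d + int m) \<in> grown \<xi> (\<tau> + d + m + 1)" for m
  proof (induction m rule: less_induct)
    case (less m)
    show ?case
    proof (cases "m < s2")
      case True
      then show ?thesis using seed initial_grown by blast
    next
      case False
      have "s2 \<le> card (nbhd_v \<rho> (k, int d + int m) \<inter> grown \<xi> (\<tau> + d + m))"
      proof (rule card_nbhd_v_ge[where a = "int d + int (m - s2)"])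
        fix i assume "i < s2"
        then have "(k, int d + int (m - s2 + i)) \<in> grown \<xi> (\<tau> + d + (m - s2 + i) + 1)"
          using False by (intro less) auto
        then have "(k, int d + int (m - s2 + i)) \<in> grown \<xi> (\<tau> + d + m)"
          by (rule growth_monoD) (use \<open>i < s2\<close> False in auto)
        then show "(k, int d + int (m - s2) + int i) \<in> grown \<xi> (\<tau> + d + m)"
          by (simp add: algebra_simps)
      qed (use False r_le s2_less in auto)
      moreover have "s1 \<le> card (nbhd_h \<rho> (k, int d + int m) \<inter> grown \<xi> (\<tau> + d + m))"
        by (rule horiz) auto
      ultimately show ?thesis unfolding Suc_eq_plus1[symmetric] grown_Suc_iff by blast
    qed
  qed
  have down: "(k, int d - int m) \<in> grown \<xi> (\<tau> + d + m + 1)" for m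
  proof (induction m rule: less_induct)
    case (less m)
    show ?case
    proof (cases m)
      case 0
      then show ?thesis using seed[of 0] s2_pos initial_grown by auto
    next
      case (Suc m')
      have "s2 \<le> card (nbhd_v \<rho> (k, int d - int m) \<inter> grown \<xi> (\<tau> + d + m))"
      proof (rule card_nbhd_v_ge[where a = "int d - int m + 1"])
        fix i assume i: "i < s2"
        show "(k, int d - int m + 1 + int i) \<in> grown \<xi> (\<tau> + d + m)"
        proof (cases "i < m'")
          case True
          then have "(k, int d - int (m' - i)) \<in> grown \<xi> (\<tau> + d + (m' - i) + 1)"
            using Suc by (intro less) auto
          then have "(k, int d - int (m' - i)) \<in> grown \<xi> (\<tau> + d + m)"
            by (rule growth_monoD) (use Suc in simp)
          then show ?thesis using Suc True by (simp add: of_nat_diff algebra_simps)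
        next
          case False
          then have "(k, int d + int (i - m')) \<in> grown \<xi> (\<tau> + d + m)"
            using seed[of "i - m'"] i initial_grown by auto
          then show ?thesis using Suc False by (simp add: of_nat_diff algebra_simps)
        qed
      qed (use r_le s2_less in auto)
      moreover have "s1 \<le> card (nbhd_h \<rho> (k, int d - int m) \<inter> grown \<xi> (\<tau> + d + m))"
        by (rule horiz) auto
      ultimately show ?thesis unfolding Suc_eq_plus1[symmetric] grown_Suc_iff by blast
    qed
  qed
  show ?thesis
  proof (cases "int d \<le> y")
    case True
    show ?thesis
      by (rule growth_monoD, use up[of "nat (y - int d)"] True in simp) (use True in auto)
  next
    case False
    \<comment> \<open>Below the seed the distance travelled is
      \<open>d - y \<le> d + \<bar>y\<bar>\<close>. Together with the delay \<open>d\<close> this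
      yields the \<open>2 * d\<close> of the conclusion.\<close>
    show ?thesis
      by (rule growth_monoD, use down[of "nat (int d - y)"] False in simp) (use False in auto)
  qed
qed

text \<open>The front starts at the columns \<open>K + 1, ..., K + s1\<close> and moves left. Since
  the delays enter only through their sum, a bound on their means will suffice for the random
  configuration.\<close>

lemma origin_grown:
  assumes start: "\<And>j. 1 \<le> j \<Longrightarrow> j \<le> s1 \<Longrightarrow> \<exists>h\<le>H. \<forall>i<r. (int (K + j), int h + int i) \<in> \<xi>"
    and seed: "\<And>k i. k \<le> K \<Longrightarrow> i < s2 \<Longrightarrow> (int k, int (d k) + int i) \<in> \<xi>"
  shows "(0, 0) \<in> grown \<xi> (H + (\<Sum>k\<le>K. 2 * d k + 1))"
proof -
  have init: "(int (K + j), y) \<in> grown \<xi> (H + nat \<bar>y\<bar>)" if "1 \<le> j" "j \<le> s1" for j y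
  proof -
    note j = that
    obtain h where "h \<le> H" "\<And>i. i < r \<Longrightarrow> (int (K + j), int h + int i) \<in> \<xi>"
      using start[OF j] by blast
    then show ?thesis using column_fill[of "int (K + j)" "int h" \<xi> y]
      by (auto elim!: growth_monoD)
  qed
  \<comment> \<open>Induction on the number \<open>m\<close> of columns passed on the way left. All
    columns up to \<open>K + s1\<close> are kept in the claim, because the next column needs
    \<open>s1\<close> of them as horizontal neighbors.\<close>
  have "\<forall>k y. K + 1 - m \<le> k \<and> k \<le> K + s1 \<longrightarrow>
      (int k, y) \<in> grown \<xi> (H + (\<Sum>i\<in>{K + 1 - m..K}. 2 * d i + 1) + nat \<bar>y\<bar>)" if "m \<le> K + 1" for m
    using that
  proof (induction m)
    case 0
    have "(int k, y) \<in> grown \<xi> (H + nat \<bar>y\<bar>)" if "K + 1 \<le> k" "k \<le> K + s1" for k y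
      using init[of "k - K" y] that by (auto simp: of_nat_diff)
    then show ?case by auto
  next
    case (Suc m)
    define k0 where "k0 = K - m"
    have k0: "K + 1 - m = Suc k0" "K + 1 - Suc m = k0" "k0 \<le> K" using Suc.prems by (auto simp: k0_def)
    define \<tau> where "\<tau> = H + (\<Sum>i\<in>{Suc k0..K}. 2 * d i + 1)"
    have sum: "(\<Sum>i\<in>{k0..K}. 2 * d i + 1) = 2 * d k0 + 1 + (\<Sum>i\<in>{Suc k0..K}. 2 * d i + 1)"
      using k0 by (simp add: sum.atLeast_Suc_atMost)
    have IH: "(int k, y) \<in> grown \<xi> (\<tau> + nat \<bar>y\<bar>)" if "Suc k0 \<le> k" "k \<le> K + s1" for k y
      using Suc that unfolding k0 \<tau>_def by auto
    have new: "(int k0, y) \<in> grown \<xi> (\<tau> + 2 * d k0 + 1 + nat \<bar>y\<bar>)" for y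
    proof (rule column_spread)
      fix j y assume "1 \<le> j" "j \<le> s1"
      then show "(int k0 + int j, y) \<in> grown \<xi> (\<tau> + nat \<bar>y\<bar>)"
        using IH[of "k0 + j" y] k0 by auto
    qed (use seed k0 in auto)
    show ?case
    proof (intro allI impI)
      fix k y assume k: "K + 1 - Suc m \<le> k \<and> k \<le> K + s1"
      have *: "H + (\<Sum>i\<in>{K + 1 - Suc m..K}. 2 * d i + 1) + nat \<bar>y\<bar> = \<tau> + 2 * d k0 + 1 + nat \<bar>y\<bar>"
        unfolding k0 sum \<tau>_def by simp
      show "(int k, y) \<in> grown \<xi> (H + (\<Sum>i\<in>{K + 1 - Suc m..K}. 2 * d i + 1) + nat \<bar>y\<bar>)"
      proof (cases "k = k0")
        case True
        then show ?thesis using new[of y] * by metis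
      next
        case False
        then have "(int k, y) \<in> grown \<xi> (\<tau> + nat \<bar>y\<bar>)" using IH k k0 by auto
        then show ?thesis unfolding * by (rule growth_monoD) simp
      qed
    qed
  qed
  from this[OF order.refl, rule_format, of 0 0] show ?thesis by (simp add: atMost_atLeast0)
qed

end

section \<open>Waiting times for blocks\<close>

text \<open>Bernoulli's inequality gives \<open>1 + n x \<le> (1 + x)^n\<close>, and
  \<open>(1 + x) (1 - x) \<le> 1\<close>. The bound serves twice: directly, to make the failure of
  all groups unlikely, and in the form \<open>1 - (1 - x)^n \<ge> n x / (1 + n x)\<close>, to bound
  the success probability of one column from below.\<close>

lemma one_minus_power_le:
  fixes x :: real
  assumes "0 \<le> x" "x \<le> 1"
  shows "(1 - x) ^ n \<le> 1 / (1 + real n * x)"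
proof -
  have "(1 + real n * x) * (1 - x) ^ n \<le> (1 + x) ^ n * (1 - x) ^ n"
    using assms Bernoulli_inequality[of x n] by (intro mult_right_mono) auto
  also have "\<dots> = (1 - x * x) ^ n"
    by (simp add: power_mult_distrib[symmetric] algebra_simps)
  also have "\<dots> \<le> 1"
    using assms by (intro power_le_one) (auto simp: mult_le_one)
  finally have "(1 + real n * x) * (1 - x) ^ n \<le> 1" .
  moreover have "1 + real n * x > 0" using assms by (simp add: add_pos_nonneg)
  ultimately show ?thesis by (simp add: pos_le_divide_eq mult.commute)
qed

lemma prob_not_init:
  assumes "finite K" "\<And>\<omega> \<omega>'. (\<And>i. i \<in> K \<Longrightarrow> \<omega> i = \<omega>' i) \<Longrightarrow> Q \<omega> = Q \<omega>'"
  shows "measure (init_measure p) {\<omega>. \<not> Q \<omega>} = 1 - measure (init_measure p) {\<omega>. Q \<omega>}"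
proof -
  interpret prob_space "init_measure p" by (rule prob_space_init)
  have "prob (space (init_measure p) - {\<omega>. Q \<omega>}) = 1 - prob {\<omega>. Q \<omega>}"
    by (rule prob_compl, rule finite_coordinates_event(3)[OF assms])
  moreover have "space (init_measure p) - {\<omega>. Q \<omega>} = {\<omega>. \<not> Q \<omega>}" by auto
  ultimately show ?thesis by simp
qed

definition block :: "nat \<Rightarrow> nat \<Rightarrow> nat \<Rightarrow> (int \<times> int) set" where
  "block k h n = (\<lambda>i. (int k, int h + int i)) ` {..<n}"

lemma finite_block [simp]: "finite (block k h n)"
  by (simp add: block_def)

lemma card_block: "card (block k h n) = n"
  by (simp add: block_def card_image inj_on_def)

lemma disjoint_blocks: "disjoint_family_on (\<lambda>i. block k (n * i) n) L"
proof -
  have "block k (n * i) n \<inter> block k (n * j) n = {}" if "i < j" for i j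
  proof -
    have "n * i + n \<le> n * j" using that by (metis Suc_leI mult_Suc_right mult_le_mono2 add.commute)
    then have "int (n * i) + int n \<le> int (n * j)" by linarith
    then show ?thesis by (auto simp: block_def)
  qed
  then show ?thesis unfolding disjoint_family_on_def by (metis Int_commute linorder_neqE_nat)
qed

lemma prob_no_block:
  assumes "0 \<le> p" "p \<le> 1"
  shows "measure (init_measure p) {\<omega>. \<forall>i<m. \<not> (\<forall>z\<in>block k (n * i) n. \<omega> z)} = (1 - p ^ n) ^ m"
proof -
  have "measure (init_measure p) {\<omega>. \<forall>i\<in>{..<m}. \<not> (\<forall>z\<in>block k (n * i) n. \<omega> z)}
      = (\<Prod>i<m. measure (init_measure p) {\<omega>. \<not> (\<forall>z\<in>block k (n * i) n. \<omega> z)})"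
    by (rule prob_indep[where K = "\<lambda>i. block k (n * i) n"]) (auto simp: disjoint_blocks)
  also have "\<dots> = (\<Prod>i<m. 1 - p ^ n)"
    by (intro prod.cong refl, subst prob_not_init[where K = "block k (n * _) n"])
      (use assms in \<open>auto simp: prob_cylinder card_block\<close>)
  finally show ?thesis by (simp add: Ball_def)
qed

definition has_block :: "nat \<Rightarrow> nat \<Rightarrow> nat \<Rightarrow> (int \<times> int \<Rightarrow> bool) \<Rightarrow> bool" where
  "has_block n m k \<omega> \<longleftrightarrow> (\<exists>i<m. \<forall>z\<in>block k (n * i) n. \<omega> z)"

lemma has_block_cong:
  assumes "\<And>z. z \<in> (\<Union>i<m. block k (n * i) n) \<Longrightarrow> \<omega> z = \<omega>' z"
  shows "has_block n m k \<omega> = has_block n m k \<omega>'"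
  using assms unfolding has_block_def by blast

lemma prob_has_block:
  assumes "0 \<le> p" "p \<le> 1"
  shows "measure (init_measure p) {\<omega>. has_block n m k \<omega>} = 1 - (1 - p ^ n) ^ m"
proof -
  have "measure (init_measure p) {\<omega>. \<not> has_block n m k \<omega>} = 1 - measure (init_measure p) {\<omega>. has_block n m k \<omega>}"
    by (rule prob_not_init[where K = "\<Union>i<m. block k (n * i) n"]) (simp, rule has_block_cong)
  moreover have "{\<omega>. \<not> has_block n m k \<omega>} = {\<omega>. \<forall>i<m. \<not> (\<forall>z\<in>block k (n * i) n. \<omega> z)}"
    by (auto simp: has_block_def)
  ultimately show ?thesis using prob_no_block[OF assms] by simp
qed

text \<open>Group \<open>g\<close> consists of the columns \<open>g * s + 1, ..., g * s + s\<close>.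
  Numbering from 1 leaves the columns \<open>0, ..., g * s\<close> to the left of the group, which
  the front has to cross.\<close>

lemma prob_no_group:
  assumes p: "0 \<le> p" "p \<le> 1"
  shows "measure (init_measure p) {\<omega>. \<forall>g<G. \<not> (\<forall>j<s. has_block n m (g * s + Suc j) \<omega>)}
    = (1 - (1 - (1 - p ^ n) ^ m) ^ s) ^ G"
proof -
  let ?K = "\<lambda>k. \<Union>i<m. block k (n * i) n"
  let ?L = "\<lambda>g. \<Union>j<s. ?K (g * s + Suc j)"
  have disjoint: "?K k \<inter> ?K k' = {}" if "k \<noteq> k'" for k k'
    using that by (auto simp: block_def)
  have one: "measure (init_measure p) {\<omega>. \<forall>j\<in>{..<s}. has_block n m (g * s + Suc j) \<omega>} = (1 - (1 - p ^ n) ^ m) ^ s" for g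
  proof -
    have "measure (init_measure p) {\<omega>. \<forall>j\<in>{..<s}. has_block n m (g * s + Suc j) \<omega>}
       = (\<Prod>j<s. measure (init_measure p) {\<omega>. has_block n m (g * s + Suc j) \<omega>})"
    proof (rule prob_indep[where K = "\<lambda>j. ?K (g * s + Suc j)"])
      show "disjoint_family_on (\<lambda>j. ?K (g * s + Suc j)) {..<s}"
        unfolding disjoint_family_on_def
      proof (intro ballI impI)
        fix j j' :: nat assume "j \<noteq> j'"
        then show "?K (g * s + Suc j) \<inter> ?K (g * s + Suc j') = {}"
          by (intro disjoint) simp
      qed
    next
      fix j and \<omega> \<omega>' :: "int \<times> int \<Rightarrow> bool" assume "\<And>i. i \<in> ?K (g * s + Suc j) \<Longrightarrow> \<omega> i = \<omega>' i"
      then show "has_block n m (g * s + Suc j) \<omega> = has_block n m (g * s + Suc j) \<omega>'"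
        by (rule has_block_cong)
    qed auto
    then show ?thesis using p by (simp add: prob_has_block)
  qed
  have cong: "(\<forall>j\<in>{..<s}. has_block n m (g * s + Suc j) \<omega>) = (\<forall>j\<in>{..<s}. has_block n m (g * s + Suc j) \<omega>')"
    if "\<And>i. i \<in> ?L g \<Longrightarrow> \<omega> i = \<omega>' i" for g and \<omega> \<omega>' :: "int \<times> int \<Rightarrow> bool"
    by (intro ball_cong refl has_block_cong that) auto
  have "measure (init_measure p) {\<omega>. \<forall>g\<in>{..<G}. \<not> (\<forall>j\<in>{..<s}. has_block n m (g * s + Suc j) \<omega>)}
      = (\<Prod>g<G. measure (init_measure p) {\<omega>. \<not> (\<forall>j\<in>{..<s}. has_block n m (g * s + Suc j) \<omega>)})"
  proof (rule prob_indep[where K = ?L])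
    show "disjoint_family_on ?L {..<G}"
      unfolding disjoint_family_on_def
    proof (intro ballI impI)
      fix g g' :: nat assume "g \<noteq> g'"
      have "g * s + Suc j \<noteq> g' * s + Suc j'" if "j < s" "j' < s" for j j'
      proof
        assume "g * s + Suc j = g' * s + Suc j'"
        then have "(g * s + j) div s = (g' * s + j') div s" by simp
        then show False using that \<open>g \<noteq> g'\<close> by simp
      qed
      then have "?K (g * s + Suc j) \<inter> ?K (g' * s + Suc j') = {}" if "j < s" "j' < s" for j j'
        using disjoint that by blast
      then show "?L g \<inter> ?L g' = {}" by blast
    qed
  next
    fix g and \<omega> \<omega>' :: "int \<times> int \<Rightarrow> bool" assume *: "\<And>i. i \<in> ?L g \<Longrightarrow> \<omega> i = \<omega>' i"
    show "(\<not> (\<forall>j\<in>{..<s}. has_block n m (g * s + Suc j) \<omega>)) = (\<not> (\<forall>j\<in>{..<s}. has_block n m (g * s + Suc j) \<omega>'))"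
      by (intro arg_cong[where f = Not] cong *)
  qed auto
  also have "\<dots> = (\<Prod>g<G. 1 - (1 - (1 - p ^ n) ^ m) ^ s)"
  proof (intro prod.cong refl)
    fix g
    show "measure (init_measure p) {\<omega>. \<not> (\<forall>j\<in>{..<s}. has_block n m (g * s + Suc j) \<omega>)} = 1 - (1 - (1 - p ^ n) ^ m) ^ s"
      using one[of g] prob_not_init[of "?L g", OF _ cong] by simp
  qed
  finally show ?thesis by (simp add: Ball_def)
qed

text \<open>The number of blocks before the first fully occupied one, truncated at \<open>m\<close> to keep it
  a finite sum of indicators.\<close>
definition block_wait :: "nat \<Rightarrow> nat \<Rightarrow> nat \<Rightarrow> (int \<times> int \<Rightarrow> bool) \<Rightarrow> nat" where
  "block_wait n m k \<omega> = card {i. i < m \<and> \<not> has_block n (Suc i) k \<omega>}"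

text \<open>If the blocks with indices up to \<open>w = block_wait n m k \<omega>\<close> all
  failed, then these \<open>w + 1\<close> indices, all below \<open>m\<close>, would be counted in a
  set of \<open>w\<close> elements.\<close>

lemma has_block_if_wait_less:
  assumes "block_wait n m k \<omega> < m"
  shows "\<exists>i\<le>block_wait n m k \<omega>. \<forall>z\<in>block k (n * i) n. \<omega> z"
proof (rule ccontr)
  let ?w = "block_wait n m k \<omega>"
  assume "\<not> ?thesis"
  then have "{..?w} \<subseteq> {i. i < m \<and> \<not> has_block n (Suc i) k \<omega>}"
    using assms by (auto simp: has_block_def)
  from card_mono[OF _ this] show False by (simp add: block_wait_def)
qed

text \<open>The \<open>i\<close>-th indicator has mean \<open>(1 - p ^ n) ^ Suc i\<close>, and the
  geometric series bounds the sum uniformly in the truncation \<open>m\<close>.\<close>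

lemma expectation_block_wait:
  assumes p: "0 < p" "p \<le> 1"
  shows "integrable (init_measure p) (\<lambda>\<omega>. real (block_wait n m k \<omega>))"
    and "(\<integral>\<omega>. real (block_wait n m k \<omega>) \<partial>init_measure p) \<le> 1 / p ^ n"
proof -
  interpret prob_space "init_measure p" by (rule prob_space_init)
  let ?E = "\<lambda>i. {\<omega>. \<not> has_block n (Suc i) k \<omega>}"
  have ev: "?E i \<in> events" for i
    by (rule finite_coordinates_event(3)[where K = "\<Union>i'<Suc i. block k (n * i') n"])
      (simp, metis has_block_cong)
  have eq: "real (block_wait n m k \<omega>) = (\<Sum>i<m. indicator (?E i) \<omega>)" for \<omega>
  proof -
    have "{i. i < m \<and> \<not> has_block n (Suc i) k \<omega>} = {..<m} \<inter> {i. \<omega> \<in> ?E i}" by auto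
    then show ?thesis
      by (simp add: block_wait_def indicator_def of_bool_def sum.If_cases)
  qed
  have int: "integrable (init_measure p) (indicator (?E i) :: _ \<Rightarrow> real)" for i
    using ev by (intro integrable_real_indicator) (auto simp: emeasure_eq_measure)
  then show "integrable (init_measure p) (\<lambda>\<omega>. real (block_wait n m k \<omega>))"
    unfolding eq by (rule Bochner_Integration.integrable_sum)
  have "(\<integral>\<omega>. real (block_wait n m k \<omega>) \<partial>init_measure p) = (\<Sum>i<m. prob (?E i))"
    unfolding eq using int ev by (subst Bochner_Integration.integral_sum) auto
  also have "\<dots> = (\<Sum>i<m. (1 - p ^ n) ^ Suc i)"
  proof (intro sum.cong refl)
    fix i
    have "?E i = {\<omega>. \<forall>i'<Suc i. \<not> (\<forall>z\<in>block k (n * i') n. \<omega> z)}" by (auto simp: has_block_def)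
    then show "prob (?E i) = (1 - p ^ n) ^ Suc i" using p prob_no_block[of p "Suc i" k n] by simp
  qed
  also have "\<dots> \<le> (\<Sum>i<m. (1 - p ^ n) ^ i)"
    using p by (intro sum_mono power_decreasing) (auto simp: power_le_one)
  also have "\<dots> \<le> 1 / p ^ n"
  proof -
    have "p ^ n * (\<Sum>i<m. (1 - p ^ n) ^ i) = 1 - (1 - p ^ n) ^ m"
      using one_diff_power_eq[of "1 - p ^ n" m] by simp
    also have "\<dots> \<le> 1" using p by (simp add: power_le_one)
    finally show ?thesis using p by (simp add: pos_le_divide_eq mult.commute)
  qed
  finally show "(\<integral>\<omega>. real (block_wait n m k \<omega>) \<partial>init_measure p) \<le> 1 / p ^ n" .
qed

section \<open>Tail bound for the hitting time\<close>

context cross_growth begin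

lemma hit_time_le: "(0, 0) \<in> grown {x. \<omega> x} t \<Longrightarrow> hit_time \<rho> corner_zeros \<omega> \<le> of_nat t"
  unfolding hit_time_def by (rule INF_lower) simp

text \<open>A late hit has one of two causes. Either each of the \<open>G\<close> groups has a
  column without an \<open>r\<close>-block among its lowest \<open>N\<close> blocks, which is
  estimated by independence, or crossing the columns takes at least \<open>R\<close>, which is
  estimated by Markov's inequality.\<close>

lemma hit_time_upper_bound:
  assumes p: "0 < p" "p \<le> 1" and R: "0 < R" and \<tau>: "real (N * r) + R < \<tau>"
  shows "measure (init_measure p) {\<omega>. hit_time \<rho> corner_zeros \<omega> \<ge> ennreal \<tau>}
    \<le> (1 - (1 - (1 - p ^ r) ^ N) ^ s1) ^ G + real (G * s1 + 1) * (2 * real s2 / p ^ s2 + 1) / R"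
proof -
  interpret prob_space "init_measure p" by (rule prob_space_init)
  \<comment> \<open>The truncation level exceeds \<open>R\<close>: as long as the total delay is
    below \<open>R\<close>, every wait is below \<open>M\<close> and hence leads to an occupied
    block.\<close>
  define M where "M = Suc (nat \<lceil>R\<rceil>)"
  have M: "R < real M" unfolding M_def by linarith
  let ?B = "\<lambda>\<omega>. \<forall>g<G. \<not> (\<forall>j<s1. has_block r N (g * s1 + Suc j) \<omega>)"
  \<comment> \<open>The sum extends over all \<open>G * s1 + 1\<close> columns, not just over those
    left of the successful group, whose position is random. The factor \<open>s2\<close> turns the
    index of a block into its height.\<close>
  let ?W = "\<lambda>\<omega>. \<Sum>k\<le>G * s1. 2 * (real s2 * real (block_wait s2 M k \<omega>)) + 1"
  have int: "integrable (init_measure p) ?W"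
    by (intro Bochner_Integration.integrable_sum Bochner_Integration.integrable_add integrable_mult_right
        expectation_block_wait(1)[OF p] integrable_const)
  have "(\<integral>\<omega>. ?W \<omega> \<partial>init_measure p)
      = (\<Sum>k\<le>G * s1. 2 * (real s2 * (\<integral>\<omega>. real (block_wait s2 M k \<omega>) \<partial>init_measure p)) + 1)"
    using expectation_block_wait(1)[OF p]
    using prob_space by (subst Bochner_Integration.integral_sum) auto
  also have "\<dots> \<le> (\<Sum>k\<le>G * s1. 2 * (real s2 * (1 / p ^ s2)) + 1)"
    using expectation_block_wait(2)[OF p] by (intro sum_mono add_right_mono mult_left_mono) auto
  also have "\<dots> = real (G * s1 + 1) * (2 * real s2 / p ^ s2 + 1)"
    by simp
  finally have EW: "(\<integral>\<omega>. ?W \<omega> \<partial>init_measure p) \<le> real (G * s1 + 1) * (2 * real s2 / p ^ s2 + 1)" .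
  have WR: "prob {\<omega>. R \<le> ?W \<omega>} \<le> real (G * s1 + 1) * (2 * real s2 / p ^ s2 + 1) / R"
  proof -
    have "prob {\<omega>\<in>space (init_measure p). R \<le> ?W \<omega>} \<le> (\<integral>\<omega>. ?W \<omega> \<partial>init_measure p) / R"
      by (rule integral_Markov_inequality_measure[OF int, where A = "{}"])
        (use R in \<open>auto intro!: AE_I2 sum_nonneg\<close>)
    also have "\<dots> \<le> real (G * s1 + 1) * (2 * real s2 / p ^ s2 + 1) / R"
      using EW R by (intro divide_right_mono) auto
    finally show ?thesis by simp
  qed
  have mW: "{\<omega>. R \<le> ?W \<omega>} \<in> events"
  proof -
    have "?W \<in> borel_measurable (init_measure p)" using int by (rule borel_measurable_integrable)
    then have "{\<omega>\<in>space (init_measure p). R \<le> ?W \<omega>} \<in> events" by measurable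
    then show ?thesis by simp
  qed
  have mB: "{\<omega>. ?B \<omega>} \<in> events"
  proof (rule finite_coordinates_event(3)[where K = "\<Union>g<G. \<Union>j<s1. \<Union>i<N. block (g * s1 + Suc j) (r * i) r"])
    fix \<omega> \<omega>' :: "int \<times> int \<Rightarrow> bool"
    assume "\<And>z. z \<in> (\<Union>g<G. \<Union>j<s1. \<Union>i<N. block (g * s1 + Suc j) (r * i) r) \<Longrightarrow> \<omega> z = \<omega>' z"
    then have "has_block r N (g * s1 + Suc j) \<omega> = has_block r N (g * s1 + Suc j) \<omega>'" if "g < G" "j < s1" for g j
      using that by (intro has_block_cong) blast
    then show "?B \<omega> = ?B \<omega>'" by blast
  qed auto
  have "\<omega> \<in> {\<omega>. ?B \<omega>} \<union> {\<omega>. R \<le> ?W \<omega>}" if T: "hit_time \<rho> corner_zeros \<omega> \<ge> ennreal \<tau>" for \<omega>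
  proof (rule ccontr)
    assume *: "\<omega> \<notin> {\<omega>. ?B \<omega>} \<union> {\<omega>. R \<le> ?W \<omega>}"
    then obtain g where g: "g < G" "\<And>j. j < s1 \<Longrightarrow> has_block r N (g * s1 + Suc j) \<omega>" by auto
    have W: "?W \<omega> < R" using * by auto
    have wait: "block_wait s2 M k \<omega> < M" if "k \<le> G * s1" for k
    proof -
      have "real (block_wait s2 M k \<omega>) \<le> 2 * (real s2 * real (block_wait s2 M k \<omega>)) + 1"
        using s2_pos mult_right_mono[of 1 "2 * real s2" "real (block_wait s2 M k \<omega>)"] by simp
      also have "\<dots> \<le> ?W \<omega>"
        using that by (intro member_le_sum) auto
      finally show ?thesis using W M by linarith
    qed
    have "\<exists>i. i \<le> block_wait s2 M k \<omega> \<and> (\<forall>z\<in>block k (s2 * i) s2. \<omega> z)" if "k \<le> G * s1" for k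
      using has_block_if_wait_less[OF wait[OF that]] by blast
    then obtain d where d: "\<And>k. k \<le> G * s1 \<Longrightarrow> d k \<le> block_wait s2 M k \<omega>"
      "\<And>k. k \<le> G * s1 \<Longrightarrow> \<forall>z\<in>block k (s2 * d k) s2. \<omega> z" by metis
    have gG: "g * s1 \<le> G * s1" using g by (intro mult_right_mono) auto
    have "(0, 0) \<in> grown {x. \<omega> x} (N * r + (\<Sum>k\<le>g * s1. 2 * (s2 * d k) + 1))"
    proof (rule origin_grown)
      fix j assume j: "1 \<le> j" "j \<le> s1"
      then obtain i where "i < N" "\<forall>z\<in>block (g * s1 + j) (r * i) r. \<omega> z"
        using g(2)[of "j - 1"] unfolding has_block_def by fastforce
      moreover from this have "r * i \<le> N * r" by simp
      ultimately show "\<exists>h\<le>N * r. \<forall>i<r. (int (g * s1 + j), int h + int i) \<in> {x. \<omega> x}"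
        unfolding block_def by (intro exI[of _ "r * i"]) auto
    next
      fix k i assume "k \<le> g * s1" "i < s2"
      then show "(int k, int (s2 * d k) + int i) \<in> {x. \<omega> x}"
        using d(2)[of k] gG unfolding block_def by auto
    qed
    from hit_time_le[OF this] T
    have "ennreal \<tau> \<le> of_nat (N * r + (\<Sum>k\<le>g * s1. 2 * (s2 * d k) + 1))" by order
    then have "\<tau> \<le> real (N * r + (\<Sum>k\<le>g * s1. 2 * (s2 * d k) + 1))"
      by (simp add: ennreal_of_nat_eq_real_of_nat del: of_nat_add of_nat_sum)
    also have "\<dots> = real (N * r) + (\<Sum>k\<le>g * s1. 2 * (real s2 * real (d k)) + 1)"
      by (simp add: algebra_simps)
    also have "(\<Sum>k\<le>g * s1. 2 * (real s2 * real (d k)) + 1) \<le> (\<Sum>k\<le>g * s1. 2 * (real s2 * real (block_wait s2 M k \<omega>)) + 1)"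
    proof (intro sum_mono add_right_mono mult_left_mono)
      fix k assume "k \<in> {..g * s1}"
      then show "real (d k) \<le> real (block_wait s2 M k \<omega>)" using d(1)[of k] gG by simp
    qed auto
    also have "\<dots> \<le> ?W \<omega>"
      using gG by (intro sum_mono2) auto
    finally show False using W \<tau> by linarith
  qed
  then have "prob {\<omega>. hit_time \<rho> corner_zeros \<omega> \<ge> ennreal \<tau>} \<le> prob ({\<omega>. ?B \<omega>} \<union> {\<omega>. R \<le> ?W \<omega>})"
    using mB mW by (intro finite_measure_mono) auto
  also have "\<dots> \<le> prob {\<omega>. ?B \<omega>} + prob {\<omega>. R \<le> ?W \<omega>}"
    using mB mW by (rule measure_Un_le)
  also have "prob {\<omega>. ?B \<omega>} = (1 - (1 - (1 - p ^ r) ^ N) ^ s1) ^ G"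
    using prob_no_group[of p G s1 r N] p by simp
  finally show ?thesis using WR by linarith
qed

end

section \<open>The upper bound\<close>

lemma tendsto_Limsup_prob:
  fixes P :: "real \<Rightarrow> real \<Rightarrow> real"
  assumes "\<forall>\<^sub>F l in F. \<forall>\<^sub>F p in at_right 0. P l p \<le> g l" "(g \<longlongrightarrow> 0) F" "\<And>l p. 0 \<le> P l p"
  shows "((\<lambda>l. Limsup (at_right 0) (\<lambda>p. ereal (P l p))) \<longlongrightarrow> 0) F"
proof (rule tendsto_sandwich)
  show "\<forall>\<^sub>F l in F. 0 \<le> Limsup (at_right (0::real)) (\<lambda>p. ereal (P l p))"
    using assms(3) by (intro always_eventually allI le_Limsup) auto
  show "\<forall>\<^sub>F l in F. Limsup (at_right (0::real)) (\<lambda>p. ereal (P l p)) \<le> ereal (g l)"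
    using assms(1) by eventually_elim (intro Limsup_bounded, simp)
  show "((\<lambda>l. ereal (g l)) \<longlongrightarrow> 0) F" using assms(2) by (simp add: zero_ereal_def)
qed simp

lemma filterlim_powr_neg_at_right_0:
  assumes "0 < a"
  shows "filterlim (\<lambda>p::real. p powr (- a)) at_top (at_right 0)"
proof -
  have "((\<lambda>p::real. p powr a) \<longlongrightarrow> 0) (at_right 0)"
    using assms by (auto intro!: tendsto_eq_intros eventually_at_rightI[of 0 1])
  moreover have "\<forall>\<^sub>F p in at_right 0. 0 < (p::real) powr a"
    using eventually_at_right_less[of "0::real"] by eventually_elim simp
  ultimately show ?thesis unfolding powr_minus by (rule filterlim_inverse_at_top)
qed

context cross_growth begin

definition gam :: real where "gam = (real r * real s1 + real s2) / (1 + real s1)"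

lemma gam_gt: "real s2 < gam"
proof -
  have "real s2 * (1 + real s1) < real r * real s1 + real s2"
    using s2_less s1_pos mult_strict_right_mono[of "real s2" "real r" "real s1"] by (simp add: algebra_simps)
  then show ?thesis unfolding gam_def by (subst pos_less_divide_eq) auto
qed

lemma gam_less: "gam < real r"
  using s2_less unfolding gam_def by (subst pos_divide_less_eq) (auto simp: algebra_simps)

lemma gam_pos: "0 < gam"
  using gam_gt by linarith

text \<open>Up to constants, \<open>p^r a\<close> is the probability of an \<open>r\<close>-block in
  one column of height \<open>a\<close>, and \<open>p^s2 a\<close> is the number of columns crossed
  in time \<open>a\<close>. The identity says that about one group of \<open>s1\<close> such columns
  is expected within that distance.\<close>

lemma gam_balance:
  assumes "0 < p"
  shows "(p ^ s2 * p powr (- gam)) * (p ^ r * p powr (- gam)) ^ s1 = 1"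
proof -
  have *: "p ^ k * p powr (- gam) = p powr (real k - gam)" for k
    using assms by (simp add: powr_realpow[symmetric] powr_add[symmetric])
  have "(p ^ s2 * p powr (- gam)) * (p ^ r * p powr (- gam)) ^ s1
      = p powr (real s2 - gam + real s1 * (real r - gam))"
    unfolding * using assms by (simp add: powr_power powr_add)
  also have "real s2 - gam + real s1 * (real r - gam) = (real r * real s1 + real s2) - gam * (1 + real s1)"
    by (simp add: algebra_simps)
  also have "gam * (1 + real s1) = real r * real s1 + real s2"
    unfolding gam_def by simp
  finally show ?thesis using assms by simp
qed

text \<open>The last two limits express \<open>s2 < gam < r\<close>: a single column of height
  \<open>a\<close> rarely contains an \<open>r\<close>-block, while the width that a front crosses
  in time \<open>a\<close> diverges.\<close>

lemma filterlim_gam: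
  "filterlim (\<lambda>p. p powr (- gam)) at_top (at_right 0)"
  "((\<lambda>p. p ^ r * p powr (- gam)) \<longlongrightarrow> 0) (at_right 0)"
  "filterlim (\<lambda>p. p ^ s2 * p powr (- gam)) at_top (at_right 0)"
proof -
  show "filterlim (\<lambda>p. p powr (- gam)) at_top (at_right 0)"
    using gam_pos by (rule filterlim_powr_neg_at_right_0)
  have ev: "\<forall>\<^sub>F p in at_right 0. p powr (real k - gam) = p ^ k * p powr (- gam)" for k
    using eventually_at_right_less[of 0]
    by eventually_elim (simp add: powr_realpow[symmetric] powr_add[symmetric])
  show "((\<lambda>p. p ^ r * p powr (- gam)) \<longlongrightarrow> 0) (at_right 0)"
    by (rule tendsto_cong[THEN iffD1, OF ev])
      (use gam_less in \<open>auto intro!: tendsto_eq_intros eventually_at_rightI[of 0 1]\<close>)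
  show "filterlim (\<lambda>p. p ^ s2 * p powr (- gam)) at_top (at_right 0)"
    by (rule filterlim_cong[THEN iffD1, OF refl refl ev])
      (use gam_gt filterlim_powr_neg_at_right_0[of "gam - real s2"] in simp)
qed

text \<open>The time \<open>l * A\<close> is divided: heights up to
  \<open>N * r \<le> l * A / 4\<close> are searched for \<open>r\<close>-blocks, and
  \<open>R = l * A / 2\<close> is available for the delays of the crossed columns.\<close>

lemma hit_time_upper:
  assumes l: "1 \<le> l"
  shows "\<forall>\<^sub>F p in at_right 0. measure (init_measure p) {\<omega>. hit_time \<rho> corner_zeros \<omega> \<ge> ennreal (l * p powr (- gam))}
    \<le> ((16 * real r) ^ s1 + 4 * (real s1 + 1) * (2 * real s2 + 1)) / sqrt l"
proof -
  have "\<forall>\<^sub>F p in at_right 0. 8 * real r \<le> p powr (- gam)"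
    using filterlim_gam(1) by (simp add: filterlim_at_top)
  moreover have "\<forall>\<^sub>F p in at_right 0. p ^ r * p powr (- gam) < 1 / l"
    using filterlim_gam(2) l by (intro order_tendstoD) auto
  moreover have "\<forall>\<^sub>F p in at_right 0. 1 \<le> p ^ s2 * p powr (- gam)"
    using filterlim_gam(3) by (simp add: filterlim_at_top)
  moreover have "\<forall>\<^sub>F p in at_right 0. p < (1::real)"
    by (rule eventually_at_right_real[THEN eventually_mono, of 0 1]) auto
  ultimately show ?thesis using eventually_at_right_less[of 0]
  proof eventually_elim
    case (elim p)
    define A where "A = p powr (- gam)"
    have A: "8 * real r \<le> A" and w1: "p ^ r * A < 1 / l" and u1: "1 \<le> p ^ s2 * A" and p: "0 < p" "p < 1"
      using elim by (auto simp: A_def)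
    have bal: "(p ^ s2 * A) * (p ^ r * A) ^ s1 = 1"
      unfolding A_def by (rule gam_balance[OF p(1)])
    have r1: "1 \<le> real r" using s2_less by simp
    have A0: "0 < A" using A r1 by linarith
    have lA: "8 * real r \<le> l * A" using A l A0 mult_right_mono[of 1 l A] by linarith
    define N where "N = nat \<lfloor>l * A / (4 * real r)\<rfloor>"
    \<comment> \<open>The factor \<open>sqrt l\<close> makes the expected number of groups with blocks large, while the mean
      travel time stays a factor \<open>sqrt l\<close> below \<open>l * A\<close>.\<close>
    define G where "G = nat \<lceil>sqrt l * (p ^ s2 * A)\<rceil>"
    have sl: "1 \<le> sqrt l" using l by simp
    have x2: "2 \<le> l * A / (4 * real r)" using lA r1 by (simp add: pos_le_divide_eq)
    have N1: "real N \<le> l * A / (4 * real r)" unfolding N_def using x2 by linarith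
    have half: "y / 2 \<le> real (nat \<lfloor>y\<rfloor>)" if "2 \<le> y" for y :: real
      using that by linarith
    have N2: "l * A / (8 * real r) \<le> real N"
    proof -
      have "l * A / (8 * real r) = (l * A / (4 * real r)) / 2" by simp
      also have "\<dots> \<le> real N" unfolding N_def by (rule half[OF x2])
      finally show ?thesis .
    qed
    have su: "1 \<le> sqrt l * (p ^ s2 * A)" using sl u1 mult_mono[of 1 "sqrt l" 1 "p ^ s2 * A"] by simp
    have G1: "sqrt l * (p ^ s2 * A) \<le> real G" unfolding G_def by linarith
    have G2: "real G \<le> 2 * (sqrt l * (p ^ s2 * A))" unfolding G_def using su by linarith
    define R where "R = l * A / 2"
    have "real (N * r) \<le> l * A / 4" using N1 r1 by (simp add: field_simps)
    moreover have "0 < l * A" using l A0 by simp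
    ultimately have *: "real (N * r) + R < l * A" "0 < R" unfolding R_def by linarith+
    define \<pi> where "\<pi> = (1 - (1 - p ^ r) ^ N) ^ s1"
    have pr: "0 < p ^ r" "p ^ r \<le> 1" using p by (auto simp: power_le_one)
    \<comment> \<open>A column contains an \<open>r\<close>-block with probability at least
      \<open>x / (1 + x)\<close> for \<open>x = N p^r\<close>. By \<open>w1\<close> also
      \<open>x \<le> 1\<close>, so this is at least \<open>x / 2\<close>.\<close>
    have c1: "l * (p ^ r * A) / (16 * real r) \<le> 1 - (1 - p ^ r) ^ N"
    proof -
      define x where "x = real N * p ^ r"
      have x0: "0 \<le> x" using pr by (simp add: x_def)
      have "x \<le> l * A / (4 * real r) * p ^ r" unfolding x_def using N1 pr by (intro mult_right_mono) auto
      also have "\<dots> = l * (p ^ r * A) / (4 * real r)" by simp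
      also have "\<dots> \<le> 1 / (4 * real r)" using w1 l r1 by (intro divide_right_mono) (auto simp: field_simps)
      also have "\<dots> \<le> 1" using r1 by simp
      finally have x1: "x \<le> 1" .
      have "l * (p ^ r * A) / (16 * real r) = l * A / (8 * real r) * p ^ r / 2" by simp
      also have "\<dots> \<le> x / 2" unfolding x_def using N2 pr by (intro divide_right_mono mult_right_mono) auto
      also have "\<dots> \<le> x / (1 + x)" using x0 x1 by (intro divide_left_mono) auto
      also have "\<dots> = 1 - 1 / (1 + x)" using x0 by (simp add: field_simps)
      also have "\<dots> \<le> 1 - (1 - p ^ r) ^ N"
        using one_minus_power_le[of "p ^ r" N] pr unfolding x_def by simp
      finally show ?thesis .
    qed
    have pi0: "(l * (p ^ r * A) / (16 * real r)) ^ s1 \<le> \<pi>"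
      unfolding \<pi>_def using c1 l A0 pr by (intro power_mono) auto
    have pi1: "0 \<le> \<pi>" "\<pi> \<le> 1"
      unfolding \<pi>_def using pr by (auto intro!: zero_le_power power_le_one)
    \<comment> \<open>The expected number of successful groups: the powers of \<open>p\<close>
      cancel by \<open>bal\<close>, and of the remaining \<open>sqrt l * l ^ s1\<close> only
      \<open>sqrt l\<close> is kept.\<close>
    have "sqrt l / (16 * real r) ^ s1 \<le> real G * \<pi>"
    proof -
      have "sqrt l / (16 * real r) ^ s1 \<le> sqrt l * l ^ s1 / (16 * real r) ^ s1"
        using l r1 sl mult_left_mono[of 1 "l ^ s1" "sqrt l"] by (intro divide_right_mono) auto
      also have "\<dots> = (sqrt l * l ^ s1 / (16 * real r) ^ s1) * ((p ^ s2 * A) * (p ^ r * A) ^ s1)"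
        unfolding bal by simp
      also have "\<dots> = (sqrt l * (p ^ s2 * A)) * (l * (p ^ r * A) / (16 * real r)) ^ s1"
        by (simp add: power_mult_distrib power_divide)
      also have "\<dots> \<le> real G * \<pi>"
        using G1 pi0 su l A0 pr r1 by (intro mult_mono) auto
      finally show ?thesis .
    qed
    then have Gpi: "sqrt l / (16 * real r) ^ s1 \<le> 1 + real G * \<pi>" by simp
    have "(1 - \<pi>) ^ G \<le> 1 / (1 + real G * \<pi>)"
      using one_minus_power_le pi1 by blast
    also have "\<dots> \<le> 1 / (sqrt l / (16 * real r) ^ s1)"
      using Gpi r1 sl pi1 by (intro divide_left_mono) (auto intro!: mult_pos_pos divide_pos_pos add_pos_nonneg)
    finally have t1: "(1 - \<pi>) ^ G \<le> (16 * real r) ^ s1 / sqrt l" by simp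
    have ps: "0 < p ^ s2" "p ^ s2 \<le> 1" using p by (auto simp: power_le_one)
    have G0: "1 \<le> real G" using G1 su by linarith
    have "real (G * s1 + 1) * (2 * real s2 / p ^ s2 + 1) / R
       \<le> ((real s1 + 1) * (2 * (sqrt l * (p ^ s2 * A)))) * ((2 * real s2 + 1) / p ^ s2) / R"
    proof (intro divide_right_mono mult_mono)
      have "real (G * s1 + 1) \<le> (real s1 + 1) * real G" using G0 by (simp add: algebra_simps)
      also have "\<dots> \<le> (real s1 + 1) * (2 * (sqrt l * (p ^ s2 * A)))" using G2 by (intro mult_left_mono) auto
      finally show "real (G * s1 + 1) \<le> (real s1 + 1) * (2 * (sqrt l * (p ^ s2 * A)))" .
      show "2 * real s2 / p ^ s2 + 1 \<le> (2 * real s2 + 1) / p ^ s2"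
        using ps by (simp add: add_divide_distrib)
    qed (use ps A0 sl * in auto)
    also have "\<dots> = 4 * (real s1 + 1) * (2 * real s2 + 1) * (sqrt l / l)"
    proof -
      have "a * (2 * (q * (x * y))) * (b / x) / (z * y / 2) = 4 * a * b * (q / z)"
        if "x \<noteq> 0" "y \<noteq> 0" for a b q x y z :: real
        using that by (simp add: divide_simps)
      moreover have "p ^ s2 \<noteq> 0" "A \<noteq> 0" using ps A0 by linarith+
      ultimately show ?thesis unfolding R_def by blast
    qed
    also have "sqrt l / l = 1 / sqrt l" using l by (simp add: real_div_sqrt field_simps)
    finally have t2: "real (G * s1 + 1) * (2 * real s2 / p ^ s2 + 1) / R
       \<le> 4 * (real s1 + 1) * (2 * real s2 + 1) / sqrt l" by simp
    show ?case
      using hit_time_upper_bound[of p R N "l * A" G] p * t1 t2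
      unfolding A_def[symmetric] \<pi>_def by (simp add: add_divide_distrib)
  qed
qed

lemma hit_time_lesssim:
  "prob_lesssim init_measure (\<lambda>_. hit_time \<rho> corner_zeros) (\<lambda>p. p powr (- gam))"
  unfolding prob_lesssim_def
proof (rule tendsto_Limsup_prob)
  let ?C = "(16 * real r) ^ s1 + 4 * (real s1 + 1) * (2 * real s2 + 1)"
  show "\<forall>\<^sub>F l in at_top. \<forall>\<^sub>F p in at_right 0. measure (init_measure p)
    {\<omega> \<in> space (init_measure p). hit_time \<rho> corner_zeros \<omega> \<ge> ennreal (l * p powr (- gam))} \<le> ?C / sqrt l"
    using eventually_ge_at_top[of "1::real"] by eventually_elim (use hit_time_upper in simp)
  show "((\<lambda>l. ?C / sqrt l) \<longlongrightarrow> 0) at_top"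
    by (intro tendsto_divide_0[OF tendsto_const] filterlim_at_top_imp_at_infinity sqrt_at_top)
qed simp

end

section \<open>Separated classes of initially occupied sites\<close>

text \<open>Growth in the grid of one class may combine a row of one class with a column of another, hence
  closeness is required of both projections separately and not of a pair of points.\<close>
definition near :: "int \<Rightarrow> (int \<times> int) set \<Rightarrow> (int \<times> int) set \<Rightarrow> bool" where
  "near a c c' \<longleftrightarrow> (\<exists>x\<in>fst ` c. \<exists>x'\<in>fst ` c'. \<bar>x - x'\<bar> \<le> a) \<and> (\<exists>y\<in>snd ` c. \<exists>y'\<in>snd ` c'. \<bar>y - y'\<bar> \<le> a)"

definition spread_le :: "int \<Rightarrow> (int \<times> int) set \<Rightarrow> bool" where
  "spread_le d c \<longleftrightarrow> (\<forall>p\<in>c. \<forall>q\<in>c. \<bar>fst p - fst q\<bar> \<le> d \<and> \<bar>snd p - snd q\<bar> \<le> d)"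

lemma spread_le_mono: "spread_le d c \<Longrightarrow> d \<le> d' \<Longrightarrow> spread_le d' c"
  unfolding spread_le_def by (meson order_trans)

text \<open>The points \<open>u\<close>, \<open>u'\<close> bridge the abscissas and
  \<open>v\<close>, \<open>v'\<close> the ordinates. They may be different pairs, so the two
  coordinates are estimated separately.\<close>

lemma spread_le_Un:
  assumes c: "spread_le d c" "spread_le d' c'" and n: "near a c c'" and nonneg: "0 \<le> d" "0 \<le> d'" "0 \<le> a"
  shows "spread_le (d + d' + a) (c \<union> c')"
proof -
  obtain u u' v v' where uv: "u \<in> c" "u' \<in> c'" "\<bar>fst u - fst u'\<bar> \<le> a" "v \<in> c" "v' \<in> c'" "\<bar>snd v - snd v'\<bar> \<le> a"
    using n unfolding near_def by auto
  have cross: "\<bar>fst p - fst q\<bar> \<le> d + d' + a \<and> \<bar>snd p - snd q\<bar> \<le> d + d' + a" if "p \<in> c" "q \<in> c'" for p q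
  proof -
    have "\<bar>fst p - fst u\<bar> \<le> d" "\<bar>snd p - snd v\<bar> \<le> d" "\<bar>fst u' - fst q\<bar> \<le> d'" "\<bar>snd v' - snd q\<bar> \<le> d'"
      using c uv that unfolding spread_le_def by blast+
    then show ?thesis using uv by linarith
  qed
  show ?thesis unfolding spread_le_def
  proof (intro ballI)
    fix p q assume "p \<in> c \<union> c'" "q \<in> c \<union> c'"
    then consider "p \<in> c" "q \<in> c" | "p \<in> c'" "q \<in> c'" | "p \<in> c" "q \<in> c'" | "q \<in> c" "p \<in> c'" by blast
    then show "\<bar>fst p - fst q\<bar> \<le> d + d' + a \<and> \<bar>snd p - snd q\<bar> \<le> d + d' + a"
    proof cases
      case 1 then show ?thesis using c(1) nonneg unfolding spread_le_def by fastforce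
    next
      case 2 then show ?thesis using c(2) nonneg unfolding spread_le_def by fastforce
    next
      case 3 then show ?thesis by (rule cross)
    next
      case 4 then show ?thesis using cross[OF 4] by linarith
    qed
  qed
qed

text \<open>Among the partitions whose classes \<open>c\<close> have fewer than \<open>M\<close>
  points and spread at most \<open>(card c - 1) * a\<close>, one with the fewest classes is
  separated. Merging two near classes would preserve the spread bound, since
  \<open>(m - 1) a + (m' - 1) a + a = (m + m' - 1) a\<close>, and would yield a smaller partition of
  the same kind.\<close>

lemma separated_partition_exists:
  fixes a :: int and M :: nat
  assumes P: "finite P" and M: "2 \<le> M" and a: "0 \<le> a"
    and dense: "\<And>A. A \<subseteq> P \<Longrightarrow> M \<le> card A \<Longrightarrow> spread_le (2 * int M * a) A \<Longrightarrow> False"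
  obtains \<C> where "partition_on P \<C>" "\<And>c. c \<in> \<C> \<Longrightarrow> spread_le (int M * a) c"
    "\<And>c c'. c \<in> \<C> \<Longrightarrow> c' \<in> \<C> \<Longrightarrow> near a c c' \<Longrightarrow> c = c'"
proof -
  define good where "good = (\<lambda>\<C>. partition_on P \<C> \<and> (\<forall>c\<in>\<C>. card c < M \<and> spread_le ((int (card c) - 1) * a) c))"
  have "good ((\<lambda>x. {x}) ` P)"
    unfolding good_def partition_on_def disjoint_def using M by (auto simp: spread_le_def)
  from ex_has_least_nat[of good, OF this, of card] obtain \<C>
    where \<C>: "good \<C>" and least: "\<And>\<D>. good \<D> \<Longrightarrow> card \<C> \<le> card \<D>" by blast
  have part: "partition_on P \<C>" and small: "\<And>c. c \<in> \<C> \<Longrightarrow> card c < M \<and> spread_le ((int (card c) - 1) * a) c"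
    using \<C> by (auto simp: good_def)
  have fin: "finite \<C>" using part P by (auto intro: finite_elements)
  have finc: "finite c" if "c \<in> \<C>" for c
    using that part P partition_onD1[OF part] by (meson Sup_upper finite_subset)
  have pos: "1 \<le> card c" if "c \<in> \<C>" for c
    using finc[OF that] partition_onD3[OF part] that by (metis One_nat_def Suc_leI card_gt_0_iff)
  have sep: "c = c'" if cc: "c \<in> \<C>" "c' \<in> \<C>" "near a c c'" for c c'
  proof (rule ccontr)
    assume ne: "c \<noteq> c'"
    have disj: "c \<inter> c' = {}" using partition_onD2[OF part] cc ne by (auto simp: disjoint_def)
    have card: "card (c \<union> c') = card c + card c'"
      using disj finc cc by (intro card_Un_disjoint) auto
    have "spread_le ((int (card c) - 1) * a + (int (card c') - 1) * a + a) (c \<union> c')"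
      using small cc pos[OF cc(1)] pos[OF cc(2)] a by (intro spread_le_Un mult_nonneg_nonneg) auto
    then have spr: "spread_le ((int (card (c \<union> c')) - 1) * a) (c \<union> c')"
      unfolding card by (simp add: algebra_simps)
    \<comment> \<open>Otherwise the union, which has fewer than \<open>2 * M\<close> points and thus
      spread at most \<open>2 * M * a\<close>, would be a dense set excluded by
      \<open>dense\<close>.\<close>
    have "card (c \<union> c') < M"
    proof (rule ccontr)
      assume "\<not> ?thesis"
      then have "M \<le> card (c \<union> c')" by simp
      moreover have "int (card (c \<union> c')) - 1 \<le> 2 * int M"
        using small[OF cc(1)] small[OF cc(2)] card by simp
      then have "spread_le (2 * int M * a) (c \<union> c')"
        using spr a by (elim spread_le_mono) (intro mult_right_mono)
      moreover have "c \<union> c' \<subseteq> P" using partition_onD1[OF part] cc by auto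
      ultimately show False using dense by blast
    qed
    moreover have "partition_on P (insert (c \<union> c') (\<C> - {c, c'}))"
    proof (rule partition_onI)
      show "\<Union> (insert (c \<union> c') (\<C> - {c, c'})) = P"
        using partition_onD1[OF part] cc by auto
      show "disjnt q q'" if "q \<in> insert (c \<union> c') (\<C> - {c, c'})" "q' \<in> insert (c \<union> c') (\<C> - {c, c'})" "q \<noteq> q'" for q q'
      proof -
        have D: "disjnt u v" if "u \<in> \<C>" "v \<in> \<C>" "u \<noteq> v" for u v
          using partition_onD2[OF part] that by (auto simp: disjoint_def disjnt_def)
        have "q = c \<union> c' \<or> (q \<in> \<C> \<and> q \<noteq> c \<and> q \<noteq> c')" "q' = c \<union> c' \<or> (q' \<in> \<C> \<and> q' \<noteq> c \<and> q' \<noteq> c')"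
          using that by blast+
        then consider "q = c \<union> c'" "q' = c \<union> c'" | "q = c \<union> c'" "q' \<in> \<C>" "q' \<noteq> c" "q' \<noteq> c'"
          | "q' = c \<union> c'" "q \<in> \<C>" "q \<noteq> c" "q \<noteq> c'" | "q \<in> \<C>" "q' \<in> \<C>" by blast
        then show ?thesis
        proof cases
          case 2
          then have "disjnt c q'" "disjnt c' q'" using D cc by blast+
          then show ?thesis using 2 by (simp add: disjnt_Un1)
        next
          case 3
          then have "disjnt q c" "disjnt q c'" using D cc by blast+
          then show ?thesis using 3 by (simp add: disjnt_Un2)
        qed (use that(3) D in blast)+
      qed
      show "{} \<notin> insert (c \<union> c') (\<C> - {c, c'})"
        using partition_onD3[OF part] cc by auto
    qed
    ultimately have "good (insert (c \<union> c') (\<C> - {c, c'}))"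
      unfolding good_def using spr small by auto
    then have "card \<C> \<le> card (insert (c \<union> c') (\<C> - {c, c'}))" by (rule least)
    also have "\<dots> \<le> Suc (card (\<C> - {c, c'}))" by (rule card_insert_le_m1) auto
    also have "card (\<C> - {c, c'}) = card \<C> - 2"
      using cc ne fin by (subst card_Diff_subset) auto
    finally have "card \<C> \<le> Suc (card \<C> - 2)" .
    moreover have "card {c, c'} \<le> card \<C>" using cc fin by (intro card_mono) auto
    ultimately show False using ne by simp
  qed
  have "spread_le (int M * a) c" if "c \<in> \<C>" for c
  proof (rule spread_le_mono)
    show "spread_le ((int (card c) - 1) * a) c" using small[OF that] by simp
    show "(int (card c) - 1) * a \<le> int M * a" using small[OF that] a by (intro mult_right_mono) auto
  qed
  then show ?thesis using that part sep by blast
qed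

definition grid :: "(int \<times> int) set \<Rightarrow> (int \<times> int) set" where
  "grid c = fst ` c \<times> snd ` c"

lemma subset_grid: "c \<subseteq> grid c"
  by (force simp: grid_def)

lemma near_if_grid:
  assumes "z \<in> grid c" "z' \<in> grid c'" "\<bar>fst z - fst z'\<bar> \<le> a" "\<bar>snd z - snd z'\<bar> \<le> a"
  shows "near a c c'"
  using assms unfolding near_def grid_def mem_Times_iff by blast

section \<open>Closure of the initial sites in the presence of full columns\<close>

context cross_growth begin

text \<open>The rule for \<open>r\<close> vertical neighbors is left out: a column in which it applies is added to
  \<open>B\<close> as a whole.\<close>
inductive_set closure_with :: "int set \<Rightarrow> (int \<times> int) set \<Rightarrow> (int \<times> int) set"
  for B :: "int set" and P :: "(int \<times> int) set" where
  column: "fst z \<in> B \<Longrightarrow> z \<in> closure_with B P"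
| initial: "z \<in> P \<Longrightarrow> z \<in> closure_with B P"
| corner: "U \<subseteq> nbhd_h \<rho> z \<Longrightarrow> card U = s1 \<Longrightarrow> V \<subseteq> nbhd_v \<rho> z \<Longrightarrow> card V = s2 \<Longrightarrow>
    \<forall>u\<in>U. u \<in> closure_with B P \<Longrightarrow> \<forall>v\<in>V. v \<in> closure_with B P \<Longrightarrow> z \<in> closure_with B P"

end

text \<open>Two sites seen from one site differ by at most \<open>2 * \<rho>\<close> in each
  coordinate. With this separation, grid sites that occur together in one neighborhood cross belong
  to the grid of a single class.\<close>

locale separated_classes = cross_growth +
  fixes P :: "(int \<times> int) set" and \<C> :: "(int \<times> int) set set" and \<Delta> :: int
  assumes finite_P: "finite P" and partition: "partition_on P \<C>"
    and spread: "\<And>c. c \<in> \<C> \<Longrightarrow> spread_le \<Delta> c"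
    and separated: "\<And>c c'. c \<in> \<C> \<Longrightarrow> c' \<in> \<C> \<Longrightarrow> near (2 * int \<rho>) c c' \<Longrightarrow> c = c'"
    and \<Delta>_nonneg: "0 \<le> \<Delta>"
begin

text \<open>Large enough for two purposes: a full column within \<open>\<rho>\<close> of some column
  of a class is within \<open>reach\<close> of all columns of that class, and the full columns in a
  window of radius \<open>\<rho>\<close> have mutual distances at most \<open>reach\<close>.\<close>

abbreviation reach :: int where "reach \<equiv> \<Delta> + 2 * int \<rho>"

abbreviation closed :: "int set \<Rightarrow> (int \<times> int) set" where "closed B \<equiv> closure_with B P"

definition thin :: "int set \<Rightarrow> bool" where
  "thin B \<longleftrightarrow> (\<forall>x. card (B \<inter> {x - int \<rho>..x + int \<rho>}) < s1)"

text \<open>Apart from membership in the grid, the condition concerns only the row of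
  \<open>z\<close>, so it passes along a row from one grown site to the next. It is required at
  every column \<open>x\<close> of the class in order to be available later at the column that
  becomes full.\<close>

definition grown_in :: "int set \<Rightarrow> (int \<times> int) set \<Rightarrow> int \<times> int \<Rightarrow> bool" where
  "grown_in B c z \<longleftrightarrow> z \<in> grid c \<and> (\<forall>x\<in>fst ` c.
     s1 \<le> card {q\<in>c. snd q = snd z \<and> fst q \<notin> B} + card (B \<inter> {x - reach..x + reach}))"

lemma class_subset: "c \<in> \<C> \<Longrightarrow> c \<subseteq> P"
  using partition_onD1[OF partition] by auto

lemma finite_class: "c \<in> \<C> \<Longrightarrow> finite c"
  using class_subset finite_P finite_subset by blast

lemma class_exists: "z \<in> P \<Longrightarrow> \<exists>c\<in>\<C>. z \<in> c"
  using partition_onD1[OF partition] by auto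

text \<open>For a site grown outside \<open>B\<close>, a vertical neighbor provides the column of
  some grid. Since \<open>B\<close> is thin, the horizontal neighbors do not all lie in full
  columns, and one outside them provides the row. Separation makes both grids belong to the same
  class.\<close>

lemma closed_cases:
  assumes thin: "thin B" and z: "z \<in> closed B"
  shows "fst z \<in> B \<or> z \<in> P \<or> (\<exists>c\<in>\<C>. grown_in B c z)"
  using z
proof (induction rule: closure_with.induct)
  case (corner U z V)
  obtain x y where z: "z = (x, y)" by (cases z)
  show ?case
  proof (cases "x \<in> B")
    case True
    then show ?thesis by (simp add: z)
  next
    case False
    have finU: "finite U" using corner finite_subset finite_nbhd by metis
    have U: "snd u = y" "\<bar>fst u - x\<bar> \<le> int \<rho>" if "u \<in> U" for u
      using subsetD[OF corner(1) that] by (auto simp: z nbhd_h_eq)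
    have V: "fst v = x" "\<bar>snd v - y\<bar> \<le> int \<rho>" if "v \<in> V" for v
      using subsetD[OF corner(3) that] by (auto simp: z nbhd_v_eq)
    have in_grid: "\<exists>c\<in>\<C>. w \<in> grid c" if "w \<in> P \<or> (\<exists>c\<in>\<C>. grown_in B c w)" for w
      using that class_exists subset_grid unfolding grown_in_def by blast
    obtain v where v: "v \<in> V" using corner(4) s2_pos by (metis card.empty ex_in_conv not_one_le_zero)
    then have "v \<in> P \<or> (\<exists>c\<in>\<C>. grown_in B c v)" using corner(6) V(1)[OF v] False by auto
    then obtain c where c: "c \<in> \<C>" "v \<in> grid c" using in_grid by blast
    have same: "c' = c" if "u \<in> U" "c' \<in> \<C>" "u \<in> grid c'" for u c'
      by (rule separated[OF that(2) c(1) near_if_grid[OF that(3) c(2)]])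
        (use U[OF that(1)] V[OF v] in auto)
    let ?W = "B \<inter> {x - int \<rho>..x + int \<rho>}"
    have "\<exists>u\<in>U. fst u \<notin> B"
    proof (rule ccontr)
      assume "\<not> ?thesis"
      then have "U \<subseteq> ?W \<times> {y}" using U by (fastforce simp: abs_le_iff)
      then have "card U \<le> card (?W \<times> {y})" by (intro card_mono) auto
      also have "\<dots> < s1" using thin by (simp add: thin_def card_cartesian_product)
      finally show False using corner(2) by simp
    qed
    then obtain u where u: "u \<in> U" "fst u \<notin> B" by blast
    have cases_U: "w \<in> P \<or> (\<exists>c\<in>\<C>. grown_in B c w)" if "w \<in> U" "fst w \<notin> B" for w
      using corner(5) that by auto
    have ug: "u \<in> grid c" using cases_U[OF u] in_grid same[OF u(1)] by blast
    have zg: "z \<in> grid c" using ug c(2) U(1)[OF u(1)] V(1)[OF v] by (auto simp: grid_def z mem_Times_iff)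
    show ?thesis
    \<comment> \<open>If a horizontal neighbor outside \<open>B\<close> was itself grown, its row
      condition is inherited. Otherwise the \<open>s1\<close> neighbors are initial sites of
      \<open>c\<close> or sites of full columns, and they are counted directly.\<close>
    proof (cases "\<forall>w\<in>U. fst w \<notin> B \<longrightarrow> w \<in> P")
      case False
      then obtain w where w: "w \<in> U" "fst w \<notin> B" "w \<notin> P" by blast
      then obtain c' where c': "c' \<in> \<C>" "grown_in B c' w" using cases_U by blast
      then have "c' = c" using same[OF w(1)] by (auto simp: grown_in_def)
      then have "grown_in B c z" using c' zg U(1)[OF w(1)] by (simp add: grown_in_def z)
      then show ?thesis using c by blast
    next
      case True
      have "w \<in> c" if w: "w \<in> U" "fst w \<notin> B" for w
      proof -
        obtain c' where "c' \<in> \<C>" "w \<in> c'" using True w class_exists by blast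
        then show ?thesis using same[OF w(1)] subset_grid by blast
      qed
      then have Usub: "U \<subseteq> {q\<in>c. snd q = y \<and> fst q \<notin> B} \<union> ?W \<times> {y}"
        using U by (fastforce simp: abs_le_iff)
      have "s1 \<le> card {q\<in>c. snd q = y \<and> fst q \<notin> B} + card (B \<inter> {x0 - reach..x0 + reach})"
        if x0: "x0 \<in> fst ` c" for x0
      proof -
        have "x \<in> fst ` c" using zg by (auto simp: grid_def z)
        then have "\<bar>x - x0\<bar> \<le> \<Delta>" using spread[OF c(1)] x0 unfolding spread_le_def by blast
        then have W: "?W \<subseteq> B \<inter> {x0 - reach..x0 + reach}" by auto
        have "s1 \<le> card ({q\<in>c. snd q = y \<and> fst q \<notin> B} \<union> ?W \<times> {y})"
          using corner(2) card_mono[OF _ Usub] finite_class[OF c(1)] by auto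
        also have "\<dots> \<le> card {q\<in>c. snd q = y \<and> fst q \<notin> B} + card (?W \<times> {y})"
          by (rule card_Un_le)
        also have "card (?W \<times> {y}) = card ?W" by (simp add: card_cartesian_product)
        also have "\<dots> \<le> card (B \<inter> {x0 - reach..x0 + reach})"
          using W by (intro card_mono) auto
        finally show ?thesis by simp
      qed
      then have "grown_in B c z" using zg by (simp add: grown_in_def z)
      then show ?thesis using c by blast
    qed
  qed
qed auto

lemma closed_grid:
  assumes "thin B" "z \<in> closed B" "fst z \<notin> B"
  shows "\<exists>c\<in>\<C>. z \<in> grid c"
  using closed_cases[OF assms(1,2)] assms(3) class_exists subset_grid unfolding grown_in_def by blast

text \<open>The closed sites of a vertical neighborhood in a column that is not full are pairwise
  near, so they share one class, and their distinct ordinates are rows of that class.\<close>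

lemma closed_column_class:
  assumes "thin B" "x \<notin> B" "k \<le> card (nbhd_v \<rho> (x, y) \<inter> closed B)" "1 \<le> k"
  obtains c where "c \<in> \<C>" "nbhd_v \<rho> (x, y) \<inter> closed B \<subseteq> grid c" "x \<in> fst ` c" "k \<le> card (snd ` c)"
    "\<And>w. w \<in> c \<Longrightarrow> \<bar>fst w - x\<bar> \<le> \<Delta> \<and> \<bar>snd w - y\<bar> \<le> \<Delta> + int \<rho>"
proof -
  let ?N = "nbhd_v \<rho> (x, y) \<inter> closed B"
  have N: "fst w = x" "\<bar>snd w - y\<bar> \<le> int \<rho>" if "w \<in> ?N" for w
    using that by (auto simp: nbhd_v_eq)
  have finN: "finite ?N" by simp
  have "?N \<noteq> {}" using assms(3,4) by (metis card.empty le_zero_eq not_one_le_zero)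
  then obtain v where v: "v \<in> ?N" by blast
  then obtain c where c: "c \<in> \<C>" "v \<in> grid c" using closed_grid[OF assms(1)] N(1)[OF v] assms(2) by blast
  have sub: "?N \<subseteq> grid c"
  proof
    fix w assume w: "w \<in> ?N"
    then obtain c' where c': "c' \<in> \<C>" "w \<in> grid c'" using closed_grid[OF assms(1)] N(1)[OF w] assms(2) by blast
    have "c' = c" by (rule separated[OF c'(1) c(1) near_if_grid[OF c'(2) c(2)]]) (use N[OF v] N[OF w] in auto)
    then show "w \<in> grid c" using c' by simp
  qed
  have x: "x \<in> fst ` c" using c(2) N(1)[OF v] by (simp add: grid_def mem_Times_iff)
  have "inj_on snd ?N" using N(1) by (intro inj_onI) (metis prod_eq_iff)
  then have "card ?N = card (snd ` ?N)" by (simp add: card_image)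
  also have "\<dots> \<le> card (snd ` c)"
    using sub finite_class[OF c(1)] by (intro card_mono) (auto simp: grid_def)
  finally have k: "k \<le> card (snd ` c)" using assms(3) by linarith
  have "\<bar>fst w - x\<bar> \<le> \<Delta> \<and> \<bar>snd w - y\<bar> \<le> \<Delta> + int \<rho>" if "w \<in> c" for w
  proof -
    obtain p where p: "p \<in> c" "snd p = snd v" using c(2) by (auto simp: grid_def mem_Times_iff)
    obtain p' where p': "p' \<in> c" "fst p' = x" using x by auto
    have "\<bar>fst w - fst p'\<bar> \<le> \<Delta>" "\<bar>snd w - snd p\<bar> \<le> \<Delta>"
      using spread[OF c(1)] that p p' unfolding spread_le_def by blast+
    then show ?thesis using p p' N(2)[OF v] by auto
  qed
  then show ?thesis using that c(1) sub x k by blast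
qed

end

section \<open>Counting the sites that create full columns\<close>

definition linked :: "int \<Rightarrow> int set \<Rightarrow> bool" where
  "linked d C \<longleftrightarrow> (\<forall>z\<in>C. (\<exists>w\<in>C. z < w) \<longrightarrow> (\<exists>w\<in>C. z < w \<and> w \<le> z + d))"

lemma linked_left:
  assumes "linked d C"
  shows "linked d {z\<in>C. z < x}"
  unfolding linked_def
proof (intro ballI impI)
  fix z assume z: "z \<in> {z\<in>C. z < x}" and "\<exists>w\<in>{z\<in>C. z < x}. z < w"
  then obtain w where w: "w \<in> C" "w < x" "z < w" by blast
  obtain f where f: "f \<in> C" "z < f" "f \<le> z + d" using assms z w unfolding linked_def by blast
  show "\<exists>w\<in>{z\<in>C. z < x}. z < w \<and> w \<le> z + d"
  proof (cases "f < x")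
    case True
    then show ?thesis using f by blast
  next
    case False
    then have "w \<le> z + d" using f w by simp
    then show ?thesis using w by blast
  qed
qed

lemma linked_right:
  assumes "linked d C"
  shows "linked d {z\<in>C. x < z}"
  unfolding linked_def
proof (intro ballI impI)
  fix z assume z: "z \<in> {z\<in>C. x < z}" and "\<exists>w\<in>{z\<in>C. x < z}. z < w"
  then obtain f where f: "f \<in> C" "z < f" "f \<le> z + d" using assms unfolding linked_def by blast
  then show "\<exists>w\<in>{z\<in>C. x < z}. z < w \<and> w \<le> z + d" using z by auto
qed

lemma linked_insert:
  assumes C: "linked d C" "finite C" and w: "w \<in> C" "\<bar>z - w\<bar> \<le> d" and d: "0 \<le> d"
  shows "linked d (insert z C)"
proof (cases "z \<in> C")
  case True
  then show ?thesis using C by (simp add: insert_absorb)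
next
  case False
  show ?thesis unfolding linked_def
  proof (intro ballI impI)
    fix e assume e: "e \<in> insert z C" and ex: "\<exists>f\<in>insert z C. e < f"
    show "\<exists>f\<in>insert z C. e < f \<and> f \<le> e + d"
    proof (cases "e = z")
      case True
      then obtain f where f: "f \<in> C" "z < f" using ex by auto
      show ?thesis
      proof (cases "z < w")
        case True
        then show ?thesis using w \<open>e = z\<close> by (intro bexI[of _ w]) auto
      next
        case wz: False
        \<comment> \<open>The largest element \<open>m\<close> of \<open>C\<close> below
          \<open>z\<close> has a larger element \<open>g\<close> within \<open>d\<close>. It lies
          beyond \<open>z\<close>, hence within \<open>d\<close> of \<open>z\<close> too.\<close>
        define m where "m = Max {e\<in>C. e < z}"
        have "w < z" using wz w(1) False by (metis linorder_neqE)
        then have ne: "w \<in> {e\<in>C. e < z}" using w by simp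
        have m: "m \<in> {e\<in>C. e < z}" unfolding m_def using C(2) ne by (intro Max_in) auto
        then have "\<exists>g\<in>C. m < g \<and> g \<le> m + d" using C(1) f unfolding linked_def by force
        then obtain g where g: "g \<in> C" "m < g" "g \<le> m + d" by blast
        have "\<not> g < z"
        proof
          assume "g < z"
          then have "g \<le> m" unfolding m_def using g C(2) by (intro Max_ge) auto
          then show False using g by simp
        qed
        moreover have "g \<noteq> z" using g False by auto
        ultimately have "z < g" "g \<le> z + d" using g m by auto
        then show ?thesis using g \<open>e = z\<close> by blast
      qed
    next
      case False
      then have eC: "e \<in> C" using e by simp
      show ?thesis
      proof (cases "\<exists>f\<in>C. e < f")
        case True
        then show ?thesis using C(1) eC unfolding linked_def by blast
      next
        case no: False
        then have "e < z" "w \<le> e" using ex w(1) by (auto simp: not_less)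
        then show ?thesis using w by (intro bexI[of _ z]) auto
      qed
    qed
  qed
qed

lemma linked_dist:
  assumes C: "linked d C" "finite C" and d: "0 \<le> d"
  shows "u \<in> C \<Longrightarrow> v \<in> C \<Longrightarrow> u \<le> v \<Longrightarrow> v - u \<le> d * int (card {w\<in>C. u < w \<and> w \<le> v})"
proof (induction "nat (v - u)" arbitrary: u rule: less_induct)
  case less
  show ?case
  proof (cases "u = v")
    case False
    then have uv: "u < v" using less by simp
    then obtain f where f: "f \<in> C" "u < f" "f \<le> u + d" using C(1) less unfolding linked_def by blast
    show ?thesis
    proof (cases "f \<le> v")
      case True
      have IH: "v - f \<le> d * int (card {w\<in>C. f < w \<and> w \<le> v})"
        by (rule less(1)) (use True f less in auto)
      have "card (insert f {w\<in>C. f < w \<and> w \<le> v}) \<le> card {w\<in>C. u < w \<and> w \<le> v}"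
        using C(2) f True by (intro card_mono) auto
      then have "1 + int (card {w\<in>C. f < w \<and> w \<le> v}) \<le> int (card {w\<in>C. u < w \<and> w \<le> v})"
        using C(2) by simp
      then have "d * (1 + int (card {w\<in>C. f < w \<and> w \<le> v})) \<le> d * int (card {w\<in>C. u < w \<and> w \<le> v})"
        using d by (rule mult_left_mono)
      then show ?thesis using IH f by (simp add: algebra_simps)
    next
      case False
      have "card {v} \<le> card {w\<in>C. u < w \<and> w \<le> v}"
        using C(2) less uv by (intro card_mono) auto
      then have "d * 1 \<le> d * int (card {w\<in>C. u < w \<and> w \<le> v})"
        using d by (intro mult_left_mono) auto
      moreover have "v - u \<le> d" using False f by linarith
      ultimately show ?thesis by linarith
    qed
  qed (use d in auto)
qed

lemma initial_segment_exists:
  fixes J :: "nat set"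
  assumes "finite J" "m \<le> card J"
  shows "\<exists>J'\<subseteq>J. card J' = m \<and> (\<forall>i\<in>J'. \<forall>j\<in>J. j < i \<longrightarrow> j \<in> J')"
  using assms(2)
proof (induction m)
  case 0
  show ?case by (rule exI[of _ "{}"]) auto
next
  case (Suc m)
  then obtain J' where J': "J' \<subseteq> J" "card J' = m" "\<forall>i\<in>J'. \<forall>j\<in>J. j < i \<longrightarrow> j \<in> J'" by auto
  have fin: "finite J'" using J' assms finite_subset by blast
  have "J - J' \<noteq> {}"
  proof
    assume "J - J' = {}"
    then have "J = J'" using J'(1) by blast
    then show False using J'(2) Suc.prems by simp
  qed
  then have mem: "Min (J - J') \<in> J - J'" using assms by (intro Min_in) auto
  have least: "j \<in> J'" if "j \<in> J" "j < Min (J - J')" for j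
    using that assms by (metis Diff_iff Min_le finite_Diff leD)
  show ?case
  proof (intro exI[of _ "insert (Min (J - J')) J'"] conjI)
    show "card (insert (Min (J - J')) J') = Suc m" using mem fin J' by simp
    show "\<forall>i\<in>insert (Min (J - J')) J'. \<forall>j\<in>J. j < i \<longrightarrow> j \<in> insert (Min (J - J')) J'"
      using J' least by blast
  qed (use mem J' in auto)
qed

text \<open>Column \<open>i\<close> has \<open>a\<close> sites of its own and \<open>R\<close> grown
  rows, each contributing at least \<open>s - k\<close> further sites; \<open>l\<close> of the
  \<open>m\<close> columns of the class precede it. If it is the last one,
  \<open>a + R \<ge> r\<close> suffices. Otherwise \<open>a\<close> is small, so
  \<open>(s + 1) * R \<ge> r - s2\<close>, and each of the \<open>s - k - 1\<close> further
  multiples of \<open>R\<close> pays for one later column.\<close>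

lemma count_arith:
  fixes s r s2 a R l m k :: nat
  assumes "1 \<le> s" "s2 < r" "r \<le> a + R" "k < s" "l < m"
    and "l = m - 1 \<or> ((s + 1) * a < r - s2 \<and> m - 1 - l \<le> s - 1 - k)"
  shows "(s + 1) * r + (m - 1 - l) * (r - s2) \<le> (s + 1) * (a + R * (s - k))"
proof (cases "l = m - 1")
  case True
  have "R * 1 \<le> R * (s - k)" using assms by (intro mult_left_mono) auto
  then have "r \<le> a + R * (s - k)" using assms by linarith
  then have "(s + 1) * r \<le> (s + 1) * (a + R * (s - k))" by (rule mult_left_mono) simp
  then show ?thesis using True by simp
next
  case False
  then have a: "(s + 1) * a < r - s2" and e: "m - 1 - l \<le> s - 1 - k" using assms by auto
  obtain t where t: "s - k = Suc t" using assms by (metis Suc_diff_Suc)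
  then have et: "m - 1 - l \<le> t" using e by simp
  have "(s + 1) * r = s * r + r" by simp
  moreover have "1 * r \<le> s * r" using assms by (intro mult_right_mono) auto
  ultimately have "r + r \<le> (s + 1) * r" by linarith
  moreover have "(s + 1) * r \<le> (s + 1) * a + (s + 1) * R"
    using assms(3) by (metis add_mult_distrib2 mult_le_mono2)
  ultimately have "r - s2 \<le> (s + 1) * R" using a by linarith
  then have "(m - 1 - l) * (r - s2) \<le> t * ((s + 1) * R)" using et by (rule mult_le_mono[rotated])
  moreover have "(s + 1) * r \<le> (s + 1) * (a + R)" using assms(3) by (rule mult_left_mono) simp
  ultimately show ?thesis unfolding t by (simp add: algebra_simps)
qed

text \<open>A row grown in column \<open>b i\<close> contains \<open>s\<close> sites outside this column, all but
  \<open>card {j\<in>J. j < i}\<close> of them initially occupied.  The count is evaluated at the first column of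
  \<open>I\<close> with less than \<open>(r - s2) / (s + 1)\<close> sites of its own, or at the last column if there is none.\<close>
lemma class_count:
  fixes b :: "nat \<Rightarrow> int" and c :: "(int \<times> int) set" and Y :: "nat \<Rightarrow> int set" and s r s2 :: nat
  assumes c: "finite c" and J: "finite J" "card J = s" and I: "I \<subseteq> J" "I \<noteq> {}" and inj: "inj_on b J"
    and s: "1 \<le> s" "s2 < r"
    and finY: "\<And>i. i \<in> I \<Longrightarrow> finite (Y i)"
    and B: "\<And>i j. i \<in> I \<Longrightarrow> j \<in> J \<Longrightarrow> j < i \<Longrightarrow> b j \<in> B i"
    and rows: "\<And>i. i \<in> I \<Longrightarrow> r \<le> card {q\<in>c. fst q = b i} + card (Y i)"
    and row: "\<And>i y. i \<in> I \<Longrightarrow> y \<in> Y i \<Longrightarrow>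
      s \<le> card {q\<in>c. snd q = y \<and> fst q \<notin> B i \<and> fst q \<noteq> b i} + card {j\<in>J. j < i}"
  shows "(s + 1) * r + (card I - 1) * (r - s2) \<le> (s + 1) * card c"
proof -
  define a where "a = (\<lambda>i. card {q\<in>c. fst q = b i})"
  have finI: "finite I" using I J finite_subset by blast
  define low where "low = (\<lambda>i. (s + 1) * a i < r - s2)"
  obtain i where i: "i \<in> I" "\<And>j. j \<in> I \<Longrightarrow> j < i \<Longrightarrow> \<not> low j" and i_or: "low i \<or> (\<forall>j\<in>I. j \<le> i)"
  proof (cases "\<exists>i\<in>I. low i")
    case True
    define i where "i = (LEAST i. i \<in> I \<and> low i)"
    have "i \<in> I \<and> low i" 
      unfolding i_def by (rule LeastI_ex[of "\<lambda>i. i \<in> I \<and> low i"]) (use True in blast)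
    moreover have "\<not> low j" if "j \<in> I" "j < i" for j
      using that not_less_Least unfolding i_def by blast
    ultimately show ?thesis using that by blast
  next
    case False
    then show ?thesis using that[of "Max I"] finI I by auto
  qed
  let ?k = "card {j\<in>J. j < i}" and ?l = "card {j\<in>I. j < i}"
  have iJ: "i \<in> J" using i I by blast
  have k: "?k < s"
    unfolding J(2)[symmetric] using J(1) iJ by (intro psubset_card_mono) auto
  have l: "?l < card I"
    using finI i by (intro psubset_card_mono) auto
  have later: "card I - 1 - ?l = card {j\<in>I. i < j}"
  proof -
    have "I = {j\<in>I. j < i} \<union> {i} \<union> {j\<in>I. i < j}" using i by auto
    then have "card I = card ({j\<in>I. j < i} \<union> {i} \<union> {j\<in>I. i < j})" by simp
    also have "\<dots> = ?l + 1 + card {j\<in>I. i < j}" using finI by (subst card_Un_disjoint; auto)+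
    finally show ?thesis by simp
  qed
  have laterJ: "s - 1 - ?k = card {j\<in>J. i < j}"
  proof -
    have "J = {j\<in>J. j < i} \<union> {i} \<union> {j\<in>J. i < j}" using iJ by auto
    then have "s = card ({j\<in>J. j < i} \<union> {i} \<union> {j\<in>J. i < j})" using J by simp
    also have "\<dots> = ?k + 1 + card {j\<in>J. i < j}" using J by (subst card_Un_disjoint; auto)+
    finally show ?thesis by simp
  qed
  have "?l = card I - 1 \<or> (low i \<and> card I - 1 - ?l \<le> s - 1 - ?k)"
    using i_or
  proof
    assume "low i"
    moreover have "card {j\<in>I. i < j} \<le> card {j\<in>J. i < j}" using I J by (intro card_mono) auto
    ultimately show ?thesis unfolding later laterJ by blast
  next
    assume "\<forall>j\<in>I. j \<le> i"
    then have "{j\<in>I. i < j} = {}" by fastforce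
    then have "card {j\<in>I. i < j} = 0" by (metis card.empty)
    then show ?thesis using later l by linarith
  qed
  then have arith: "(s + 1) * r + (card I - 1 - ?l) * (r - s2) \<le> (s + 1) * (a i + card (Y i) * (s - ?k))"
    using rows[OF i(1)] s k l unfolding low_def a_def by (intro count_arith) auto
  let ?X = "\<lambda>j. {q\<in>c. fst q = b j}" and ?Z = "\<lambda>y. {q\<in>c. snd q = y \<and> fst q \<notin> B i \<and> fst q \<noteq> b i}"
  have U1: "card (\<Union>j\<in>{j\<in>I. j < i}. ?X j) = (\<Sum>j\<in>{j\<in>I. j < i}. a j)"
    unfolding a_def using finI c inj I
    by (intro card_UN_disjoint) (auto simp: inj_on_def subset_iff)
  have U2: "card (\<Union>y\<in>Y i. ?Z y) = (\<Sum>y\<in>Y i. card (?Z y))"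
    using finY[OF i(1)] c by (intro card_UN_disjoint) auto
  have "?l * (r - s2) = (\<Sum>j\<in>{j\<in>I. j < i}. r - s2)" by simp
  also have "\<dots> \<le> (\<Sum>j\<in>{j\<in>I. j < i}. (s + 1) * a j)"
    using i(2) unfolding low_def by (intro sum_mono) (auto simp: not_less)
  also have "\<dots> = (s + 1) * (\<Sum>j\<in>{j\<in>I. j < i}. a j)" by (simp add: sum_distrib_left)
  finally have e1: "?l * (r - s2) \<le> (s + 1) * (\<Sum>j\<in>{j\<in>I. j < i}. a j)" .
  have e2: "card (Y i) * (s - ?k) \<le> (\<Sum>y\<in>Y i. card (?Z y))"
  proof -
    have "(\<Sum>y\<in>Y i. s - ?k) \<le> (\<Sum>y\<in>Y i. card (?Z y))"
      using row[OF i(1)] by (intro sum_mono) (simp add: le_diff_conv)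
    then show ?thesis by simp
  qed
  \<comment> \<open>The three parts of \<open>c\<close> are disjoint: distinct indices give distinct
    columns, the earlier columns belong to \<open>B i\<close>, and the sites counted in the grown
    rows avoid both \<open>B i\<close> and the column \<open>b i\<close>.\<close>
  have "(\<Sum>j\<in>{j\<in>I. j < i}. a j) + a i + (\<Sum>y\<in>Y i. card (?Z y))
      = card ((\<Union>j\<in>{j\<in>I. j < i}. ?X j) \<union> ?X i \<union> (\<Union>y\<in>Y i. ?Z y))"
  proof -
    have d1: "(\<Union>j\<in>{j\<in>I. j < i}. ?X j) \<inter> ?X i = {}"
    proof -
      have ne: "b j \<noteq> b i" if "j \<in> I" "j < i" for j
        using inj_onD[OF inj, of j i] that I iJ by blast
      show ?thesis
      proof (rule equals0I)
        fix q assume "q \<in> (\<Union>j\<in>{j\<in>I. j < i}. ?X j) \<inter> ?X i"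
        then obtain j where "j \<in> I" "j < i" "fst q = b j" "fst q = b i" by blast
        then show False using ne[of j] by simp
      qed
    qed
    have d2: "((\<Union>j\<in>{j\<in>I. j < i}. ?X j) \<union> ?X i) \<inter> (\<Union>y\<in>Y i. ?Z y) = {}"
      using B[OF i(1)] I by auto
    have f: "finite (\<Union>j\<in>{j\<in>I. j < i}. ?X j)" "finite (?X i)" "finite (\<Union>y\<in>Y i. ?Z y)"
      using c finI finY[OF i(1)] by auto
    show ?thesis
      using f by (simp add: card_Un_disjoint[OF _ _ d2] card_Un_disjoint[OF _ _ d1] U1 U2 a_def)
  qed
  also have "\<dots> \<le> card c" using c by (intro card_mono) auto
  finally have "(s + 1) * ((\<Sum>j\<in>{j\<in>I. j < i}. a j) + a i + (\<Sum>y\<in>Y i. card (?Z y))) \<le> (s + 1) * card c"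
    by (rule mult_left_mono) simp
  moreover have "(s + 1) * (a i + card (Y i) * (s - ?k)) \<le> (s + 1) * (a i + (\<Sum>y\<in>Y i. card (?Z y)))"
    using e2 by (intro mult_left_mono) auto
  ultimately have "?l * (r - s2) + ((s + 1) * r + (card I - 1 - ?l) * (r - s2)) \<le> (s + 1) * card c"
    using e1 arith unfolding distrib_left by linarith
  moreover have "?l * (r - s2) + (card I - 1 - ?l) * (r - s2) = (card I - 1) * (r - s2)"
    using l by (simp add: distrib_right[symmetric])
  ultimately show ?thesis by linarith
qed

section \<open>Clusters of full columns\<close>

definition sparse :: "int \<Rightarrow> nat \<Rightarrow> int set \<Rightarrow> bool" where
  "sparse d s B \<longleftrightarrow> (\<forall>C\<subseteq>B. linked d C \<longrightarrow> card C < s)"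

lemma sparseD: "sparse d s B \<Longrightarrow> C \<subseteq> B \<Longrightarrow> linked d C \<Longrightarrow> card C < s"
  unfolding sparse_def by simp

lemma sparse_subset: "sparse d s B \<Longrightarrow> A \<subseteq> B \<Longrightarrow> sparse d s A"
  unfolding sparse_def by blast

text \<open>A linked subset of largest cardinality absorbs every point within \<open>d\<close> of
  it. It contains \<open>x\<close> because \<open>B\<close> is sparse, and its parts on both sides
  of \<open>x\<close> are linked subsets of \<open>B\<close>, so each has fewer than
  \<open>s\<close> points. This limits its extent around \<open>x\<close>.\<close>

lemma maximal_linked:
  assumes B: "finite B" "sparse d s B" and x: "x \<notin> B" and d: "0 \<le> d"
    and not_sparse: "\<not> sparse d s (insert x B)"
  obtains C where "C \<subseteq> insert x B" "s \<le> card C"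
    "\<And>z w. z \<in> insert x B \<Longrightarrow> w \<in> C \<Longrightarrow> \<bar>z - w\<bar> \<le> d \<Longrightarrow> z \<in> C"
    "\<And>z. z \<in> C \<Longrightarrow> \<bar>z - x\<bar> \<le> d * int s"
proof -
  define good where "good = (\<lambda>C. C \<subseteq> insert x B \<and> linked d C)"
  have bound: "card C \<le> card (insert x B)" if "good C" for C
    using that B unfolding good_def by (intro card_mono) auto
  obtain C0 where C0: "good C0" "s \<le> card C0"
    using not_sparse unfolding sparse_def good_def by (auto simp: not_less)
  obtain C where C: "good C" and max: "\<And>D. good D \<Longrightarrow> card D \<le> card C"
    using ex_has_greatest_nat[of good C0 card "Suc (card (insert x B))"] C0 bound by (auto simp: less_Suc_eq_le)
  have sub: "C \<subseteq> insert x B" and lk: "linked d C" using C by (auto simp: good_def)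
  have fin: "finite C" using sub B finite_subset by blast
  have sC: "s \<le> card C" using max[OF C0(1)] C0 by linarith
  have closed: "z \<in> C" if "z \<in> insert x B" "w \<in> C" "\<bar>z - w\<bar> \<le> d" for z w
  proof (rule ccontr)
    assume "z \<notin> C"
    have "good (insert z C)"
      unfolding good_def using linked_insert[OF lk fin that(2,3) d] sub that by auto
    from max[OF this] show False using \<open>z \<notin> C\<close> fin by simp
  qed
  have xC: "x \<in> C"
  proof (rule ccontr)
    assume "x \<notin> C"
    then have "C \<subseteq> B" using sub by blast
    then have "card C < s" using B(2) lk by (intro sparseD)
    then show False using sC by simp
  qed
  have left: "card {z\<in>C. z < x} < s"
    by (rule sparseD[OF B(2) _ linked_left[OF lk]]) (use sub in auto)
  have right: "card {z\<in>C. x < z} < s"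
    by (rule sparseD[OF B(2) _ linked_right[OF lk]]) (use sub in auto)
  have "\<bar>z - x\<bar> \<le> d * int s" if z: "z \<in> C" for z
  proof (cases "z \<le> x")
    case True
    have "card {w\<in>C. z < w \<and> w \<le> x} \<le> card (insert x {w\<in>C. w < x})"
      using fin by (intro card_mono) auto
    also have "\<dots> \<le> s" using left fin by simp
    finally have "d * int (card {w\<in>C. z < w \<and> w \<le> x}) \<le> d * int s" using d by (intro mult_left_mono) auto
    then show ?thesis using linked_dist[OF lk fin d z xC True] True by linarith
  next
    case False
    have "card {w\<in>C. x < w \<and> w \<le> z} \<le> card {w\<in>C. x < w}"
      using fin by (intro card_mono) auto
    then have "d * int (card {w\<in>C. x < w \<and> w \<le> z}) \<le> d * int s" using right d by (intro mult_left_mono) auto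
    moreover have "z - x \<le> d * int (card {w\<in>C. x < w \<and> w \<le> z})"
      using False by (intro linked_dist[OF lk fin d xC z]) simp
    ultimately show ?thesis using False by linarith
  qed
  then show ?thesis using that sub sC closed by blast
qed

context cross_growth begin

text \<open>The cost of \<open>s1\<close> full columns created by \<open>k\<close> classes, located by their leftmost abscissa
  \<open>v\<close> and their lowest ordinates \<open>hs\<close>.\<close>
definition heavy :: "int \<Rightarrow> (int \<times> int) set \<Rightarrow> bool" where
  "heavy \<Delta> P \<longleftrightarrow> (\<exists>v\<in>fst ` P. \<exists>k hs F. 1 \<le> k \<and> k \<le> s1 \<and> length hs = k \<and> set hs \<subseteq> snd ` P \<and> F \<subseteq> P
     \<and> (\<forall>q\<in>F. v \<le> fst q \<and> fst q \<le> v + 2 * (\<Delta> + 2 * int \<rho>) * (int s1 + 1) \<and> (\<exists>h\<in>set hs. h \<le> snd q \<and> snd q \<le> h + \<Delta>))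
     \<and> (s1 + 1) * (k * r) + (s1 - k) * (r - s2) \<le> (s1 + 1) * card F)"

end

section \<open>Full columns created by the classes\<close>

context separated_classes begin

text \<open>Columns that fill one after the other in the absence of sites outside \<open>P\<close>.\<close>
definition bad_seq :: "(nat \<Rightarrow> int) \<Rightarrow> nat \<Rightarrow> bool" where
  "bad_seq b n \<longleftrightarrow> inj_on b {..<n} \<and> (\<forall>i<n. \<exists>y. r \<le> card (nbhd_v \<rho> (b i, y) \<inter> closed (b ` {..<i})))"

text \<open>A window of radius \<open>\<rho>\<close> has width
  \<open>2 * \<rho> \<le> reach\<close>, so the full columns in it form a linked set.\<close>

lemma thin_if_sparse:
  assumes "sparse reach s1 B"
  shows "thin B"
  unfolding thin_def
proof
  fix x
  have "linked reach (B \<inter> {x - int \<rho>..x + int \<rho>})"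
    unfolding linked_def using \<Delta>_nonneg by force
  then show "card (B \<inter> {x - int \<rho>..x + int \<rho>}) < s1"
    by (intro sparseD[OF assms]) auto
qed

text \<open>The occupied neighbors are split into initial sites of column \<open>x\<close> and grown
  sites \<open>R\<close>, whose rows form \<open>Y\<close>. In a grown row the site in column
  \<open>x\<close> is not initial, so the row condition can be stated without column
  \<open>x\<close>; row sites and column sites then never coincide.\<close>

lemma bad_column_class:
  assumes thin: "thin B" and x: "x \<notin> B" and bad: "r \<le> card (nbhd_v \<rho> (x, y) \<inter> closed B)"
  obtains c Y where "c \<in> \<C>" "x \<in> fst ` c" "finite Y" "r \<le> card {q\<in>c. fst q = x} + card Y"
    "\<And>y. y \<in> Y \<Longrightarrow> s1 \<le> card {q\<in>c. snd q = y \<and> fst q \<notin> B \<and> fst q \<noteq> x} + card (B \<inter> {x - reach..x + reach})"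
proof -
  let ?N = "nbhd_v \<rho> (x, y) \<inter> closed B"
  have r1: "1 \<le> r" using s2_less by simp
  obtain c where c: "c \<in> \<C>" "?N \<subseteq> grid c" "x \<in> fst ` c"
    by (rule closed_column_class[OF thin x bad r1]) (rule that)
  have N: "fst w = x" "w \<in> grid c" "w \<in> closed B" if "w \<in> ?N" for w
    using that c(2) by (auto simp: nbhd_v_eq)
  define R where "R = ?N - c"
  have finR: "finite R" by (simp add: R_def)
  have "?N \<subseteq> {q\<in>c. fst q = x} \<union> R" using N(1) unfolding R_def by blast
  then have "card ?N \<le> card ({q\<in>c. fst q = x} \<union> R)"
    using finite_class[OF c(1)] finR by (intro card_mono) auto
  also have "\<dots> \<le> card {q\<in>c. fst q = x} + card R" by (rule card_Un_le)
  also have "card R = card (snd ` R)"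
    using N(1) unfolding R_def by (intro card_image[symmetric] inj_onI) (metis DiffD1 prod_eq_iff)
  finally have cnt: "r \<le> card {q\<in>c. fst q = x} + card (snd ` R)" using bad by linarith
  have row: "s1 \<le> card {q\<in>c. snd q = y' \<and> fst q \<notin> B \<and> fst q \<noteq> x} + card (B \<inter> {x - reach..x + reach})"
    if "y' \<in> snd ` R" for y'
  proof -
    obtain w where w: "w \<in> R" "snd w = y'" using \<open>y' \<in> snd ` R\<close> by blast
    then have wN: "w \<in> ?N" "w \<notin> c" by (auto simp: R_def)
    have same: "c' = c" if "c' \<in> \<C>" "w \<in> grid c'" for c'
      by (rule separated[OF that(1) c(1) near_if_grid[OF that(2) N(2)[OF wN(1)]]]) auto
    have "w \<notin> P" using class_exists same subset_grid wN(2) by blast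
    then obtain c' where "c' \<in> \<C>" "grown_in B c' w"
      using closed_cases[OF thin N(3)[OF wN(1)]] N(1)[OF wN(1)] x by blast
    then have g: "grown_in B c w" using same unfolding grown_in_def by blast
    have "(x, y') \<notin> c" using wN N(1)[OF wN(1)] w(2) by auto
    then have "{q\<in>c. snd q = y' \<and> fst q \<notin> B} = {q\<in>c. snd q = y' \<and> fst q \<notin> B \<and> fst q \<noteq> x}"
      by auto
    then show ?thesis using g c(3) w(2) unfolding grown_in_def by auto
  qed
  show ?thesis by (rule that[OF c(1) c(3) _ cnt row]) (use finR in auto)
qed

text \<open>Consider the first column \<open>b n\<close> that completes a linked set of
  \<open>s1\<close> columns, a maximal cluster \<open>C\<close> around it, and the \<open>s1\<close>
  indices \<open>J\<close> of \<open>C\<close> that fill earliest. Up to this moment the full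
  columns are thin, so each column of \<open>J\<close> has a class. Counting the sites class by
  class and adding up over the \<open>k\<close> classes that occur makes \<open>P\<close>
  heavy.\<close>

lemma sparse_bad_seq:
  assumes heavy: "\<not> heavy \<Delta> P" and b: "bad_seq b n"
  shows "sparse reach s1 (b ` {..<n})"
  using b
proof (induction n)
  case 0
  then show ?case using s1_pos by (simp add: sparse_def)
next
  case (Suc n)
  have inj: "inj_on b {..<Suc n}" and bad: "\<And>i. i < Suc n \<Longrightarrow> \<exists>y. r \<le> card (nbhd_v \<rho> (b i, y) \<inter> closed (b ` {..<i}))"
    using Suc.prems by (auto simp: bad_seq_def)
  have "bad_seq b n"
    using Suc.prems unfolding bad_seq_def by (auto intro: inj_on_subset)
  then have IH: "sparse reach s1 (b ` {..<n})" by (rule Suc.IH)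
  show ?case
  proof (rule ccontr)
    assume ns: "\<not> ?thesis"
    have ins: "b ` {..<Suc n} = insert (b n) (b ` {..<n})" by (simp add: lessThan_Suc)
    have fresh: "b i \<notin> b ` {..<i}" if "i < Suc n" for i
    proof
      assume "b i \<in> b ` {..<i}"
      then obtain j where "j < i" "b i = b j" by auto
      then show False using inj_onD[OF inj, of i j] that by simp
    qed
    have bn: "b n \<notin> b ` {..<n}" by (rule fresh) simp
    have reach0: "0 \<le> reach" using \<Delta>_nonneg by simp
    obtain C where C: "C \<subseteq> b ` {..<Suc n}" "s1 \<le> card C"
      "\<And>z w. z \<in> b ` {..<Suc n} \<Longrightarrow> w \<in> C \<Longrightarrow> \<bar>z - w\<bar> \<le> reach \<Longrightarrow> z \<in> C"
      "\<And>z. z \<in> C \<Longrightarrow> \<bar>z - b n\<bar> \<le> reach * int s1"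
      using maximal_linked[OF _ IH bn reach0, folded ins] ns by blast
    define J0 where "J0 = {i. i < Suc n \<and> b i \<in> C}"
    have finJ0: "finite J0" by (simp add: J0_def)
    have "C \<subseteq> b ` J0" using C(1) unfolding J0_def by blast
    then have "card C \<le> card J0" using finJ0 by (metis card_image_le card_mono finite_imageI le_trans)
    then have "s1 \<le> card J0" using C(2) by simp
    then obtain J where J: "J \<subseteq> J0" "card J = s1" "\<forall>i\<in>J. \<forall>j\<in>J0. j < i \<longrightarrow> j \<in> J"
      using initial_segment_exists[OF finJ0] by blast
    have finJ: "finite J" using J finJ0 finite_subset by blast
    have Jn: "i < Suc n" "b i \<in> C" if "i \<in> J" for i using that J(1) by (auto simp: J0_def)
    have injJ: "inj_on b J" using inj Jn(1) by (auto simp: inj_on_def)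
    define class_for where "class_for = (\<lambda>i c Y. c \<in> \<C> \<and> b i \<in> fst ` c \<and> finite Y \<and> r \<le> card {q\<in>c. fst q = b i} + card Y
      \<and> (\<forall>y\<in>Y. s1 \<le> card {q\<in>c. snd q = y \<and> fst q \<notin> b ` {..<i} \<and> fst q \<noteq> b i} + card {j\<in>J. j < i}))"
    have "\<exists>c Y. class_for i c Y"
      if i: "i \<in> J" for i
    proof -
      have "b ` {..<i} \<subseteq> b ` {..<n}" using Jn(1)[OF i] by auto
      then have thin: "thin (b ` {..<i})" using IH sparse_subset thin_if_sparse by blast
      have nin: "b i \<notin> b ` {..<i}" by (rule fresh[OF Jn(1)[OF i]])
      obtain y where y: "r \<le> card (nbhd_v \<rho> (b i, y) \<inter> closed (b ` {..<i}))" using bad Jn(1)[OF i] by blast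
      obtain c Y where cY: "c \<in> \<C>" "b i \<in> fst ` c" "finite Y" "r \<le> card {q\<in>c. fst q = b i} + card Y"
        "\<And>y. y \<in> Y \<Longrightarrow> s1 \<le> card {q\<in>c. snd q = y \<and> fst q \<notin> b ` {..<i} \<and> fst q \<noteq> b i}
            + card (b ` {..<i} \<inter> {b i - reach..b i + reach})"
        by (rule bad_column_class[OF thin nin y]) (rule that)
      \<comment> \<open>An earlier full column within \<open>reach\<close> of \<open>b i\<close>
        lies in \<open>C\<close> by maximality, and its index lies in \<open>J\<close> because
        \<open>J\<close> is an initial segment of the indices of \<open>C\<close>. So at most
        \<open>card {j\<in>J. j < i}\<close> full columns can help.\<close>
      have "b ` {..<i} \<inter> {b i - reach..b i + reach} \<subseteq> b ` {j\<in>J. j < i}"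
      proof
        fix z assume z: "z \<in> b ` {..<i} \<inter> {b i - reach..b i + reach}"
        then obtain j where j: "j < i" "z = b j" by auto
        have "z \<in> C" by (rule C(3)[OF _ Jn(2)[OF i]]) (use j z Jn(1)[OF i] in auto)
        then have "j \<in> J0" using j Jn(1)[OF i] by (auto simp: J0_def)
        then show "z \<in> b ` {j\<in>J. j < i}" using J(3) i j by blast
      qed
      then have "card (b ` {..<i} \<inter> {b i - reach..b i + reach}) \<le> card (b ` {j\<in>J. j < i})"
        using finJ by (intro card_mono) auto
      also have "\<dots> \<le> card {j\<in>J. j < i}" using finJ by (intro card_image_le) auto
      finally have "card (b ` {..<i} \<inter> {b i - reach..b i + reach}) \<le> card {j\<in>J. j < i}" .
      then have "\<forall>y\<in>Y. s1 \<le> card {q\<in>c. snd q = y \<and> fst q \<notin> b ` {..<i} \<and> fst q \<noteq> b i} + card {j\<in>J. j < i}"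
        using cY(5) by (meson add_left_mono order_trans)
      then show ?thesis using cY(1-4) unfolding class_for_def by blast
    qed
    then obtain c Y where "\<And>i. i \<in> J \<Longrightarrow> class_for i (c i) (Y i)" by metis
    then have cY: "\<And>i. i \<in> J \<Longrightarrow> c i \<in> \<C>" "\<And>i. i \<in> J \<Longrightarrow> b i \<in> fst ` c i" "\<And>i. i \<in> J \<Longrightarrow> finite (Y i)"
      "\<And>i. i \<in> J \<Longrightarrow> r \<le> card {q\<in>c i. fst q = b i} + card (Y i)"
      "\<And>i y. i \<in> J \<Longrightarrow> y \<in> Y i \<Longrightarrow>
        s1 \<le> card {q\<in>c i. snd q = y \<and> fst q \<notin> b ` {..<i} \<and> fst q \<noteq> b i} + card {j\<in>J. j < i}"
      unfolding class_for_def by auto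
    let ?K = "c ` J"
    let ?m = "\<lambda>e. card {i\<in>J. c i = e}"
    have K\<C>: "?K \<subseteq> \<C>" using cY(1) by blast
    have finK: "finite ?K" using finJ by simp
    have count: "(s1 + 1) * r + (?m e - 1) * (r - s2) \<le> (s1 + 1) * card e" if e: "e \<in> ?K" for e
    proof (rule class_count[OF _ finJ J(2) _ _ injJ s1_pos s2_less, where Y = Y and B = "\<lambda>i. b ` {..<i}"])
      show "finite e" using e K\<C> finite_class by blast
      show "{i\<in>J. c i = e} \<noteq> {}" using e by blast
    qed (use cY in auto)
    have m1: "1 \<le> ?m e" if "e \<in> ?K" for e
    proof -
      have "{i\<in>J. c i = e} \<noteq> {}" using that by blast
      then show ?thesis using finJ by (simp add: Suc_le_eq card_gt_0_iff)
    qed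
    have summ: "(\<Sum>e\<in>?K. ?m e) = s1"
      using sum.image_gen[OF finJ, of "\<lambda>_. 1::nat" c] J(2) by simp
    define k where "k = card ?K"
    have k: "1 \<le> k" "k \<le> s1"
    proof -
      have "J \<noteq> {}" using J(2) s1_pos by auto
      then show "1 \<le> k" unfolding k_def using finK by (simp add: Suc_le_eq card_gt_0_iff)
      show "k \<le> s1" unfolding k_def J(2)[symmetric] using finJ by (rule card_image_le)
    qed
    have summ1: "(\<Sum>e\<in>?K. ?m e - 1) = s1 - k"
    proof -
      have "(\<Sum>e\<in>?K. ?m e - 1) + k = (\<Sum>e\<in>?K. (?m e - 1) + 1)"
        unfolding k_def by (simp only: sum.distrib card_eq_sum)
      also have "\<dots> = (\<Sum>e\<in>?K. ?m e)" by (intro sum.cong refl le_add_diff_inverse2 m1)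
      finally show ?thesis using summ by simp
    qed
    have cardF: "card (\<Union>?K) = (\<Sum>e\<in>?K. card e)"
      using partition_onD2[OF partition] K\<C> finite_class
      by (intro card_Union_disjoint) (auto simp: pairwise_def disjoint_def disjnt_def subset_iff)
    \<comment> \<open>Each of the \<open>k\<close> classes pays \<open>r\<close> for its first
      column, and the remaining \<open>s1 - k\<close> columns are paid at the reduced rate.\<close>
    have "(s1 + 1) * (k * r) + (s1 - k) * (r - s2) = (\<Sum>e\<in>?K. (s1 + 1) * r + (?m e - 1) * (r - s2))"
      unfolding sum.distrib sum_distrib_right[symmetric] summ1 by (simp add: k_def algebra_simps)
    also have "\<dots> \<le> (\<Sum>e\<in>?K. (s1 + 1) * card e)" using count by (rule sum_mono)
    also have "\<dots> = (s1 + 1) * card (\<Union>?K)" unfolding cardF by (simp add: sum_distrib_left)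
    finally have big: "(s1 + 1) * (k * r) + (s1 - k) * (r - s2) \<le> (s1 + 1) * card (\<Union>?K)" .
    let ?F = "\<Union>?K"
    have FP: "?F \<subseteq> P" using K\<C> class_subset by blast
    have finF: "finite ?F" using FP finite_P finite_subset by blast
    have ne: "e \<noteq> {}" "finite e" if "e \<in> ?K" for e
      using that K\<C> partition_onD3[OF partition] finite_class by blast+
    have Fne: "?F \<noteq> {}"
    proof -
      have "J \<noteq> {}" using J(2) s1_pos by auto
      then show ?thesis using ne by blast
    qed
    \<comment> \<open>A class extends at most \<open>\<Delta>\<close> from its column, and the
      column is at most \<open>reach * s1\<close> from \<open>b n\<close>. Twice the resulting bound
      is the width allowed in \<open>heavy\<close>.\<close>
    have close: "\<bar>fst q - b n\<bar> \<le> reach * (int s1 + 1)" if "q \<in> ?F" for q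
    proof -
      obtain i where i: "i \<in> J" "q \<in> c i" using \<open>q \<in> ?F\<close> by blast
      obtain p where p: "p \<in> c i" "fst p = b i" using cY(2)[OF i(1)] by auto
      have "\<bar>fst q - b i\<bar> \<le> \<Delta>" using spread[OF cY(1)[OF i(1)]] i p unfolding spread_le_def by metis
      moreover have "\<bar>b i - b n\<bar> \<le> reach * int s1" using C(4) Jn i by blast
      ultimately show ?thesis by (simp add: algebra_simps)
    qed
    obtain hs where hs: "set hs = (\<lambda>e. e) ` ?K" "distinct hs" using finite_distinct_list[OF finK] by auto
    define v where "v = Min (fst ` ?F)"
    have v: "v \<in> fst ` ?F" unfolding v_def using finF Fne by (intro Min_in) auto
    have vle: "v \<le> fst q" if "q \<in> ?F" for q
      unfolding v_def using finF that by (intro Min_le) auto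
    have "heavy \<Delta> P"
      unfolding heavy_def
    proof (rule bexI[of _ v], intro exI[of _ k] exI[of _ "map (\<lambda>e. Min (snd ` e)) hs"] exI[of _ ?F] conjI ballI)
      show "v \<in> fst ` P" using v FP by blast
      show "length (map (\<lambda>e. Min (snd ` e)) hs) = k" using hs distinct_card unfolding k_def by fastforce
      have "Min (snd ` e) \<in> snd ` P" if "e \<in> ?K" for e
      proof -
        have "Min (snd ` e) \<in> snd ` e" using ne[OF that] by (intro Min_in) auto
        then show ?thesis using that FP by blast
      qed
      then show "set (map (\<lambda>e. Min (snd ` e)) hs) \<subseteq> snd ` P" using hs by auto
    next
      fix q assume q: "q \<in> ?F"
      then show "v \<le> fst q" by (rule vle)
      obtain p where "p \<in> ?F" "fst p = v" using v by auto
      then show "fst q \<le> v + 2 * reach * (int s1 + 1)" using close[of p] close[OF q] by (auto simp: algebra_simps)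
      obtain e where e: "e \<in> ?K" "q \<in> e" using q by blast
      have "Min (snd ` e) \<in> snd ` e" using ne[OF e(1)] by (intro Min_in) auto
      then obtain p where p: "p \<in> e" "snd p = Min (snd ` e)" by auto
      have "\<bar>snd q - snd p\<bar> \<le> \<Delta>" using spread e p K\<C> unfolding spread_le_def by blast
      moreover have "Min (snd ` e) \<le> snd q" using ne[OF e(1)] e by (intro Min_le) auto
      ultimately show "\<exists>h\<in>set (map (\<lambda>e. Min (snd ` e)) hs). h \<le> snd q \<and> snd q \<le> h + \<Delta>"
        using e hs p by (intro bexI[of _ "Min (snd ` e)"]) auto
    qed (use k FP big in auto)
    then show False using heavy by blast
  qed
qed

end

section \<open>Stable sets and escape chains\<close>

definition square :: "int \<Rightarrow> int \<times> int \<Rightarrow> (int \<times> int) set" where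
  "square K z = {fst z - K..fst z + K} \<times> {snd z - K..snd z + K}"

lemma finite_square [simp]: "finite (square K z)"
  by (simp add: square_def)

context separated_classes begin

text \<open>When column \<open>b i\<close> fills, the earlier full columns are thin, so its
  \<open>r\<close> occupied neighbors occupy \<open>r\<close> rows of a single class. The class both
  bounds the number of bad columns and limits the chance that column 0 is one.\<close>

lemma bad_seq_class:
  assumes heavy: "\<not> heavy \<Delta> P" and b: "bad_seq b n" and i: "i < n"
  obtains c where "c \<in> \<C>" "b i \<in> fst ` c" "r \<le> card c"
proof -
  have inj: "inj_on b {..<n}" using b by (simp add: bad_seq_def)
  obtain y where y: "r \<le> card (nbhd_v \<rho> (b i, y) \<inter> closed (b ` {..<i}))"
    using b i by (auto simp: bad_seq_def)
  have sub: "b ` {..<i} \<subseteq> b ` {..<n}" using i by auto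
  have thin: "thin (b ` {..<i})"
    by (rule thin_if_sparse[OF sparse_subset[OF sparse_bad_seq[OF heavy b] sub]])
  have nin: "b i \<notin> b ` {..<i}"
  proof
    assume "b i \<in> b ` {..<i}"
    then obtain j where "j < i" "b i = b j" by auto
    then show False using inj_onD[OF inj, of i j] i by simp
  qed
  have r1: "1 \<le> r" using s2_less by simp
  obtain c where c: "c \<in> \<C>" "b i \<in> fst ` c" "r \<le> card (snd ` c)"
    by (rule closed_column_class[OF thin nin y r1]) (rule that)
  have "r \<le> card c" using c(3) card_image_le[OF finite_class[OF c(1)], of snd] by simp
  then show ?thesis using that c by blast
qed

text \<open>Every bad column is the abscissa of a point of the finite set \<open>P\<close>, so there
  is a longest bad sequence. Any further column with \<open>r\<close> closed vertical neighbors
  could be appended to it.\<close>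

lemma saturated_bad_seq:
  assumes heavy: "\<not> heavy \<Delta> P"
  obtains b n where "bad_seq b n" "\<And>x y. x \<notin> b ` {..<n} \<Longrightarrow> card (nbhd_v \<rho> (x, y) \<inter> closed (b ` {..<n})) < r"
proof -
  have bound: "n \<le> card (fst ` P)" if "bad_seq b n" for b n
  proof -
    have "b ` {..<n} \<subseteq> fst ` P"
    proof
      fix z assume "z \<in> b ` {..<n}"
      then obtain i where i: "i < n" "z = b i" by auto
      obtain c where "c \<in> \<C>" "b i \<in> fst ` c" by (rule bad_seq_class[OF heavy \<open>bad_seq b n\<close> i(1)]) (rule that)
      then show "z \<in> fst ` P" using class_subset i by blast
    qed
    then have "card (b ` {..<n}) \<le> card (fst ` P)" using finite_P by (intro card_mono) auto
    then show ?thesis using that by (simp add: bad_seq_def card_image)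
  qed
  define good where "good = (\<lambda>n. \<exists>b. bad_seq b n)"
  have g0: "good 0" by (auto simp: good_def bad_seq_def)
  have "n < Suc (card (fst ` P))" if "good n" for n
    using that bound unfolding good_def by (auto simp: less_Suc_eq_le)
  then obtain n where n: "good n" "\<And>m. good m \<Longrightarrow> m \<le> n"
    using ex_has_greatest_nat[of good 0 "\<lambda>n. n" "Suc (card (fst ` P))"] g0 by blast
  then obtain b where b: "bad_seq b n" by (auto simp: good_def)
  have "card (nbhd_v \<rho> (x, y) \<inter> closed (b ` {..<n})) < r" if x: "x \<notin> b ` {..<n}" for x y
  proof (rule ccontr)
    assume "\<not> ?thesis"
    then have y: "r \<le> card (nbhd_v \<rho> (x, y) \<inter> closed (b ` {..<n}))" by simp
    let ?b = "b(n := x)"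
    have im: "?b ` {..<i} = b ` {..<i}" if "i \<le> n" for i
      using that by (intro image_cong refl) auto
    have "inj_on b {..<n}" using b by (simp add: bad_seq_def)
    then have "inj_on ?b {..<Suc n}"
      using x unfolding lessThan_Suc by (auto simp: inj_on_insert inj_on_fun_updI im[OF order.refl] image_def split: if_splits)
    moreover have "\<exists>y. r \<le> card (nbhd_v \<rho> (?b i, y) \<inter> closed (?b ` {..<i}))" if "i < Suc n" for i
    proof (cases "i = n")
      case True
      then show ?thesis using y im[of n] by auto
    next
      case False
      then have "i < n" using that by simp
      then show ?thesis using b im[of i] by (auto simp: bad_seq_def)
    qed
    ultimately have "good (Suc n)" unfolding good_def bad_seq_def by blast
    from n(2)[OF this] show False by simp
  qed
  then show ?thesis using that b by blast
qed

text \<open>With saturated full columns, the closure is stable under both rules: under the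
  \<open>r\<close>-rule by saturation, under the corner rule by construction. Outside it,
  \<open>s2\<close> vertical neighbors come from \<open>s2\<close> rows of one class, whose sites
  are nearby. The origin belongs to it either through a full column 0, whose class has
  \<open>r\<close> sites, or through the grid of a class, which then has a site near the
  origin.\<close>

lemma stable_closure:
  assumes heavy: "\<not> heavy \<Delta> P"
  obtains S where "P \<subseteq> S"
    "\<And>z. z \<notin> S \<Longrightarrow> card (nbhd_v \<rho> z \<inter> S) < r"
    "\<And>z. z \<notin> S \<Longrightarrow> s2 \<le> card (nbhd_v \<rho> z \<inter> S) \<Longrightarrow> card (nbhd_h \<rho> z \<inter> S) < s1"
    "\<And>z. z \<notin> S \<Longrightarrow> s2 \<le> card (nbhd_v \<rho> z \<inter> S) \<Longrightarrow> s2 \<le> card (P \<inter> square (\<Delta> + int \<rho>) z)"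
    "(0, 0) \<in> S \<Longrightarrow> P \<inter> square (\<Delta> + int \<rho>) (0, 0) \<noteq> {} \<or> (\<exists>y\<in>snd ` P. r \<le> card (P \<inter> square (\<Delta> + int \<rho>) (0, y)))"
proof -
  obtain b n where b: "bad_seq b n" and
    sat: "\<And>x y. x \<notin> b ` {..<n} \<Longrightarrow> card (nbhd_v \<rho> (x, y) \<inter> closed (b ` {..<n})) < r"
    by (rule saturated_bad_seq[OF heavy]) (rule that)
  define B where "B = b ` {..<n}"
  define S where "S = closed B"
  have thin: "thin B" unfolding B_def by (rule thin_if_sparse[OF sparse_bad_seq[OF heavy b]])
  have notB: "fst z \<notin> B" if "z \<notin> S" for z
    using that closure_with.column unfolding S_def by blast
  have sub: "P \<subseteq> S" unfolding S_def using closure_with.initial by blast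
  have st1: "card (nbhd_v \<rho> z \<inter> S) < r" if "z \<notin> S" for z
    using sat[of "fst z" "snd z"] notB[OF that] unfolding S_def B_def by simp
  have st2: "card (nbhd_h \<rho> z \<inter> S) < s1" if z: "z \<notin> S" and v: "s2 \<le> card (nbhd_v \<rho> z \<inter> S)" for z
  proof (rule ccontr)
    assume "\<not> ?thesis"
    then have h: "s1 \<le> card (nbhd_h \<rho> z \<inter> S)" by simp
    obtain U where U: "U \<subseteq> nbhd_h \<rho> z \<inter> S" "card U = s1" using obtain_subset_with_card_n[OF h] by blast
    obtain V where V: "V \<subseteq> nbhd_v \<rho> z \<inter> S" "card V = s2" using obtain_subset_with_card_n[OF v] by blast
    have "z \<in> S" unfolding S_def
      by (rule closure_with.corner[of U _ V]) (use U V in \<open>auto simp: S_def\<close>)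
    then show False using z by blast
  qed
  have st3: "s2 \<le> card (P \<inter> square (\<Delta> + int \<rho>) z)" if z: "z \<notin> S" and v: "s2 \<le> card (nbhd_v \<rho> z \<inter> S)" for z
  proof -
    have v': "s2 \<le> card (nbhd_v \<rho> (fst z, snd z) \<inter> closed B)" using v by (simp add: S_def)
    obtain c where c: "c \<in> \<C>" "s2 \<le> card (snd ` c)"
      "\<And>w. w \<in> c \<Longrightarrow> \<bar>fst w - fst z\<bar> \<le> \<Delta> \<and> \<bar>snd w - snd z\<bar> \<le> \<Delta> + int \<rho>"
      by (rule closed_column_class[OF thin notB[OF z] v' s2_pos]) (rule that)
    have "c \<subseteq> P \<inter> square (\<Delta> + int \<rho>) z"
    proof
      fix w assume w: "w \<in> c"
      then show "w \<in> P \<inter> square (\<Delta> + int \<rho>) z"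
        using c(3)[OF w] class_subset[OF c(1)] by (auto simp: square_def mem_Times_iff abs_le_iff)
    qed
    then have "card c \<le> card (P \<inter> square (\<Delta> + int \<rho>) z)" by (intro card_mono) auto
    then show ?thesis using c(2) card_image_le[OF finite_class[OF c(1)], of snd] by linarith
  qed
  have org: "P \<inter> square (\<Delta> + int \<rho>) (0, 0) \<noteq> {} \<or> (\<exists>y\<in>snd ` P. r \<le> card (P \<inter> square (\<Delta> + int \<rho>) (0, y)))"
    if S0: "(0, 0) \<in> S"
  proof (cases "0 \<in> B")
    case True
    then obtain i where i: "i < n" "b i = 0" unfolding B_def by auto
    obtain c where c: "c \<in> \<C>" "b i \<in> fst ` c" "r \<le> card c"
      by (rule bad_seq_class[OF heavy b i(1)]) (rule that)
    obtain p where p: "p \<in> c" "fst p = 0" using c(2) i by auto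
    have "c \<subseteq> P \<inter> square (\<Delta> + int \<rho>) (0, snd p)"
    proof
      fix w assume w: "w \<in> c"
      have "\<bar>fst w - fst p\<bar> \<le> \<Delta> \<and> \<bar>snd w - snd p\<bar> \<le> \<Delta>" using spread[OF c(1)] w p unfolding spread_le_def by blast
      then show "w \<in> P \<inter> square (\<Delta> + int \<rho>) (0, snd p)"
        using w class_subset[OF c(1)] p by (auto simp: square_def mem_Times_iff abs_le_iff)
    qed
    then have "card c \<le> card (P \<inter> square (\<Delta> + int \<rho>) (0, snd p))" by (intro card_mono) auto
    then show ?thesis using c p class_subset by (intro disjI2 bexI[of _ "snd p"]) auto
  next
    case False
    then obtain c where c: "c \<in> \<C>" "(0, 0) \<in> grid c"
      using closed_grid[OF thin, of "(0, 0)"] S0 by (auto simp: S_def)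
    then obtain p q where pq: "p \<in> c" "fst p = 0" "q \<in> c" "snd q = 0" by (auto simp: grid_def)
    have "\<bar>fst p - fst q\<bar> \<le> \<Delta> \<and> \<bar>snd p - snd q\<bar> \<le> \<Delta>" using spread[OF c(1)] pq unfolding spread_le_def by blast
    then have "p \<in> P \<inter> square (\<Delta> + int \<rho>) (0, 0)"
      using pq class_subset[OF c(1)] by (auto simp: square_def mem_Times_iff abs_le_iff)
    then show ?thesis by blast
  qed
  show ?thesis by (rule that[OF sub st1 st2 st3 org])
qed

end

text \<open>Unions of \<open>n\<close> sets of \<open>s\<close> sites, the \<open>i\<close>-th one near a point whose abscissa has modulus about
  \<open>(k + i) * w\<close>, where the total vertical distance of successive points is at most \<open>t\<close>.\<close>
primrec chain_sets :: "nat \<Rightarrow> nat \<Rightarrow> int \<Rightarrow> int \<Rightarrow> nat \<Rightarrow> int \<Rightarrow> int \<Rightarrow> int \<Rightarrow> (int \<times> int) set set" where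
  "chain_sets \<rho> s K w 0 k y t = {{}}"
| "chain_sets \<rho> s K w (Suc n) k y t =
    (\<Union>x\<in>{x. k * w \<le> \<bar>x\<bar> \<and> \<bar>x\<bar> \<le> k * w + int \<rho>}. \<Union>y'\<in>{y - t..y + t}.
      \<Union>A\<in>{A. A \<subseteq> square K (x, y') \<and> card A = s}.
        (\<lambda>F. A \<union> F) ` chain_sets \<rho> s K w n (k + 1) y' (t - \<bar>y - y'\<bar>))"

lemma chain_sets_mono: "t \<le> t' \<Longrightarrow> chain_sets \<rho> s K w n k y t \<subseteq> chain_sets \<rho> s K w n k y t'"
proof (induction n arbitrary: k y t t')
  case (Suc n)
  have "chain_sets \<rho> s K w n (k + 1) y' (t - \<bar>y - y'\<bar>) \<subseteq> chain_sets \<rho> s K w n (k + 1) y' (t' - \<bar>y - y'\<bar>)" for y'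
    using Suc by simp
  moreover have "{y - t..y + t} \<subseteq> {y - t'..y + t'}" using Suc.prems by auto
  ultimately show ?case unfolding chain_sets.simps
    by (intro UN_mono image_mono order.refl)
qed simp

section \<open>Tracing an occupied origin back in time\<close>

context cross_growth begin

lemma stable_set_exists:
  assumes P: "finite P" and M: "2 \<le> M"
    and dense: "\<And>A. A \<subseteq> P \<Longrightarrow> M \<le> card A \<Longrightarrow> spread_le (2 * int M * (2 * int \<rho>)) A \<Longrightarrow> False"
    and \<Delta>: "\<Delta> = int M * (2 * int \<rho>)"
    and heavy: "\<not> heavy \<Delta> P"
  obtains S where "P \<subseteq> S"
    "\<And>z. z \<notin> S \<Longrightarrow> card (nbhd_v \<rho> z \<inter> S) < r"
    "\<And>z. z \<notin> S \<Longrightarrow> s2 \<le> card (nbhd_v \<rho> z \<inter> S) \<Longrightarrow> card (nbhd_h \<rho> z \<inter> S) < s1"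
    "\<And>z. z \<notin> S \<Longrightarrow> s2 \<le> card (nbhd_v \<rho> z \<inter> S) \<Longrightarrow> s2 \<le> card (P \<inter> square (\<Delta> + int \<rho>) z)"
    "(0, 0) \<in> S \<Longrightarrow> P \<inter> square (\<Delta> + int \<rho>) (0, 0) \<noteq> {} \<or> (\<exists>y\<in>snd ` P. r \<le> card (P \<inter> square (\<Delta> + int \<rho>) (0, y)))"
proof -
  have \<rho>0: "0 \<le> 2 * int \<rho>" by simp
  obtain \<C> where \<C>: "partition_on P \<C>" "\<And>c. c \<in> \<C> \<Longrightarrow> spread_le (int M * (2 * int \<rho>)) c"
    "\<And>c c'. c \<in> \<C> \<Longrightarrow> c' \<in> \<C> \<Longrightarrow> near (2 * int \<rho>) c c' \<Longrightarrow> c = c'"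
    by (rule separated_partition_exists[OF P M \<rho>0 dense]) (assumption | rule that)+
  interpret separated_classes r s1 s2 \<rho> P \<C> \<Delta>
    by unfold_locales (use \<C> P \<Delta> in auto)
  show ?thesis by (rule stable_closure[OF heavy]) (rule that)
qed

text \<open>Traces a site outside the stable set back in time, preferring vertical neighbors.  A horizontal
  step is taken only at sites where \<open>S\<close> itself provides \<open>s2\<close> vertical neighbors.\<close>
lemma escape:
  assumes P: "P = \<xi> \<inter> {- L..L} \<times> {- (int \<rho> * int t)..int \<rho> * int t}" and PS: "P \<subseteq> S"
    and st1: "\<And>z. z \<notin> S \<Longrightarrow> card (nbhd_v \<rho> z \<inter> S) < r"
    and st2: "\<And>z. z \<notin> S \<Longrightarrow> s2 \<le> card (nbhd_v \<rho> z \<inter> S) \<Longrightarrow> card (nbhd_h \<rho> z \<inter> S) < s1"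
    and nuc: "\<And>z. z \<notin> S \<Longrightarrow> s2 \<le> card (nbhd_v \<rho> z \<inter> S) \<Longrightarrow> s2 \<le> card (P \<inter> square K z)"
    and m: "m + int \<rho> \<le> L"
  shows "(x, y) \<in> grown \<xi> s \<Longrightarrow> (x, y) \<notin> S \<Longrightarrow> \<bar>x\<bar> \<le> m + int \<rho> \<Longrightarrow> s \<le> t \<Longrightarrow> \<bar>y\<bar> \<le> int \<rho> * int (t - s) \<Longrightarrow>
    \<exists>x' y' s'. m \<le> \<bar>x'\<bar> \<and> \<bar>x'\<bar> \<le> m + int \<rho> \<and> s2 \<le> card (P \<inter> square K (x', y')) \<and> (x', y') \<in> grown \<xi> s' \<and> (x', y') \<notin> S
      \<and> s' \<le> s \<and> \<bar>y'\<bar> \<le> int \<rho> * int (t - s') \<and> \<bar>y - y'\<bar> \<le> int \<rho> * int (s - s')"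
proof (induction s arbitrary: x y)
  case 0
  \<comment> \<open>A trace that reached time 0 outside \<open>S\<close> would end at an initial
    site of the box, hence in \<open>P \<subseteq> S\<close>.\<close>
  then have "(x, y) \<in> P" using m unfolding P by auto
  then show ?case using 0 PS by blast
next
  case (Suc s)
  have ts: "int (t - s) = int (t - Suc s) + 1" using Suc.prems by simp
  have step: ?case if "(x', y') \<in> grown \<xi> s" "(x', y') \<notin> S" "\<bar>x'\<bar> \<le> m + int \<rho>" "\<bar>y - y'\<bar> \<le> int \<rho>" for x' y'
  proof -
    \<comment> \<open>The bound \<open>\<rho> * (t - s)\<close> is a light cone: it widens by
      \<open>\<rho>\<close> with every step back and stays within the height of the box.\<close>
    have y': "\<bar>y'\<bar> \<le> int \<rho> * int (t - s)" using that(4) Suc.prems(5) unfolding ts by (simp add: distrib_left)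
    note near = that
    from y' obtain x'' y'' s' where *: "m \<le> \<bar>x''\<bar>" "\<bar>x''\<bar> \<le> m + int \<rho>" "s2 \<le> card (P \<inter> square K (x'', y''))"
        "(x'', y'') \<in> grown \<xi> s'" "(x'', y'') \<notin> S" "s' \<le> s" "\<bar>y''\<bar> \<le> int \<rho> * int (t - s')" "\<bar>y' - y''\<bar> \<le> int \<rho> * int (s - s')"
      using Suc.IH[OF near(1-3)] Suc.prems by auto
    have "int (Suc s - s') = int (s - s') + 1" using *(6) by simp
    then have "\<bar>y - y''\<bar> \<le> int \<rho> * int (Suc s - s')" using that(4) *(8) by (simp add: distrib_left)
    then show ?thesis using * by (intro exI[of _ x''] exI[of _ y''] exI[of _ s']) auto
  qed
  show ?case
  proof (cases "(x, y) \<in> grown \<xi> s")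
    case True
    then show ?thesis using step[of x y] Suc.prems by simp
  next
    case new: False
    show ?thesis
    proof (cases "nbhd_v \<rho> (x, y) \<inter> grown \<xi> s \<subseteq> S")
      case False
      then obtain w where "w \<in> nbhd_v \<rho> (x, y)" "w \<in> grown \<xi> s" "w \<notin> S" by blast
      then have "fst w = x" "\<bar>y - snd w\<bar> \<le> int \<rho>" "(fst w, snd w) \<in> grown \<xi> s" "(fst w, snd w) \<notin> S"
        by (auto simp: nbhd_v_eq)
      then show ?thesis using step[of "fst w" "snd w"] Suc.prems by simp
    next
      case True
      have vle: "card (nbhd_v \<rho> (x, y) \<inter> grown \<xi> s) \<le> card (nbhd_v \<rho> (x, y) \<inter> S)"
        using True by (intro card_mono) auto
      then have h: "s1 \<le> card (nbhd_h \<rho> (x, y) \<inter> grown \<xi> s)" and v: "s2 \<le> card (nbhd_v \<rho> (x, y) \<inter> S)"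
        using Suc.prems(1) new st1[OF Suc.prems(2)] unfolding grown_Suc_iff by auto
      have nucxy: "s2 \<le> card (P \<inter> square K (x, y))" by (rule nuc[OF Suc.prems(2) v])
      show ?thesis
      \<comment> \<open>At a site with \<open>\<bar>x\<bar> \<ge> m\<close> that relies on
        horizontal neighbors the trace ends, as this is the required site. Horizontal steps thus
        start from \<open>\<bar>x\<bar> < m\<close> and cannot pass
        \<open>m + \<rho>\<close>.\<close>
      proof (cases "m \<le> \<bar>x\<bar>")
        case True
        then show ?thesis using nucxy Suc.prems by (intro exI[of _ x] exI[of _ y] exI[of _ "Suc s"]) auto
      next
        case False
        have "\<not> nbhd_h \<rho> (x, y) \<inter> grown \<xi> s \<subseteq> S"
        proof
          assume "nbhd_h \<rho> (x, y) \<inter> grown \<xi> s \<subseteq> S"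
          then have "card (nbhd_h \<rho> (x, y) \<inter> grown \<xi> s) \<le> card (nbhd_h \<rho> (x, y) \<inter> S)"
            by (intro card_mono) auto
          then show False using st2[OF Suc.prems(2) v] h by simp
        qed
        then obtain w where "w \<in> nbhd_h \<rho> (x, y)" "w \<in> grown \<xi> s" "w \<notin> S" by blast
        then have "snd w = y" "\<bar>fst w - x\<bar> \<le> int \<rho>" "(fst w, snd w) \<in> grown \<xi> s" "(fst w, snd w) \<notin> S"
          by (auto simp: nbhd_h_eq)
        then show ?thesis using step[of "fst w" "snd w"] False by simp
      qed
    qed
  qed
qed

text \<open>Iterates the escape with \<open>m = k * w\<close>, \<open>(k + 1) * w\<close> and so on,
  each time from the last chain site. Two successive sites are vertically at most
  \<open>\<rho>\<close> times the elapsed time apart, so the time bound becomes a budget for the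
  total length of the chain.\<close>

lemma chain_of_escapes:
  assumes P: "P = \<xi> \<inter> {- L..L} \<times> {- (int \<rho> * int t)..int \<rho> * int t}" and PS: "P \<subseteq> S"
    and st1: "\<And>z. z \<notin> S \<Longrightarrow> card (nbhd_v \<rho> z \<inter> S) < r"
    and st2: "\<And>z. z \<notin> S \<Longrightarrow> s2 \<le> card (nbhd_v \<rho> z \<inter> S) \<Longrightarrow> card (nbhd_h \<rho> z \<inter> S) < s1"
    and nuc: "\<And>z. z \<notin> S \<Longrightarrow> s2 \<le> card (nbhd_v \<rho> z \<inter> S) \<Longrightarrow> s2 \<le> card (P \<inter> square K z)"
    and w: "0 \<le> w"
  shows "(x, y) \<in> grown \<xi> s \<Longrightarrow> (x, y) \<notin> S \<Longrightarrow> \<bar>x\<bar> \<le> k * w + int \<rho> \<Longrightarrow> (k + int n) * w + int \<rho> \<le> L \<Longrightarrow>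
    s \<le> t \<Longrightarrow> \<bar>y\<bar> \<le> int \<rho> * int (t - s) \<Longrightarrow> \<exists>F\<in>chain_sets \<rho> s2 K w n k y (int \<rho> * int s). F \<subseteq> P"
proof (induction n arbitrary: x y s k)
  case 0
  then show ?case by simp
next
  case (Suc n)
  have "k * w \<le> (k + int (Suc n)) * w" using w by (intro mult_right_mono) auto
  then have kL: "k * w + int \<rho> \<le> L" using Suc.prems(4) by linarith
  obtain x' y' s' where *: "k * w \<le> \<bar>x'\<bar>" "\<bar>x'\<bar> \<le> k * w + int \<rho>" "s2 \<le> card (P \<inter> square K (x', y'))"
      "(x', y') \<in> grown \<xi> s'" "(x', y') \<notin> S" "s' \<le> s" "\<bar>y'\<bar> \<le> int \<rho> * int (t - s')" "\<bar>y - y'\<bar> \<le> int \<rho> * int (s - s')"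
    using escape[OF P PS st1 st2 nuc kL Suc.prems(1,2,3,5,6)] by blast
  have "k * w \<le> (k + 1) * w" using w by (intro mult_right_mono) auto
  then have "\<exists>F\<in>chain_sets \<rho> s2 K w n (k + 1) y' (int \<rho> * int s'). F \<subseteq> P"
    using * Suc.prems by (intro Suc.IH[of x' y' s' "k + 1"]) (auto simp: algebra_simps)
  then obtain F where F: "F \<in> chain_sets \<rho> s2 K w n (k + 1) y' (int \<rho> * int s')" "F \<subseteq> P" by blast
  have "int \<rho> * int s' + int \<rho> * int (s - s') = int \<rho> * int s"
    unfolding distrib_left[symmetric] using *(6) by simp
  then have t: "int \<rho> * int s' \<le> int \<rho> * int s - \<bar>y - y'\<bar>" using *(8) by linarith
  have F': "F \<in> chain_sets \<rho> s2 K w n (k + 1) y' (int \<rho> * int s - \<bar>y - y'\<bar>)"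
    using chain_sets_mono[OF t] F by blast
  obtain A where A: "A \<subseteq> P \<inter> square K (x', y')" "card A = s2" using obtain_subset_with_card_n[OF *(3)] by blast
  have "0 \<le> int \<rho> * int s'" by simp
  then have "\<bar>y - y'\<bar> \<le> int \<rho> * int s" using t by linarith
  then have "y' \<in> {y - int \<rho> * int s..y + int \<rho> * int s}" by auto
  then have "A \<union> F \<in> chain_sets \<rho> s2 K w (Suc n) k y (int \<rho> * int s)"
    unfolding chain_sets.simps using *(1,2) A F' by blast
  then show ?case using A F by blast
qed

text \<open>If the first two alternatives fail, there is a stable set. The next two are the ways in
  which it can contain the origin, and if it does not contain the origin, the escapes yield a
  chain.\<close>

lemma origin_grown_cases:
  assumes M: "2 \<le> M" and P: "P = \<xi> \<inter> {- L..L} \<times> {- (int \<rho> * int t)..int \<rho> * int t}"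
    and \<Delta>: "\<Delta> = int M * (2 * int \<rho>)" and K: "K = \<Delta> + int \<rho>" and w: "0 \<le> w" and L: "int n * w + int \<rho> \<le> L"
    and origin: "(0, 0) \<in> grown \<xi> t"
  shows "(\<exists>A\<subseteq>P. M \<le> card A \<and> spread_le (2 * \<Delta>) A) \<or> heavy \<Delta> P \<or> P \<inter> square K (0, 0) \<noteq> {}
    \<or> (\<exists>y\<in>snd ` P. r \<le> card (P \<inter> square K (0, y)))
    \<or> (\<exists>F\<in>chain_sets \<rho> s2 K w n 0 0 (int \<rho> * int t). F \<subseteq> P)"
proof (rule ccontr)
  assume *: "\<not> ?thesis"
  have finP: "finite P" unfolding P by simp
  have dense: False if "A \<subseteq> P" "M \<le> card A" "spread_le (2 * int M * (2 * int \<rho>)) A" for A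
    using * that unfolding \<Delta> by (auto simp: mult.assoc)
  have heavy: "\<not> heavy \<Delta> P" using * by blast
  obtain S where S: "P \<subseteq> S"
    "\<And>z. z \<notin> S \<Longrightarrow> card (nbhd_v \<rho> z \<inter> S) < r"
    "\<And>z. z \<notin> S \<Longrightarrow> s2 \<le> card (nbhd_v \<rho> z \<inter> S) \<Longrightarrow> card (nbhd_h \<rho> z \<inter> S) < s1"
    "\<And>z. z \<notin> S \<Longrightarrow> s2 \<le> card (nbhd_v \<rho> z \<inter> S) \<Longrightarrow> s2 \<le> card (P \<inter> square K z)"
    "(0, 0) \<in> S \<Longrightarrow> P \<inter> square K (0, 0) \<noteq> {} \<or> (\<exists>y\<in>snd ` P. r \<le> card (P \<inter> square K (0, y)))"
    by (rule stable_set_exists[OF finP M dense \<Delta> heavy, folded K]) (assumption | rule that)+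
  have nS: "(0, 0) \<notin> S" using S(5) * by blast
  have "\<exists>F\<in>chain_sets \<rho> s2 K w n 0 0 (int \<rho> * int t). F \<subseteq> P"
    by (rule chain_of_escapes[OF P S(1-4) w origin nS]) (use L in auto)
  then show False using * by blast
qed

end

section \<open>Counting configurations\<close>

text \<open>Since \<open>k * w + \<rho> + K < (k + 1) * w - K\<close>, the squares of different
  links have disjoint ranges of \<open>\<bar>fst q\<bar>\<close>. Hence no site is counted twice,
  and a chain of \<open>n\<close> links costs exactly \<open>p ^ (n * s)\<close>.\<close>

lemma chain_sets_facts:
  assumes K: "0 \<le> K" and w: "2 * K + int \<rho> < w"
  shows "finite (chain_sets \<rho> s K w n k y t)"
    and "F \<in> chain_sets \<rho> s K w n k y t \<Longrightarrow> finite F \<and> card F = n * s \<and> (\<forall>q\<in>F. k * w - K \<le> \<bar>fst q\<bar>)"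
proof (induction n arbitrary: k y t F)
  case (Suc n)
  have X: "finite {x. k * w \<le> \<bar>x\<bar> \<and> \<bar>x\<bar> \<le> k * w + int \<rho>}" for k
    by (rule finite_subset[of _ "{- (k * w + int \<rho>)..k * w + int \<rho>}"]) auto
  {
    case 1
    have "finite {A. A \<subseteq> square K (x, y') \<and> card A = s}" for x y'
      by (rule finite_subset[of _ "Pow (square K (x, y'))"]) auto
    then show ?case unfolding chain_sets.simps using X Suc.IH(1) by (intro finite_UN_I finite_imageI) auto
  next
    case 2
    then obtain x y' A F' where x: "k * w \<le> \<bar>x\<bar>" "\<bar>x\<bar> \<le> k * w + int \<rho>"
      and A: "A \<subseteq> square K (x, y')" "card A = s"
      and F': "F' \<in> chain_sets \<rho> s K w n (k + 1) y' (t - \<bar>y - y'\<bar>)" and F: "F = A \<union> F'"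
      by auto
    have IH: "finite F'" "card F' = n * s" "\<And>q. q \<in> F' \<Longrightarrow> (k + 1) * w - K \<le> \<bar>fst q\<bar>"
      using Suc.IH(2)[OF F'] by auto
    have finA: "finite A" using A(1) finite_square finite_subset by blast
    have Aq: "\<bar>fst q - x\<bar> \<le> K" if "q \<in> A" for q
      using subsetD[OF A(1) that] by (auto simp: square_def mem_Times_iff abs_le_iff)
    have step: "k * w + int \<rho> + K < (k + 1) * w - K" using w by (simp add: algebra_simps)
    have "A \<inter> F' = {}"
    proof (rule equals0I)
      fix q assume "q \<in> A \<inter> F'"
      then have "\<bar>fst q - x\<bar> \<le> K" "(k + 1) * w - K \<le> \<bar>fst q\<bar>" using Aq IH(3) by auto
      then show False using x step by linarith
    qed
    then have "card F = Suc n * s" unfolding F using finA IH A by (subst card_Un_disjoint) auto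
    moreover have "k * w - K \<le> \<bar>fst q\<bar>" if "q \<in> F" for q
    proof (cases "q \<in> A")
      case True
      then show ?thesis using Aq[OF True] x by linarith
    next
      case False
      then have "(k + 1) * w - K \<le> \<bar>fst q\<bar>" using that IH(3) by (auto simp: F)
      then show ?thesis using step K by linarith
    qed
    ultimately show ?case using finA IH(1) by (auto simp: F)
  }
qed auto

lemma card_subsets_le: "finite X \<Longrightarrow> card {A. A \<subseteq> X \<and> card A = s} \<le> 2 ^ card X"
  using card_mono[of "Pow X" "{A. A \<subseteq> X \<and> card A = s}"] by (auto simp: card_Pow)

lemma card_square: "0 \<le> K \<Longrightarrow> card (square K z) = nat (2 * K + 1) ^ 2"
  by (simp add: square_def card_cartesian_product power2_eq_square)

lemma card_UN_le_mult:
  assumes "finite I" "\<And>i. i \<in> I \<Longrightarrow> card (A i) \<le> N"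
  shows "card (\<Union>i\<in>I. A i) \<le> card I * N"
  using card_UN_le[OF assms(1), of A] sum_mono[of I "\<lambda>i. card (A i)" "\<lambda>_. N"] assms(2) by simp

text \<open>Two geometric series with ratio \<open>exp (- \<theta>)\<close>, one on each side of
  \<open>y\<close>, together with \<open>1 - exp (- \<theta>) \<ge> \<theta> / 2\<close> for
  \<open>\<theta> \<le> 1\<close>.\<close>

lemma sum_exp_abs_le:
  fixes \<theta> :: real
  assumes "0 < \<theta>" "\<theta> \<le> 1" "0 \<le> t"
  shows "(\<Sum>z\<in>{y - t..y + t::int}. exp (- (\<theta> * real_of_int \<bar>y - z\<bar>))) \<le> 4 / \<theta>"
proof -
  define q where "q = exp (- \<theta>)"
  have q: "0 < q" "q < 1" using assms by (auto simp: q_def)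
  have e: "exp (- (\<theta> * real_of_int \<bar>y - z\<bar>)) = q ^ nat \<bar>y - z\<bar>" for z
    unfolding q_def by (simp add: exp_of_nat_mult[symmetric] mult.commute)
  have geo: "(\<Sum>i\<le>nat t. q ^ i) \<le> 1 / (1 - q)"
  proof -
    have "(1 - q) * (\<Sum>i<Suc (nat t). q ^ i) = 1 - q ^ Suc (nat t)"
      by (rule one_diff_power_eq[symmetric])
    also have "\<dots> \<le> 1" using q by simp
    finally show ?thesis using q by (simp add: pos_le_divide_eq mult.commute lessThan_Suc_atMost)
  qed
  have "(\<Sum>z\<in>{y - t..y + t}. q ^ nat \<bar>y - z\<bar>) \<le> (\<Sum>z\<in>(\<lambda>i. y + int i) ` {..nat t} \<union> (\<lambda>i. y - int i) ` {..nat t}. q ^ nat \<bar>y - z\<bar>)"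
  proof (rule sum_mono2)
    show "{y - t..y + t} \<subseteq> (\<lambda>i. y + int i) ` {..nat t} \<union> (\<lambda>i. y - int i) ` {..nat t}"
    proof
      fix z assume z: "z \<in> {y - t..y + t}"
      show "z \<in> (\<lambda>i. y + int i) ` {..nat t} \<union> (\<lambda>i. y - int i) ` {..nat t}"
      proof (cases "y \<le> z")
        case True
        then show ?thesis using z by (intro UnI1 image_eqI[of _ _ "nat (z - y)"]) auto
      next
        case False
        then show ?thesis using z by (intro UnI2 image_eqI[of _ _ "nat (y - z)"]) auto
      qed
    qed
  qed (use q in auto)
  also have "\<dots> \<le> (\<Sum>z\<in>(\<lambda>i. y + int i) ` {..nat t}. q ^ nat \<bar>y - z\<bar>) + (\<Sum>z\<in>(\<lambda>i. y - int i) ` {..nat t}. q ^ nat \<bar>y - z\<bar>)"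
    using q by (subst sum_Un) (auto intro!: sum_nonneg)
  also have "\<dots> = (\<Sum>i\<le>nat t. q ^ i) + (\<Sum>i\<le>nat t. q ^ i)"
    by (subst (1 2) sum.reindex) (auto simp: inj_on_def)
  also have "\<dots> \<le> 2 / (1 - q)" using geo by simp
  also have "\<dots> \<le> 2 / (\<theta> / 2)"
  proof (rule divide_left_mono)
    have "1 + \<theta> \<le> exp \<theta>" by (rule exp_ge_add_one_self)
    then have "q \<le> 1 / (1 + \<theta>)" unfolding q_def exp_minus using assms by (simp add: field_simps)
    also have "\<dots> \<le> 1 - \<theta> / 2" using assms by (simp add: field_simps)
    finally show "\<theta> / 2 \<le> 1 - q" by simp
  qed (use assms q in auto)
  finally show ?thesis unfolding e by simp
qed

text \<open>The number of choices for one link up to the factor \<open>1 / \<theta>\<close>: at most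
  \<open>2 * (\<rho> + 1)\<close> abscissas, \<open>4 / \<theta>\<close> from the weighted sum over
  the ordinates, and at most all subsets of a square.\<close>

definition chain_base :: "nat \<Rightarrow> int \<Rightarrow> real" where
  "chain_base \<rho> K = 8 * real (\<rho> + 1) * 2 ^ (nat (2 * K + 1) ^ 2)"

text \<open>A chain with total length at most \<open>t\<close> has weight at least one when it is weighted by
  \<open>exp (\<theta> * (t - length))\<close>, and the weights factorize.\<close>
lemma card_chain_sets_le:
  fixes \<theta> :: real
  assumes K: "0 \<le> K" and w: "2 * K + int \<rho> < w" and \<theta>: "0 < \<theta>" "\<theta> \<le> 1"
  shows "0 \<le> t \<Longrightarrow> real (card (chain_sets \<rho> s K w n k y t)) \<le> (chain_base \<rho> K / \<theta>) ^ n * exp (\<theta> * real_of_int t)"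
proof (induction n arbitrary: k y t)
  case 0
  then show ?case using \<theta> by simp
next
  case (Suc n)
  define c where "c = chain_base \<rho> K / \<theta>"
  have c0: "0 \<le> c" using \<theta> by (simp add: c_def chain_base_def)
  let ?X = "{x. k * w \<le> \<bar>x\<bar> \<and> \<bar>x\<bar> \<le> k * w + int \<rho>}"
  let ?N = "2 ^ (nat (2 * K + 1) ^ 2) :: nat"
  let ?C = "\<lambda>y'. chain_sets \<rho> s K w n (k + 1) y' (t - \<bar>y - y'\<bar>)"
  let ?G = "\<lambda>x y'. \<Union>A\<in>{A. A \<subseteq> square K (x, y') \<and> card A = s}. (\<lambda>F. A \<union> F) ` ?C y'"
  have Xsub: "?X \<subseteq> {k * w..k * w + int \<rho>} \<union> {- (k * w + int \<rho>)..- (k * w)}" by auto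
  have finX: "finite ?X" by (rule finite_subset[OF Xsub]) simp
  have "card ?X \<le> card ({k * w..k * w + int \<rho>} \<union> {- (k * w + int \<rho>)..- (k * w)})"
    using Xsub by (intro card_mono) auto
  also have "\<dots> \<le> card {k * w..k * w + int \<rho>} + card {- (k * w + int \<rho>)..- (k * w)}" by (rule card_Un_le)
  also have "\<dots> = 2 * (\<rho> + 1)" by simp
  finally have cardX: "card ?X \<le> 2 * (\<rho> + 1)" .
  have inner: "real (card (?G x y')) \<le> real ?N * (c ^ n * exp (\<theta> * real_of_int (t - \<bar>y - y'\<bar>)))"
    if y': "y' \<in> {y - t..y + t}" for x y'
  proof -
    have fin: "finite {A. A \<subseteq> square K (x, y') \<and> card A = s}"
      by (rule finite_subset[of _ "Pow (square K (x, y'))"]) auto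
    have im: "card ((\<lambda>F. A \<union> F) ` ?C y') \<le> card (?C y')" for A
      by (rule card_image_le) (rule chain_sets_facts(1)[OF K w])
    have "card (?G x y') \<le> card {A. A \<subseteq> square K (x, y') \<and> card A = s} * card (?C y')"
      using fin im by (intro card_UN_le_mult) auto
    also have "\<dots> \<le> ?N * card (?C y')"
      using card_subsets_le[of "square K (x, y')" s] K by (intro mult_right_mono) (auto simp: card_square)
    finally have "real (card (?G x y')) \<le> real ?N * real (card (?C y'))"
      unfolding of_nat_mult[symmetric] of_nat_le_iff .
    also have "\<dots> \<le> real ?N * (c ^ n * exp (\<theta> * real_of_int (t - \<bar>y - y'\<bar>)))"
      unfolding c_def using y' by (intro mult_left_mono Suc.IH) auto
    finally show ?thesis .
  qed
  have "card (chain_sets \<rho> s K w (Suc n) k y t) \<le> (\<Sum>x\<in>?X. card (\<Union>y'\<in>{y - t..y + t}. ?G x y'))"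
    unfolding chain_sets.simps using finX by (rule card_UN_le)
  also have "\<dots> \<le> (\<Sum>x\<in>?X. \<Sum>y'\<in>{y - t..y + t}. card (?G x y'))"
    by (intro sum_mono card_UN_le) simp
  finally have "real (card (chain_sets \<rho> s K w (Suc n) k y t)) \<le> (\<Sum>x\<in>?X. \<Sum>y'\<in>{y - t..y + t}. real (card (?G x y')))"
    unfolding of_nat_sum[symmetric] of_nat_le_iff .
  also have "\<dots> \<le> (\<Sum>x\<in>?X. \<Sum>y'\<in>{y - t..y + t}. real ?N * (c ^ n * exp (\<theta> * real_of_int (t - \<bar>y - y'\<bar>))))"
    using inner by (intro sum_mono) blast
  also have "\<dots> = real (card ?X) * (real ?N * c ^ n * exp (\<theta> * real_of_int t) * (\<Sum>y'\<in>{y - t..y + t}. exp (- (\<theta> * real_of_int \<bar>y - y'\<bar>))))"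
  proof -
    have e: "exp (\<theta> * real_of_int (t - d)) = exp (\<theta> * real_of_int t) * exp (- (\<theta> * real_of_int d))" for d
      by (simp add: exp_add[symmetric] algebra_simps)
    have i: "(\<Sum>y'\<in>{y - t..y + t}. real ?N * (c ^ n * exp (\<theta> * real_of_int (t - \<bar>y - y'\<bar>))))
      = real ?N * c ^ n * exp (\<theta> * real_of_int t) * (\<Sum>y'\<in>{y - t..y + t}. exp (- (\<theta> * real_of_int \<bar>y - y'\<bar>)))"
      unfolding sum_distrib_left by (intro sum.cong refl) (simp only: e mult.assoc)
    show ?thesis by (simp only: i sum_constant)
  qed
  also have "\<dots> \<le> real (2 * (\<rho> + 1)) * (real ?N * c ^ n * exp (\<theta> * real_of_int t) * (4 / \<theta>))"
    using cardX sum_exp_abs_le[OF \<theta> Suc.prems, of y] c0 \<theta>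
    by (intro mult_mono) (auto intro!: sum_nonneg mult_nonneg_nonneg)
  also have "\<dots> = c ^ Suc n * exp (\<theta> * real_of_int t)"
    unfolding c_def chain_base_def by simp
  finally show ?case unfolding c_def .
qed

lemma sum_Un_le:
  fixes f :: "'a \<Rightarrow> real"
  assumes "finite A" "finite B" "\<And>x. 0 \<le> f x"
  shows "sum f (A \<union> B) \<le> sum f A + sum f B"
  using assms by (subst sum_Un) (auto intro!: sum_nonneg)

lemma sum_UN_le:
  fixes f :: "'a \<Rightarrow> real"
  assumes "finite I" "\<And>i. i \<in> I \<Longrightarrow> finite (A i)" "\<And>x. 0 \<le> f x"
  shows "sum f (\<Union>i\<in>I. A i) \<le> (\<Sum>i\<in>I. sum f (A i))"
  using assms
proof (induction I rule: finite_induct)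
  case (insert i I)
  have "sum f (\<Union>j\<in>insert i I. A j) \<le> sum f (A i) + sum f (\<Union>j\<in>I. A j)"
    using insert by (simp, intro sum_Un_le) auto
  then show ?case using insert by simp
qed simp

lemma weight_le:
  fixes p :: real
  assumes "\<And>F. F \<in> \<F> \<Longrightarrow> card F = m" "real (card \<F>) \<le> N" "0 \<le> p"
  shows "(\<Sum>F\<in>\<F>. p ^ card F) \<le> N * p ^ m"
proof -
  have "(\<Sum>F\<in>\<F>. p ^ card F) = real (card \<F>) * p ^ m" using assms(1) by simp
  also have "\<dots> \<le> N * p ^ m" using assms by (intro mult_right_mono) auto
  finally show ?thesis .
qed

section \<open>Union bound for an occupied origin\<close>

context cross_growth begin

lemma hit_time_leD:
  assumes "hit_time \<rho> corner_zeros \<omega> \<le> ennreal \<tau>" "0 \<le> \<tau>"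
  shows "(0, 0) \<in> grown {x. \<omega> x} (nat \<lfloor>\<tau>\<rfloor>)"
proof -
  let ?S = "{t. (0, 0) \<in> grown {x. \<omega> x} t}"
  have "?S \<noteq> {}"
  proof
    assume "?S = {}"
    then have "hit_time \<rho> corner_zeros \<omega> = top" unfolding hit_time_def by (simp only: image_empty Inf_empty)
    then show False using assms(1) by (simp add: top_unique)
  qed
  then obtain t where t: "t \<in> ?S" "\<And>s. s \<in> ?S \<Longrightarrow> t \<le> s"
    using exists_least_iff[of "\<lambda>t. t \<in> ?S"] by (metis (full_types) equals0I not_less)
  then have "of_nat t \<le> hit_time \<rho> corner_zeros \<omega>"
    unfolding hit_time_def by (intro INF_greatest) auto
  then have "ennreal (real t) \<le> ennreal \<tau>"
    using assms(1) by (simp add: ennreal_of_nat_eq_real_of_nat)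
  then have "real t \<le> \<tau>" using assms(2) by simp
  then have "t \<le> nat \<lfloor>\<tau>\<rfloor>" by (simp add: le_nat_floor)
  then show ?thesis using t(1) growth_monoD by blast
qed

text \<open>The cost \<open>k r + (s1 - k) (r - s2) / (s1 + 1)\<close> rounded up to an integer.
  Heavy sets are trimmed to this size, so that all patterns for a given \<open>k\<close> have the
  same probability.\<close>

definition heavy_size :: "nat \<Rightarrow> nat" where
  "heavy_size k = (LEAST n. (s1 + 1) * (k * r) + (s1 - k) * (r - s2) \<le> (s1 + 1) * n)"

lemma heavy_size: "(s1 + 1) * (k * r) + (s1 - k) * (r - s2) \<le> (s1 + 1) * heavy_size k"
proof -
  have "(s1 + 1) * (k * r) + (s1 - k) * (r - s2) \<le> (s1 + 1) * ((s1 + 1) * (k * r) + (s1 - k) * (r - s2))"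
    by simp
  then show ?thesis unfolding heavy_size_def by (rule LeastI)
qed

lemma heavy_size_le: "(s1 + 1) * (k * r) + (s1 - k) * (r - s2) \<le> (s1 + 1) * n \<Longrightarrow> heavy_size k \<le> n"
  unfolding heavy_size_def by (rule Least_le)

definition width :: "int \<Rightarrow> int" where
  "width \<Delta> = 2 * (\<Delta> + 2 * int \<rho>) * (int s1 + 1)"

text \<open>The summands stand for dense sets, heavy sets created by \<open>k\<close> classes, a
  site near the origin, \<open>r\<close> sites near column 0, and chains across the width. For heavy
  sets, \<open>2 * L + 1\<close> counts the leftmost abscissas and \<open>(2 * H + 1) ^ k\<close>
  the lowest ordinates of the classes.\<close>

lemma origin_prob_bound:
  assumes p: "0 \<le> p" "p \<le> 1" and \<theta>: "0 < \<theta>" "\<theta> \<le> 1" and M: "2 \<le> M"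
    and \<Delta>: "\<Delta> = int M * (2 * int \<rho>)" and K: "K = \<Delta> + int \<rho>" and w: "w = 2 * K + int \<rho> + 1"
    and L: "L = n * nat w + \<rho>" and H: "H = \<rho> * t"
  shows "measure (init_measure p) {\<omega>. (0, 0) \<in> grown {x. \<omega> x} t}
    \<le> real ((2 * L + 1) * (2 * H + 1)) * 2 ^ (nat (4 * \<Delta> + 1) ^ 2) * p ^ M
      + (\<Sum>k\<in>{1..s1}. real ((2 * L + 1) * (2 * H + 1) ^ k) * 2 ^ (nat (width \<Delta> + 1) * (s1 * nat (\<Delta> + 1))) * p ^ heavy_size k)
      + real (nat (2 * K + 1) ^ 2) * p
      + real (2 * H + 1) * 2 ^ (nat (2 * K + 1) ^ 2) * p ^ r
      + (chain_base \<rho> K / \<theta>) ^ n * exp (\<theta> * real H) * p ^ (n * s2)"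
proof -
  let ?L = "{- int L..int L}" and ?H = "{- int H..int H}"
  define region where "region = (\<lambda>v hs. {v..v + width \<Delta>} \<times> (\<Union>h\<in>set hs. {h..h + \<Delta>}))"
  define F1 where "F1 = (\<Union>v\<in>?L. \<Union>h\<in>?H. {A. A \<subseteq> square (2 * \<Delta>) (v, h) \<and> card A = M})"
  \<comment> \<open>Lists rather than sets, because two classes may have the same lowest
    ordinate.\<close>
  define lists where "lists = (\<lambda>k::nat. {hs. set hs \<subseteq> ?H \<and> length hs = k})"
  define F2k where "F2k = (\<lambda>k. \<Union>v\<in>?L. \<Union>hs\<in>lists k. {F. F \<subseteq> region v hs \<and> card F = heavy_size k})"
  define F2 where "F2 = (\<Union>k\<in>{1..s1}. F2k k)"
  define F3 where "F3 = (\<lambda>z. {z}) ` square K (0, 0)"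
  define F4 where "F4 = (\<Union>y\<in>?H. {A. A \<subseteq> square K (0, y) \<and> card A = r})"
  define F5 where "F5 = chain_sets \<rho> s2 K w n 0 0 (int \<rho> * int t)"
  have \<Delta>0: "0 \<le> \<Delta>" using \<Delta> by simp
  have K0: "0 \<le> K" using K \<Delta>0 by simp
  have w0: "2 * K + int \<rho> < w" using w by simp
  have wd0: "0 \<le> width \<Delta>" using \<Delta>0 by (simp add: width_def)
  have finsub: "finite {A. A \<subseteq> X \<and> Q A}" if "finite X" for X :: "(int \<times> int) set" and Q
    by (rule finite_subset[of _ "Pow X"]) (use that in auto)
  have finlists: "finite (lists k)" for k unfolding lists_def by (rule finite_lists_length_eq) simp
  have finregion: "finite (region v hs)" for v hs by (simp add: region_def)
  have finF2k: "finite (F2k k)" for k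
    unfolding F2k_def by (intro finite_UN_I finlists finsub finregion) auto
  have fin: "finite F1" "finite F2" "finite F3" "finite F4" "finite F5"
    unfolding F1_def F2_def F3_def F4_def F5_def
    using finF2k chain_sets_facts(1)[OF K0 w0] by (auto intro!: finsub)
  have cL: "card ?L = 2 * L + 1" and cH: "card ?H = 2 * H + 1" by auto
  have finel: "finite F" if "F \<in> F1 \<union> (F2 \<union> (F3 \<union> (F4 \<union> F5)))" for F
  proof -
    have "finite F" if "F \<in> F2" using that finregion unfolding F2_def F2k_def by (auto intro: finite_subset)
    moreover have "finite F" if "F \<in> F1 \<or> F \<in> F4"
      using that finite_square unfolding F1_def F4_def by (auto intro: finite_subset)
    moreover have "finite F" if "F \<in> F3" using that unfolding F3_def by auto
    moreover have "finite F" if "F \<in> F5" using that chain_sets_facts(2)[OF K0 w0] unfolding F5_def by blast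
    ultimately show ?thesis using that by blast
  qed
  have cover: "\<exists>F\<in>F1 \<union> (F2 \<union> (F3 \<union> (F4 \<union> F5))). \<forall>i\<in>F. \<omega> i" if \<omega>: "(0, 0) \<in> grown {x. \<omega> x} t" for \<omega>
  proof -
    define P where "P = {x. \<omega> x} \<inter> {- int L..int L} \<times> {- (int \<rho> * int t)..int \<rho> * int t}"
    have Hi: "int \<rho> * int t = int H" by (simp add: H)
    have PL: "z \<in> P \<Longrightarrow> fst z \<in> ?L \<and> snd z \<in> ?H \<and> \<omega> z" for z unfolding P_def Hi by auto
    have wL: "int n * w + int \<rho> \<le> int L" unfolding L using w K0 by simp
    have w00: "0 \<le> w" using w0 K0 by simp
    have "(\<exists>A\<subseteq>P. M \<le> card A \<and> spread_le (2 * \<Delta>) A) \<or> heavy \<Delta> P \<or> P \<inter> square K (0, 0) \<noteq> {}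
      \<or> (\<exists>y\<in>snd ` P. r \<le> card (P \<inter> square K (0, y))) \<or> (\<exists>F\<in>F5. F \<subseteq> P)"
      unfolding F5_def by (rule origin_grown_cases[OF M P_def \<Delta> K w00 wL \<omega>])
    then have "\<exists>F\<in>F1 \<union> (F2 \<union> (F3 \<union> (F4 \<union> F5))). F \<subseteq> P"
    proof (elim disjE)
      assume "\<exists>A\<subseteq>P. M \<le> card A \<and> spread_le (2 * \<Delta>) A"
      then obtain A where A: "A \<subseteq> P" "M \<le> card A" "spread_le (2 * \<Delta>) A" by blast
      obtain A' where A': "A' \<subseteq> A" "card A' = M" using obtain_subset_with_card_n[OF A(2)] by blast
      have "A' \<noteq> {}" using A' M by auto
      then obtain q where q: "q \<in> A'" by blast
      have "A' \<subseteq> square (2 * \<Delta>) (fst q, snd q)"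
      proof
        fix z assume "z \<in> A'"
        then have "\<bar>fst z - fst q\<bar> \<le> 2 * \<Delta> \<and> \<bar>snd z - snd q\<bar> \<le> 2 * \<Delta>"
          using A(3) A' q unfolding spread_le_def by blast
        then show "z \<in> square (2 * \<Delta>) (fst q, snd q)" by (auto simp: square_def mem_Times_iff abs_le_iff)
      qed
      moreover have "fst q \<in> ?L" "snd q \<in> ?H" using PL q A A' by blast+
      ultimately have "A' \<in> F1" unfolding F1_def using A' by blast
      then show ?thesis using A A' by blast
    next
      assume "heavy \<Delta> P"
      then obtain v k hs F where *: "v \<in> fst ` P" "1 \<le> k" "k \<le> s1" "length hs = k" "set hs \<subseteq> snd ` P" "F \<subseteq> P"
        and F: "\<forall>q\<in>F. v \<le> fst q \<and> fst q \<le> v + width \<Delta> \<and> (\<exists>h\<in>set hs. h \<le> snd q \<and> snd q \<le> h + \<Delta>)"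
        and c: "(s1 + 1) * (k * r) + (s1 - k) * (r - s2) \<le> (s1 + 1) * card F"
        unfolding heavy_def width_def by blast
      obtain F' where F': "F' \<subseteq> F" "card F' = heavy_size k"
        by (rule obtain_subset_with_card_n[OF heavy_size_le[OF c]]) (rule that)
      have "F' \<subseteq> region v hs"
      proof
        fix q assume "q \<in> F'"
        then have "v \<le> fst q \<and> fst q \<le> v + width \<Delta> \<and> (\<exists>h\<in>set hs. h \<le> snd q \<and> snd q \<le> h + \<Delta>)"
          using F subsetD[OF F'(1)] by simp
        then show "q \<in> region v hs" unfolding region_def by (auto simp: mem_Times_iff)
      qed
      moreover have "hs \<in> lists k" "v \<in> ?L" unfolding lists_def using * PL by blast+
      ultimately have "F' \<in> F2k k" unfolding F2k_def using F' by blast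
      then have "F' \<in> F2" unfolding F2_def using * by auto
      then show ?thesis using F' * by blast
    next
      assume "P \<inter> square K (0, 0) \<noteq> {}"
      then obtain z where "z \<in> P" "z \<in> square K (0, 0)" by blast
      then show ?thesis unfolding F3_def by blast
    next
      assume "\<exists>y\<in>snd ` P. r \<le> card (P \<inter> square K (0, y))"
      then obtain y where y: "y \<in> snd ` P" "r \<le> card (P \<inter> square K (0, y))" by blast
      obtain A where A: "A \<subseteq> P \<inter> square K (0, y)" "card A = r" using obtain_subset_with_card_n[OF y(2)] by blast
      have "y \<in> ?H" using y PL by blast
      then have "A \<in> F4" unfolding F4_def using A by blast
      then show ?thesis using A by blast
    qed blast
    then show ?thesis using PL by blast
  qed
  have c1: "real (card F1) \<le> real ((2 * L + 1) * (2 * H + 1)) * 2 ^ (nat (4 * \<Delta> + 1) ^ 2)"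
  proof -
    have "card {A. A \<subseteq> square (2 * \<Delta>) z \<and> card A = M} \<le> 2 ^ (nat (4 * \<Delta> + 1) ^ 2)" for z
      using card_subsets_le[of "square (2 * \<Delta>) z" M] \<Delta>0 by (simp add: card_square)
    then have "card F1 \<le> card ?L * (card ?H * 2 ^ (nat (4 * \<Delta> + 1) ^ 2))"
      unfolding F1_def by (intro card_UN_le_mult) auto
    then have "real (card F1) \<le> real (card ?L * (card ?H * 2 ^ (nat (4 * \<Delta> + 1) ^ 2)))"
      by (rule of_nat_mono)
    then show ?thesis unfolding cL cH by (simp add: algebra_simps)
  qed
  have c2: "real (card (F2k k)) \<le> real ((2 * L + 1) * (2 * H + 1) ^ k) * 2 ^ (nat (width \<Delta> + 1) * (s1 * nat (\<Delta> + 1)))"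
    if k: "k \<in> {1..s1}" for k
  proof -
    have reg: "card (region v hs) \<le> nat (width \<Delta> + 1) * (s1 * nat (\<Delta> + 1))" if "hs \<in> lists k" for v hs
    proof -
      have "card (\<Union>h\<in>set hs. {h..h + \<Delta>}) \<le> card (set hs) * nat (\<Delta> + 1)"
        by (rule card_UN_le_mult) auto
      also have "\<dots> \<le> s1 * nat (\<Delta> + 1)"
        using that k card_length[of hs] unfolding lists_def by (intro mult_right_mono) auto
      finally have "card (\<Union>h\<in>set hs. {h..h + \<Delta>}) \<le> s1 * nat (\<Delta> + 1)" .
      moreover have "card {v..v + width \<Delta>} = nat (width \<Delta> + 1)" by simp
      ultimately show ?thesis unfolding region_def card_cartesian_product by (metis mult_le_mono2)
    qed
    have "card {F. F \<subseteq> region v hs \<and> card F = heavy_size k} \<le> 2 ^ (nat (width \<Delta> + 1) * (s1 * nat (\<Delta> + 1)))"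
      if "hs \<in> lists k" for v hs
    proof -
      have "card {F. F \<subseteq> region v hs \<and> card F = heavy_size k} \<le> 2 ^ card (region v hs)"
        by (rule card_subsets_le[OF finregion])
      also have "\<dots> \<le> 2 ^ (nat (width \<Delta> + 1) * (s1 * nat (\<Delta> + 1)))"
        using reg[OF that] by (rule power_increasing) simp
      finally show ?thesis .
    qed
    then have "card (F2k k) \<le> card ?L * (card (lists k) * 2 ^ (nat (width \<Delta> + 1) * (s1 * nat (\<Delta> + 1))))"
      unfolding F2k_def using finlists by (intro card_UN_le_mult) auto
    also have "card (lists k) = card ?H ^ k" unfolding lists_def by (rule card_lists_length_eq) simp
    finally have "real (card (F2k k)) \<le> real (card ?L * (card ?H ^ k * 2 ^ (nat (width \<Delta> + 1) * (s1 * nat (\<Delta> + 1)))))"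
      by (rule of_nat_mono)
    then show ?thesis unfolding cL cH by (simp add: algebra_simps)
  qed
  have c3: "real (card F3) \<le> real (nat (2 * K + 1) ^ 2)"
    unfolding F3_def of_nat_le_iff card_square[OF K0, symmetric, of "(0, 0)"] by (rule card_image_le) simp
  have c4: "real (card F4) \<le> real (2 * H + 1) * 2 ^ (nat (2 * K + 1) ^ 2)"
  proof -
    have "card {A. A \<subseteq> square K z \<and> card A = r} \<le> 2 ^ (nat (2 * K + 1) ^ 2)" for z
      using card_subsets_le[of "square K z" r] K0 by (simp add: card_square)
    then have "card F4 \<le> card ?H * 2 ^ (nat (2 * K + 1) ^ 2)"
      unfolding F4_def by (intro card_UN_le_mult) auto
    then have "real (card F4) \<le> real (card ?H * 2 ^ (nat (2 * K + 1) ^ 2))" by (rule of_nat_mono)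
    then show ?thesis unfolding cH by (simp add: algebra_simps)
  qed
  have c5: "real (card F5) \<le> (chain_base \<rho> K / \<theta>) ^ n * exp (\<theta> * real H)"
    using card_chain_sets_le[OF K0 w0 \<theta>, of "int \<rho> * int t" s2 n 0 0] unfolding F5_def H by simp
  have "measure (init_measure p) {\<omega>. (0, 0) \<in> grown {x. \<omega> x} t} \<le> (\<Sum>F\<in>F1 \<union> (F2 \<union> (F3 \<union> (F4 \<union> F5))). p ^ card F)"
    by (rule prob_Un_cylinders) (use fin finel p cover in auto)
  also have "\<dots> \<le> (\<Sum>F\<in>F1. p ^ card F) + ((\<Sum>F\<in>F2. p ^ card F) + ((\<Sum>F\<in>F3. p ^ card F) + ((\<Sum>F\<in>F4. p ^ card F) + (\<Sum>F\<in>F5. p ^ card F))))"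
    using p fin by (intro order_trans[OF sum_Un_le] add_left_mono) auto
  finally have total: "measure (init_measure p) {\<omega>. (0, 0) \<in> grown {x. \<omega> x} t}
    \<le> (\<Sum>F\<in>F1. p ^ card F) + ((\<Sum>F\<in>F2. p ^ card F) + ((\<Sum>F\<in>F3. p ^ card F) + ((\<Sum>F\<in>F4. p ^ card F) + (\<Sum>F\<in>F5. p ^ card F))))" .
  have s1': "(\<Sum>F\<in>F1. p ^ card F) \<le> real ((2 * L + 1) * (2 * H + 1)) * 2 ^ (nat (4 * \<Delta> + 1) ^ 2) * p ^ M"
    by (rule weight_le[OF _ c1 p(1)]) (auto simp: F1_def)
  have "(\<Sum>F\<in>F2. p ^ card F) \<le> (\<Sum>k\<in>{1..s1}. \<Sum>F\<in>F2k k. p ^ card F)"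
    unfolding F2_def using p finF2k by (intro sum_UN_le) auto
  also have "\<dots> \<le> (\<Sum>k\<in>{1..s1}. real ((2 * L + 1) * (2 * H + 1) ^ k) * 2 ^ (nat (width \<Delta> + 1) * (s1 * nat (\<Delta> + 1))) * p ^ heavy_size k)"
    by (intro sum_mono weight_le[OF _ c2 p(1)]) (auto simp: F2k_def)
  finally have s2': "(\<Sum>F\<in>F2. p ^ card F) \<le> (\<Sum>k\<in>{1..s1}. real ((2 * L + 1) * (2 * H + 1) ^ k) * 2 ^ (nat (width \<Delta> + 1) * (s1 * nat (\<Delta> + 1))) * p ^ heavy_size k)" .
  have s3': "(\<Sum>F\<in>F3. p ^ card F) \<le> real (nat (2 * K + 1) ^ 2) * p"
  proof -
    have "card F = 1" if "F \<in> F3" for F using that by (auto simp: F3_def)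
    from weight_le[OF this c3 p(1)] show ?thesis by simp
  qed
  have s4': "(\<Sum>F\<in>F4. p ^ card F) \<le> real (2 * H + 1) * 2 ^ (nat (2 * K + 1) ^ 2) * p ^ r"
    by (rule weight_le[OF _ c4 p(1)]) (auto simp: F4_def)
  have s5': "(\<Sum>F\<in>F5. p ^ card F) \<le> (chain_base \<rho> K / \<theta>) ^ n * exp (\<theta> * real H) * p ^ (n * s2)"
    by (rule weight_le[OF _ c5 p(1)]) (use chain_sets_facts(2)[OF K0 w0] in \<open>auto simp: F5_def\<close>)
  show ?thesis using total s1' s2' s3' s4' s5' by linarith
qed

end

section \<open>The lower bound and the critical power\<close>

context cross_growth begin

text \<open>As \<open>(r - s2) / (s1 + 1) = r - gam\<close>, the exponent is at least \<open>s2 -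
  gam - k gam + k r + (s1 - k) (r - gam) = s2 - gam + s1 (r - gam) = 0\<close>, independently of
  \<open>k\<close>.\<close>

lemma heavy_weight_le:
  assumes p: "0 < p" "p \<le> 1" and k: "k \<le> s1"
  shows "(p ^ s2 * p powr (- gam)) * (p powr (- gam)) ^ k * p ^ heavy_size k \<le> 1"
proof -
  have g: "gam * (real s1 + 1) = real r * real s1 + real s2"
    unfolding gam_def by (simp add: add.commute)
  have "real ((s1 + 1) * (k * r) + (s1 - k) * (r - s2)) \<le> real ((s1 + 1) * heavy_size k)"
    using heavy_size by (rule of_nat_mono)
  moreover have "real ((s1 + 1) * (k * r) + (s1 - k) * (r - s2))
      = (real s1 + 1) * (real k * real r) + (real s1 - real k) * (real r - real s2)"
    unfolding of_nat_add of_nat_mult using k s2_less by (simp add: of_nat_diff)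
  ultimately have h: "(real s1 + 1) * (real k * real r) + (real s1 - real k) * (real r - real s2) \<le> (real s1 + 1) * real (heavy_size k)"
    by (simp add: algebra_simps)
  have rs: "real r - real s2 = (real s1 + 1) * (real r - gam)"
    using g by (simp add: algebra_simps)
  have "(real s1 + 1) * (real k * real r + (real s1 - real k) * (real r - gam)) \<le> (real s1 + 1) * real (heavy_size k)"
    using h unfolding rs by (simp add: algebra_simps)
  then have "real k * real r + (real s1 - real k) * (real r - gam) \<le> real (heavy_size k)"
    by (rule mult_left_le_imp_le) simp
  then have e: "0 \<le> real s2 - gam + real k * (- gam) + real (heavy_size k)"
    using g by (simp add: algebra_simps)
  have "(p ^ s2 * p powr (- gam)) * (p powr (- gam)) ^ k * p ^ heavy_size k
      = p powr (real s2 - gam + real k * (- gam) + real (heavy_size k))"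
  proof -
    have "(p powr (- gam)) ^ k = p powr (real k * (- gam))" "\<And>j. p ^ j = p powr real j"
      using p by (auto simp: powr_power powr_realpow)
    then show ?thesis by (simp only: powr_add[symmetric] add_uminus_conv_diff)
  qed
  also have "\<dots> \<le> 1"
    using e p by (simp add: powr_le1)
  finally show ?thesis .
qed

text \<open>Only the heavy sets survive in the limit, with a bound proportional to \<open>l\<close>
  because the width is. For fixed \<open>l\<close> the other terms are collected in
  \<open>err\<close> and vanish as \<open>p\<close> tends to 0.\<close>

lemma hit_time_lower:
  "\<exists>C. \<forall>l. 0 < l \<and> l \<le> 1 \<longrightarrow> (\<forall>\<^sub>F p in at_right 0.
     measure (init_measure p) {\<omega>. hit_time \<rho> corner_zeros \<omega> \<le> ennreal (l * p powr (- gam))} \<le> C * l)"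
proof -
  \<comment> \<open>For \<open>2 * r\<close> sites in a bounded square, area times probability is of
    order \<open>p^s2 (p^r a)^2\<close>, which tends to 0.\<close>
  define M where "M = 2 * r"
  define \<Delta> where "\<Delta> = int M * (2 * int \<rho>)"
  define K where "K = \<Delta> + int \<rho>"
  define w where "w = 2 * K + int \<rho> + 1"
  define c1 :: real where "c1 = 2 ^ (nat (4 * \<Delta> + 1) ^ 2)"
  define c2 :: real where "c2 = 2 ^ (nat (width \<Delta> + 1) * (s1 * nat (\<Delta> + 1)))"
  define c3 where "c3 = real (nat (2 * K + 1) ^ 2)"
  define c4 :: real where "c4 = 2 ^ (nat (2 * K + 1) ^ 2)"
  define m where "m = chain_base \<rho> K * exp 1"
  define B1 where "B1 = 2 * m * real \<rho> * (4 * real (nat w) + 2 * real \<rho> + 1)"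
  define B2 where "B2 = 2 * real \<rho> + 1"
  have M2: "2 \<le> M" using s2_less by (simp add: M_def)
  have cb: "0 < chain_base \<rho> K" by (simp add: chain_base_def)
  have m0: "0 < m" using cb by (simp add: m_def)
  have \<rho>1: "1 \<le> real \<rho>" using r_le s2_less by simp
  have pos: "0 \<le> B1" "1 \<le> B2" "0 \<le> c1" "0 \<le> c2" "0 \<le> c3" "0 \<le> c4"
    using m0 by (auto simp: B1_def B2_def c1_def c2_def c3_def c4_def)
  have main: "\<forall>\<^sub>F p in at_right 0. measure (init_measure p) {\<omega>. hit_time \<rho> corner_zeros \<omega> \<le> ennreal (l * p powr (- gam))}
      \<le> (real s1 * (B1 * B2 ^ s1 * c2) + 1) * l" if l: "0 < l" "l \<le> 1" for l
  proof -
    define err where "err = (\<lambda>p. (B1 * B2 * c1 + c3) * p + B2 * c4 * (p ^ r * p powr (- gam))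
      + exp (- (m * real \<rho> * l * (p ^ s2 * p powr (- gam)))))"
    have "(err \<longlongrightarrow> (B1 * B2 * c1 + c3) * 0 + B2 * c4 * 0 + 0) (at_right 0)"
      unfolding err_def
    proof (intro tendsto_add tendsto_mult tendsto_const filterlim_gam(2))
      show "((\<lambda>p::real. p) \<longlongrightarrow> 0) (at_right 0)" by (rule tendsto_ident_at)
      have "filterlim (\<lambda>p. m * real \<rho> * l * (p ^ s2 * p powr (- gam))) at_top (at_right 0)"
        by (rule filterlim_tendsto_pos_mult_at_top[OF tendsto_const _ filterlim_gam(3)]) (use m0 \<rho>1 l in simp)
      then have "filterlim (\<lambda>p. - (m * real \<rho> * l * (p ^ s2 * p powr (- gam)))) at_bot (at_right 0)"
        by (simp add: filterlim_uminus_at_bot)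
      then show "((\<lambda>p. exp (- (m * real \<rho> * l * (p ^ s2 * p powr (- gam))))) \<longlongrightarrow> 0) (at_right 0)"
        by (rule filterlim_compose[OF exp_at_bot])
    qed
    then have "(err \<longlongrightarrow> 0) (at_right 0)" by simp
    then have "\<forall>\<^sub>F p in at_right 0. err p < l" using l by (intro order_tendstoD) auto
    moreover have "\<forall>\<^sub>F p in at_right 0. 1 / l \<le> p powr (- gam)"
      using filterlim_gam(1) by (simp add: filterlim_at_top)
    moreover have "\<forall>\<^sub>F p in at_right 0. p ^ r * p powr (- gam) < 1"
      using filterlim_gam(2) by (intro order_tendstoD) auto
    moreover have "\<forall>\<^sub>F p in at_right 0. 1 / (2 * m * real \<rho> * l) \<le> p ^ s2 * p powr (- gam)"
      using filterlim_gam(3) by (simp add: filterlim_at_top)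
    moreover have "\<forall>\<^sub>F p in at_right 0. p < min 1 (1 / m)"
      by (rule eventually_at_right_real[of 0 "min 1 (1 / m)", THEN eventually_mono]) (use m0 in auto)
    ultimately show ?thesis using eventually_at_right_less[of 0]
    proof eventually_elim
      case (elim p)
      define A where "A = p powr (- gam)"
      define u where "u = p ^ s2 * A"
      define v where "v = p ^ r * A"
      have p: "0 < p" "p < 1" "p < 1 / m" using elim by auto
      have err: "err p < l" and A1: "1 / l \<le> A" and v1: "v < 1" and u1: "1 / (2 * m * real \<rho> * l) \<le> u"
        using elim by (auto simp: A_def u_def v_def)
      have A0: "0 < A" and u0: "0 < u" and v0: "0 < v" using p by (auto simp: A_def u_def v_def)
      define X where "X = l * A"
      have X1: "1 \<le> X" using A1 l by (simp add: X_def field_simps)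
      define t where "t = nat \<lfloor>X\<rfloor>"
      have t: "real t \<le> X" using X1 unfolding t_def by linarith
      define H where "H = \<rho> * t"
      have H: "real H \<le> real \<rho> * X" unfolding H_def using t \<rho>1 by (simp add: mult_left_mono)
      \<comment> \<open>With this choice, \<open>chain_base \<rho> K / \<theta> * p ^ s2 = exp (- 1)\<close>.\<close>
      define \<theta> where "\<theta> = m * p ^ s2"
      have ps2: "p ^ s2 \<le> p" using p s2_pos power_decreasing[of 1 s2 p] by simp
      have \<theta>: "0 < \<theta>" "\<theta> \<le> 1"
      proof -
        show "0 < \<theta>" using m0 p by (simp add: \<theta>_def)
        have "\<theta> \<le> m * p" unfolding \<theta>_def using ps2 m0 by (intro mult_left_mono) auto
        also have "\<dots> \<le> 1" using p(3) m0 by (simp add: field_simps)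
        finally show "\<theta> \<le> 1" .
      qed
      \<comment> \<open>Twice the bound on \<open>\<theta> * H\<close>. With
        \<open>n \<ge> Y\<close> links, each contributing a factor \<open>exp (- 1)\<close>, the
        growth \<open>exp (\<theta> * H)\<close> is outweighed and \<open>exp (- Y / 2)\<close>
        remains, while the width stays of order \<open>l * u\<close>.\<close>
      define Y where "Y = 2 * m * real \<rho> * l * u"
      have Y1: "1 \<le> Y" using u1 m0 \<rho>1 l unfolding Y_def by (simp add: field_simps)
      have Y: "Y = 2 * (\<theta> * (real \<rho> * X))" by (simp add: Y_def \<theta>_def X_def u_def)
      define n where "n = nat \<lceil>Y\<rceil>"
      have n: "Y \<le> real n" "real n \<le> 2 * Y" using Y1 unfolding n_def by linarith+
      define L where "L = n * nat w + \<rho>"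
      have L: "real (2 * L + 1) \<le> B1 * l * u"
      proof -
        have "real (2 * L + 1) = 2 * real n * real (nat w) + (2 * real \<rho> + 1)" by (simp add: L_def)
        also have "\<dots> \<le> 2 * (2 * Y) * real (nat w) + (2 * real \<rho> + 1) * Y"
          using n Y1 \<rho>1 mult_left_mono[of 1 Y "2 * real \<rho> + 1"] by (intro add_mono mult_right_mono) auto
        also have "\<dots> = B1 * l * u" by (simp add: B1_def Y_def algebra_simps)
        finally show ?thesis .
      qed
      have H2: "real (2 * H + 1) \<le> B2 * X"
        using H X1 by (simp add: B2_def algebra_simps)
      have H2': "real (2 * H + 1) \<le> B2 * A"
      proof -
        have "X \<le> A" using l A0 unfolding X_def by simp
        then have "B2 * X \<le> B2 * A" using pos by (intro mult_left_mono) auto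
        then show ?thesis using H2 by linarith
      qed
      have lu: "B1 * l * u \<le> B1 * u" using l pos u0 by (simp add: mult_left_le mult_right_mono)
      have e1: "real ((2 * L + 1) * (2 * H + 1)) * c1 * p ^ M \<le> B1 * B2 * c1 * p"
      proof -
        have "real ((2 * L + 1) * (2 * H + 1)) \<le> (B1 * u) * (B2 * A)"
          unfolding of_nat_mult using L lu H2' pos u0 A0 by (intro mult_mono) auto
        then have "real ((2 * L + 1) * (2 * H + 1)) * c1 * p ^ M \<le> (B1 * u) * (B2 * A) * c1 * p ^ M"
          using pos p by (intro mult_right_mono) auto
        also have "\<dots> = B1 * B2 * c1 * (p ^ s2 * v ^ 2)"
          unfolding u_def v_def M_def by (simp add: power2_eq_square power_mult mult_2 power_add algebra_simps)
        also have "\<dots> \<le> B1 * B2 * c1 * p"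
        proof (rule mult_left_mono)
          have "p ^ s2 * v ^ 2 \<le> p * 1"
            using ps2 v0 v1 p by (intro mult_mono power_le_one) auto
          then show "p ^ s2 * v ^ 2 \<le> p" by simp
        qed (use pos in auto)
        finally show ?thesis .
      qed
      \<comment> \<open>One factor \<open>l\<close> is retained from the width; the heights are
        bounded by multiples of \<open>A\<close>, for which the balance of exponents holds for each
        \<open>k\<close>.\<close>
      have e2k: "real ((2 * L + 1) * (2 * H + 1) ^ k) * c2 * p ^ heavy_size k \<le> B1 * B2 ^ s1 * c2 * l"
        if k: "k \<in> {1..s1}" for k
      proof -
        have "real ((2 * L + 1) * (2 * H + 1) ^ k) \<le> (B1 * l * u) * (B2 * A) ^ k"
          unfolding of_nat_mult of_nat_power using L H2' pos u0 A0 l by (intro mult_mono power_mono) auto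
        then have "real ((2 * L + 1) * (2 * H + 1) ^ k) * c2 * p ^ heavy_size k \<le> (B1 * l * u) * (B2 * A) ^ k * c2 * p ^ heavy_size k"
          using pos p by (intro mult_right_mono) auto
        also have "\<dots> = (B1 * B2 ^ k * c2 * l) * (u * A ^ k * p ^ heavy_size k)"
          by (simp add: power_mult_distrib)
        also have "\<dots> \<le> (B1 * B2 ^ s1 * c2 * l) * 1"
        proof (intro mult_mono)
          show "B2 ^ k \<le> B2 ^ s1" using k pos by (intro power_increasing) auto
          show "u * A ^ k * p ^ heavy_size k \<le> 1"
            using heavy_weight_le[of p k] p k unfolding u_def A_def by simp
        qed (use pos l u0 A0 p in auto)
        finally show ?thesis by simp
      qed
      have e2: "(\<Sum>k\<in>{1..s1}. real ((2 * L + 1) * (2 * H + 1) ^ k) * c2 * p ^ heavy_size k) \<le> real s1 * (B1 * B2 ^ s1 * c2) * l"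
      proof -
        have "(\<Sum>k\<in>{1..s1}. real ((2 * L + 1) * (2 * H + 1) ^ k) * c2 * p ^ heavy_size k) \<le> (\<Sum>k\<in>{1..s1}. B1 * B2 ^ s1 * c2 * l)"
          by (rule sum_mono) (rule e2k)
        then show ?thesis by (simp add: mult.assoc)
      qed
      have e4: "real (2 * H + 1) * c4 * p ^ r \<le> B2 * c4 * v"
      proof -
        have "real (2 * H + 1) * c4 * p ^ r \<le> (B2 * A) * c4 * p ^ r"
          using H2' pos p by (intro mult_right_mono) auto
        then show ?thesis by (simp add: v_def algebra_simps)
      qed
      have e5: "(chain_base \<rho> K / \<theta>) ^ n * exp (\<theta> * real H) * p ^ (n * s2) \<le> exp (- (m * real \<rho> * l * u))"
      proof -
        have "(chain_base \<rho> K / \<theta>) ^ n * exp (\<theta> * real H) * p ^ (n * s2)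
          = (chain_base \<rho> K / \<theta> * p ^ s2) ^ n * exp (\<theta> * real H)"
        proof -
          have "p ^ (n * s2) = (p ^ s2) ^ n" by (simp add: power_mult[symmetric] mult.commute)
          then show ?thesis by (simp only: power_mult_distrib mult_ac)
        qed
        also have "chain_base \<rho> K / \<theta> * p ^ s2 = exp (- 1)"
          unfolding \<theta>_def m_def using p cb by (simp add: exp_minus field_simps)
        also have "exp (- 1) ^ n * exp (\<theta> * real H) = exp (- real n + \<theta> * real H)"
        proof -
          have "exp (- 1) ^ n = exp (- real n)" by (simp add: exp_of_nat_mult[symmetric])
          then show ?thesis by (simp only: exp_add)
        qed
        also have "\<dots> \<le> exp (- (m * real \<rho> * l * u))"
        proof -
          have "\<theta> * real H \<le> \<theta> * (real \<rho> * X)" using H \<theta> by (intro mult_left_mono) auto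
          also have "\<dots> = Y / 2" by (simp add: Y)
          finally have "- real n + \<theta> * real H \<le> - (Y / 2)" using n by linarith
          also have "\<dots> = - (m * real \<rho> * l * u)" by (simp add: Y_def)
          finally show ?thesis by simp
        qed
        finally show ?thesis .
      qed
      have "measure (init_measure p) {\<omega>. hit_time \<rho> corner_zeros \<omega> \<le> ennreal (l * p powr (- gam))}
        \<le> measure (init_measure p) {\<omega>. (0, 0) \<in> grown {x. \<omega> x} t}"
      proof -
        interpret prob_space "init_measure p" by (rule prob_space_init)
        have "{\<omega>\<in>space (init_measure p). (0, 0) \<in> grown {x. \<omega> x} t} \<in> events"
          using measurable_growth[where p = p and x = "(0, 0)" and \<rho> = \<rho> and Z = corner_zeros and t = t] by (simp add: pred_def)
        then show ?thesis
          using hit_time_leD[of _ X] X1 unfolding t_def X_def A_def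
          by (intro finite_measure_mono) auto
      qed
      also have "\<dots> \<le> real ((2 * L + 1) * (2 * H + 1)) * c1 * p ^ M
        + (\<Sum>k\<in>{1..s1}. real ((2 * L + 1) * (2 * H + 1) ^ k) * c2 * p ^ heavy_size k)
        + c3 * p + real (2 * H + 1) * c4 * p ^ r
        + (chain_base \<rho> K / \<theta>) ^ n * exp (\<theta> * real H) * p ^ (n * s2)"
        unfolding c1_def c2_def c3_def c4_def
        by (rule origin_prob_bound[OF _ _ \<theta> M2 \<Delta>_def K_def w_def L_def H_def]) (use p in auto)
      also have "\<dots> \<le> B1 * B2 * c1 * p + real s1 * (B1 * B2 ^ s1 * c2) * l + c3 * p + B2 * c4 * v + exp (- (m * real \<rho> * l * u))"
        using e1 e2 e4 e5 by linarith
      also have "\<dots> = real s1 * (B1 * B2 ^ s1 * c2) * l + err p"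
        by (simp add: err_def u_def v_def A_def algebra_simps)
      also have "\<dots> \<le> (real s1 * (B1 * B2 ^ s1 * c2) + 1) * l"
        using err by (simp add: algebra_simps)
      finally show ?case .
    qed
  qed
  then show ?thesis by blast
qed

lemma hit_time_gtrsim:
  "prob_gtrsim init_measure (\<lambda>_. hit_time \<rho> corner_zeros) (\<lambda>p. p powr (- gam))"
proof -
  obtain C where C: "\<And>l. 0 < l \<Longrightarrow> l \<le> 1 \<Longrightarrow> \<forall>\<^sub>F p in at_right 0.
     measure (init_measure p) {\<omega>. hit_time \<rho> corner_zeros \<omega> \<le> ennreal (l * p powr (- gam))} \<le> C * l"
    using hit_time_lower by blast
  show ?thesis
    unfolding prob_gtrsim_def
  proof (rule tendsto_Limsup_prob)
    show "\<forall>\<^sub>F l in at_right 0. \<forall>\<^sub>F p in at_right 0. measure (init_measure p)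
      {\<omega> \<in> space (init_measure p). hit_time \<rho> corner_zeros \<omega> \<le> ennreal (l * p powr (- gam))} \<le> C * l"
      by (rule eventually_at_right_real[of 0 1, THEN eventually_mono]) (use C in auto)
    show "((\<lambda>l. C * l) \<longlongrightarrow> 0) (at_right 0)"
      by (auto intro!: tendsto_eq_intros)
  qed simp
qed

end

section \<open>From the asymptotics to a unique critical power\<close>

lemma prob_le_one_cover:
  assumes "X \<in> borel_measurable (init_measure p)" "b \<le> a"
  shows "1 \<le> measure (init_measure p) {\<omega>. ennreal b \<le> X \<omega>} + measure (init_measure p) {\<omega>. X \<omega> \<le> ennreal a}"
proof -
  interpret prob_space "init_measure p" by (rule prob_space_init)
  have m: "{\<omega>\<in>space (init_measure p). ennreal b \<le> X \<omega>} \<in> events" "{\<omega>\<in>space (init_measure p). X \<omega> \<le> ennreal a} \<in> events"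
    using assms(1) by measurable
  have "\<omega> \<in> {\<omega>. ennreal b \<le> X \<omega>} \<union> {\<omega>. X \<omega> \<le> ennreal a}" for \<omega>
    using ennreal_leI[OF assms(2)] by (auto simp: not_le intro: order_trans less_imp_le)
  then have "1 = prob ({\<omega>. ennreal b \<le> X \<omega>} \<union> {\<omega>. X \<omega> \<le> ennreal a})"
    using prob_space by (metis UNIV_eq_I space_init)
  also have "\<dots> \<le> prob {\<omega>. ennreal b \<le> X \<omega>} + prob {\<omega>. X \<omega> \<le> ennreal a}"
    using m by (intro measure_Un_le) auto
  finally show ?thesis .
qed

lemma eventually_small_Limsup:
  fixes P :: "real \<Rightarrow> real \<Rightarrow> real"
  assumes "((\<lambda>l. Limsup (at_right 0) (\<lambda>p. ereal (P l p))) \<longlongrightarrow> 0) F"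
  shows "\<forall>\<^sub>F l in F. \<forall>\<^sub>F p in at_right 0. P l p < 1 / 2"
proof -
  have "\<forall>\<^sub>F l in F. Limsup (at_right (0::real)) (\<lambda>p. ereal (P l p)) < ereal (1 / 2)"
    using assms by (rule order_tendstoD) (simp add: zero_ereal_def)
  then show ?thesis
  proof eventually_elim
    case (elim l)
    from Limsup_lessD[OF this] show ?case by simp
  qed
qed

text \<open>If \<open>\<beta> < \<alpha>\<close>, the choice of \<open>\<epsilon>\<close> still
  gives \<open>b < a\<close>, so \<open>l2 * p powr (- b) \<le> l1 * p powr (- a)\<close> for small
  \<open>p\<close>. The two tail events then cover the whole space, although each has probability
  below \<open>1 / 2\<close>.\<close>

lemma lower_power_le_upper_power:
  assumes lower: "lower_power \<rho> Z \<alpha>" and upper: "upper_power \<rho> Z \<beta>"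
  shows "\<alpha> \<le> \<beta>"
proof (rule ccontr)
  assume "\<not> ?thesis"
  then have lt: "\<beta> < \<alpha>" by simp
  define \<epsilon> where "\<epsilon> = (\<alpha> - \<beta>) / 4"
  have \<epsilon>: "0 < \<epsilon>" using lt by (simp add: \<epsilon>_def)
  define a b where "a = \<alpha> - \<epsilon>" and "b = \<beta> + \<epsilon>"
  have ba: "b < a" using lt by (simp add: a_def b_def \<epsilon>_def field_simps)
  have "\<forall>\<^sub>F l in at_right 0. \<forall>\<^sub>F p in at_right 0.
      measure (init_measure p) {\<omega> \<in> space (init_measure p). hit_time \<rho> Z \<omega> \<le> ennreal (l * p powr (- a))} < 1 / 2"
    using lower \<epsilon> unfolding lower_power_def prob_gtrsim_def a_def by (intro eventually_small_Limsup) blast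
  then obtain l1 where l1: "0 < l1" "\<forall>\<^sub>F p in at_right 0.
      measure (init_measure p) {\<omega> \<in> space (init_measure p). hit_time \<rho> Z \<omega> \<le> ennreal (l1 * p powr (- a))} < 1 / 2"
    using eventually_conj[OF eventually_at_right_less[of "0::real"]] eventually_happens'[OF trivial_limit_at_right_real] by (metis (mono_tags, lifting))
  have "\<forall>\<^sub>F l in at_top. \<forall>\<^sub>F p in at_right 0.
      measure (init_measure p) {\<omega> \<in> space (init_measure p). ennreal (l * p powr (- b)) \<le> hit_time \<rho> Z \<omega>} < 1 / 2"
    using upper \<epsilon> unfolding upper_power_def prob_lesssim_def b_def by (intro eventually_small_Limsup) blast
  then obtain l2 where l2: "\<forall>\<^sub>F p in at_right 0.
      measure (init_measure p) {\<omega> \<in> space (init_measure p). ennreal (l2 * p powr (- b)) \<le> hit_time \<rho> Z \<omega>} < 1 / 2"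
    using eventually_happens'[OF trivial_limit_at_top_linorder] by (metis (mono_tags, lifting))
  have "filterlim (\<lambda>p::real. p powr (- (a - b))) at_top (at_right 0)"
    using ba by (intro filterlim_powr_neg_at_right_0) simp
  then have "\<forall>\<^sub>F p in at_right 0. l2 / l1 \<le> p powr (- (a - b))"
    by (simp add: filterlim_at_top)
  with l1(2) l2 eventually_at_right_less[of 0] have "\<forall>\<^sub>F p in at_right (0::real). False"
  proof eventually_elim
    case (elim p)
    have "l2 * p powr (- b) \<le> (l1 * p powr (- (a - b))) * p powr (- b)"
      using elim l1(1) by (intro mult_right_mono) (auto simp: field_simps)
    also have "\<dots> = l1 * p powr (- a)" using elim by (simp add: powr_add[symmetric])
    finally show ?case
      using prob_le_one_cover[OF measurable_hit_time, of "l2 * p powr (- b)" "l1 * p powr (- a)" p \<rho> Z] elim by simp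
  qed
  then show False by simp
qed

lemma Limsup_at_right_0_mono:
  fixes P Q :: "real \<Rightarrow> real"
  assumes "\<And>p. 0 < p \<Longrightarrow> p < 1 \<Longrightarrow> P p \<le> Q p"
  shows "Limsup (at_right 0) (\<lambda>p. ereal (P p)) \<le> Limsup (at_right 0) (\<lambda>p. ereal (Q p))"
proof (rule Limsup_mono)
  show "\<forall>\<^sub>F p in at_right 0. ereal (P p) \<le> ereal (Q p)"
    by (rule eventually_at_right_real[of 0 1, THEN eventually_mono]) (use assms in auto)
qed

text \<open>For \<open>p < 1\<close> the scale \<open>p powr (- \<gamma>)\<close> lies between the
  two perturbed ones, so for the same \<open>l\<close> the perturbed tail events are contained in
  the unperturbed ones.\<close>

lemma powers_of_asymp:
  assumes \<gamma>: "0 < \<gamma>" and asymp: "prob_asymp init_measure (\<lambda>_. hit_time \<rho> Z) (\<lambda>p. p powr (- \<gamma>))"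
  shows "is_critical_power \<rho> Z \<gamma>"
proof -
  have less: "prob_lesssim init_measure (\<lambda>_. hit_time \<rho> Z) (\<lambda>p. p powr (- (\<gamma> + \<epsilon>)))"
    and gtr: "prob_gtrsim init_measure (\<lambda>_. hit_time \<rho> Z) (\<lambda>p. p powr (- (\<gamma> - \<epsilon>)))" if \<epsilon>: "0 < \<epsilon>" for \<epsilon>
  proof -
    have ev: "\<And>p. {\<omega>\<in>space (init_measure p). ennreal c \<le> hit_time \<rho> Z \<omega>} \<in> sets (init_measure p)"
      "\<And>p. {\<omega>\<in>space (init_measure p). hit_time \<rho> Z \<omega> \<le> ennreal c} \<in> sets (init_measure p)" for c
      using measurable_hit_time by measurable
    have mono: "measure (init_measure p) A \<le> measure (init_measure p) B"
      if "A \<subseteq> B" "B \<in> sets (init_measure p)" for A B p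
      using that prob_space_init[of p] by (meson finite_measure.finite_measure_mono prob_space.finite_measure)
    show "prob_lesssim init_measure (\<lambda>_. hit_time \<rho> Z) (\<lambda>p. p powr (- (\<gamma> + \<epsilon>)))"
      unfolding prob_lesssim_def
    proof (rule tendsto_sandwich)
      show "\<forall>\<^sub>F l in at_top. 0 \<le> Limsup (at_right (0::real)) (\<lambda>p. ereal (measure (init_measure p)
          {\<omega> \<in> space (init_measure p). ennreal (l * p powr (- (\<gamma> + \<epsilon>))) \<le> hit_time \<rho> Z \<omega>}))"
        by (intro always_eventually allI le_Limsup) auto
      show "\<forall>\<^sub>F l in at_top. Limsup (at_right 0) (\<lambda>p. ereal (measure (init_measure p)
          {\<omega> \<in> space (init_measure p). ennreal (l * p powr (- (\<gamma> + \<epsilon>))) \<le> hit_time \<rho> Z \<omega>}))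
        \<le> Limsup (at_right 0) (\<lambda>p. ereal (measure (init_measure p)
          {\<omega> \<in> space (init_measure p). ennreal (l * p powr (- \<gamma>)) \<le> hit_time \<rho> Z \<omega>}))"
        using eventually_gt_at_top[of "0::real"]
      proof eventually_elim
        case (elim l)
        show ?case
        proof (rule Limsup_at_right_0_mono)
          fix p :: real assume p: "0 < p" "p < 1"
          have "p powr (- \<gamma>) \<le> p powr (- (\<gamma> + \<epsilon>))" using p \<epsilon> by (intro powr_mono') auto
          then have "ennreal (l * p powr (- \<gamma>)) \<le> ennreal (l * p powr (- (\<gamma> + \<epsilon>)))"
            using \<open>0 < l\<close> by (intro ennreal_leI mult_left_mono) auto
          then show "measure (init_measure p) {\<omega> \<in> space (init_measure p). ennreal (l * p powr (- (\<gamma> + \<epsilon>))) \<le> hit_time \<rho> Z \<omega>} \<le> measure (init_measure p) {\<omega> \<in> space (init_measure p). ennreal (l * p powr (- \<gamma>)) \<le> hit_time \<rho> Z \<omega>}"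
            by (intro mono ev) (auto intro: order_trans)
        qed
      qed
      show "((\<lambda>l. Limsup (at_right 0) (\<lambda>p. ereal (measure (init_measure p)
          {\<omega> \<in> space (init_measure p). ennreal (l * p powr (- \<gamma>)) \<le> hit_time \<rho> Z \<omega>}))) \<longlongrightarrow> 0) at_top"
        using asymp unfolding prob_asymp_def prob_lesssim_def by blast
    qed simp
    show "prob_gtrsim init_measure (\<lambda>_. hit_time \<rho> Z) (\<lambda>p. p powr (- (\<gamma> - \<epsilon>)))"
      unfolding prob_gtrsim_def
    proof (rule tendsto_sandwich)
      show "\<forall>\<^sub>F l in at_right 0. 0 \<le> Limsup (at_right (0::real)) (\<lambda>p. ereal (measure (init_measure p)
          {\<omega> \<in> space (init_measure p). hit_time \<rho> Z \<omega> \<le> ennreal (l * p powr (- (\<gamma> - \<epsilon>)))}))"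
        by (intro always_eventually allI le_Limsup) auto
      show "\<forall>\<^sub>F l in at_right 0. Limsup (at_right 0) (\<lambda>p. ereal (measure (init_measure p)
          {\<omega> \<in> space (init_measure p). hit_time \<rho> Z \<omega> \<le> ennreal (l * p powr (- (\<gamma> - \<epsilon>)))}))
        \<le> Limsup (at_right 0) (\<lambda>p. ereal (measure (init_measure p)
          {\<omega> \<in> space (init_measure p). hit_time \<rho> Z \<omega> \<le> ennreal (l * p powr (- \<gamma>))}))"
        using eventually_at_right_less[of "0::real"]
      proof eventually_elim
        case (elim l)
        show ?case
        proof (rule Limsup_at_right_0_mono)
          fix p :: real assume p: "0 < p" "p < 1"
          have "p powr (- (\<gamma> - \<epsilon>)) \<le> p powr (- \<gamma>)" using p \<epsilon> by (intro powr_mono') auto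
          then have "ennreal (l * p powr (- (\<gamma> - \<epsilon>))) \<le> ennreal (l * p powr (- \<gamma>))"
            using \<open>0 < l\<close> by (intro ennreal_leI mult_left_mono) auto
          then show "measure (init_measure p) {\<omega> \<in> space (init_measure p). hit_time \<rho> Z \<omega> \<le> ennreal (l * p powr (- (\<gamma> - \<epsilon>)))} \<le> measure (init_measure p) {\<omega> \<in> space (init_measure p). hit_time \<rho> Z \<omega> \<le> ennreal (l * p powr (- \<gamma>))}"
            by (intro mono ev) (auto intro: order_trans)
        qed
      qed
      show "((\<lambda>l. Limsup (at_right 0) (\<lambda>p. ereal (measure (init_measure p)
          {\<omega> \<in> space (init_measure p). hit_time \<rho> Z \<omega> \<le> ennreal (l * p powr (- \<gamma>))}))) \<longlongrightarrow> 0) (at_right 0)"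
        using asymp unfolding prob_asymp_def prob_gtrsim_def by blast
    qed simp
  qed
  show ?thesis
    unfolding is_critical_power_def lower_power_def upper_power_def using \<gamma> less gtr by blast
qed

theorem theorem1p5:
  fixes r s1 s2 \<rho> :: nat and Z :: "(nat \<times> nat) set"
  assumes "1 \<le> s2" and "s2 < r" and "1 \<le> s1" and "\<rho> \<ge> max r s1"
    and "Z = {(u, v). v < r \<and> (u < s1 \<or> v < s2)}"
  shows "(\<exists>!\<gamma>. is_critical_power \<rho> Z \<gamma>)
       \<and> critical_power_pure \<rho> Z
       \<and> critical_power \<rho> Z = (real r * real s1 + real s2) / (1 + real s1)"
proof -
  interpret cross_growth r s1 s2 \<rho>
    by unfold_locales (use assms in auto)
  have Z: "Z = corner_zeros" using assms(5) by (simp add: corner_zeros_def)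
  have asymp: "prob_asymp init_measure (\<lambda>_. hit_time \<rho> Z) (\<lambda>p. p powr (- gam))"
    unfolding prob_asymp_def Z using hit_time_lesssim hit_time_gtrsim by blast
  have crit: "is_critical_power \<rho> Z gam"
    by (rule powers_of_asymp[OF gam_pos asymp])
  have unique: "\<gamma> = gam" if "is_critical_power \<rho> Z \<gamma>" for \<gamma>
    using that crit lower_power_le_upper_power unfolding is_critical_power_def by (meson order_antisym)
  have "critical_power \<rho> Z = gam"
    unfolding critical_power_def using crit unique by (rule the_equality)
  moreover from this have "critical_power_pure \<rho> Z"
    unfolding critical_power_pure_def using asymp by simp
  moreover have "\<exists>!\<gamma>. is_critical_power \<rho> Z \<gamma>"
    using crit unique by blast
  ultimately show ?thesis by (simp add: gam_def)
qed

end
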